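(* Let $\theta_0\in H^s$, $\theta_0\ne0$, $s>0$, consider the Gaussian sequence observation $Y$ and the posterior $\Pi_1$ described in the context, and let $\hat\Psi_0=\sum_{\mu=1}^p\left[(Y^\mu)^2-\frac1N\right]$, $\sigma^2=4\|\theta_0\|_2^2$. Assume $p\gg N^{\frac1{4s}}$. 1. If $\Pi(d\theta)=\prod_{\mu=1}^p\sigma_\mu^{-1}\exp(-H(\theta^\mu/\sigma_\mu))\,d\theta^\mu$ with $1\ll p\ll N/\ln N$, $\sigma\in(0,\infty)^p$, where $H:\mathbb{R}\to\mathbb{R}$ is twice differentiable with $\|H'\|_\infty<\infty$ and $\|H''\|_\infty<\infty$, and $\sigma_-=\min_{1\le\mu\le p}\sigma_\mu\gg N^{-1/2}$, then $$d_{BL}\left(\Pi_1\circ Z_N^{-1},\mathcal{N}(0,\sigma^2)\right)=O_p\left(p^{-s}+\sqrt{\frac{p\ln N}{N}}+\frac1{N\sigma_-^2}+\frac{\sqrt p}{N\sigma_-}\right)=o_p(1),$$ where $$Z_N:=\sqrt N\left(\sum_{\mu=1}^p\left\{(\theta^\mu)^2+N^{-1}\sigma_\mu^{-1}H'(\theta^\mu/\sigma_\mu)(Y^\mu+\theta^\mu)\right\}-\frac{2p}N-\hat\Psi_0\right).$$ In particular, if in addition $s>1/4$ and $N^{\frac1{4s}}\ll p\ll N/\ln N$, the BvM phenomenon with centring $\hat\Psi_0$ and asymptotic variance $\sigma^2$ holds for the functional $\theta\mapsto\sum_{\mu=1}^p\{(\theta^\mu)^2+N^{-1}\sigma_\mu^{-1}H'(\theta^\mu/\sigma_\mu)(Y^\mu+\theta^\mu)\}-\frac{2p}N$.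 2. If $\Pi=\mathcal{N}(0,\mathrm{Diag}(\sigma_1^2,\dots,\sigma_p^2))$ with $\sigma_\mu\ge c(N^{-1/2}\vee|\theta_0^\mu|)$ for all $1\le\mu\le p$, for a fixed $c>0$, and $p\ll N/\ln N$, then $$d_{BL}\left(\Pi_1\circ Z_N^{-1},\mathcal{N}(0,\sigma^2)\right)=O_p\left(p^{-s}+\sqrt{\frac{p\ln N}N}\right)=o_p(1),$$ where $$Z_N:=\sqrt N\left(\sum_{\mu=1}^p\left\{(\theta^\mu)^2+N^{-1}\sigma_\mu^{-2}\theta^\mu(Y^\mu+\theta^\mu)\right\}-\frac{2p}N-\hat\Psi_0\right).$$ In particular, if in addition $s>1/4$ and $N^{\frac1{4s}}\ll p\ll N/\ln N$, the BvM phenomenon with centring $\hat\Psi_0$ and asymptotic variance $\sigma^2$ holds for the functional $\theta\mapsto\sum_{\mu=1}^p\{(\theta^\mu)^2+N^{-1}\sigma_\mu^{-2}\theta^\mu(Y^\mu+\theta^\mu)\}-\frac{2p}N$.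
   Context: Observation: $Y^\mu=\theta_0^\mu+N^{-1/2}\varepsilon^\mu$, $\mu\ge1$, with $\varepsilon^\mu$ i.i.d. $\mathcal{N}(0,1)$, where $\theta_0\in\ell^2(\mathbb{N}^* )$ is fixed and unknown. $H^s=\{\theta\in\ell^2:\sum_{\mu\ge1}\mu^{2s}(\theta^\mu)^2<\infty\}$. Asymptotics are $N\to\infty$ with $p=p_N$ and $\sigma=(\sigma_\mu)_{\mu\le p}$ allowed to depend on $N$ ($H$, $\theta_0$, $s$ fixed); $a_N\ll b_N$ (equivalently $b_N\gg a_N$) means $a_N/b_N\to0$; $O_p,o_p$ refer to the law of $Y$ under $\theta_0$. Model and posterior: the parameter is $\theta\in\Theta=\mathbb{R}^p$, with log-likelihood (up to an additive constant) $\ell_1(\theta)=N\sum_{\mu=1}^pY^\mu\theta^\mu-\frac N2\|\theta\|_2^2$; for a (possibly improper) prior $\Pi$ on $\mathbb{R}^p$ the posterior is $\Pi_1(d\theta)\propto e^{\ell_1(\theta)}\Pi(d\theta)$. $\Pi_1\circ Z_N^{-1}$ is the law of $Z_N(\theta)$ for $\theta\sim\Pi_1$ with $Y$ fixed. For probability measures $\mu,\nu$ on $\mathbb{R}$, $d_{BL}(\mu,\nu)=\sup\{|\int h\,d(\mu-\nu)|:\ h:\mathbb{R}\to[-1,1],\ |h(x)-h(y)|\le|x-y|\}$. The BvM phenomenon with centring $\hat\Psi_0$ and asymptotic variance $\sigma^2>0$ holds for functionals $\Phi_N:\Theta\to\mathbb{R}$ if $d_{BL}(\Pi_1\circ(\sqrt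 N(\Phi_N-\hat\Psi_0))^{-1},\mathcal{N}(0,\sigma^2))=o_p(1)$. *)

theory Defs
  imports "HOL-Probability.Probability" "HOL-Library.Landau_Symbols"
begin

text \<open>Sequences are indexed by \<open>\<mu> \<ge> 1\<close>; the entry at index \<open>0\<close> is never used.\<close>

definition l2 :: "(nat \<Rightarrow> real) set" where
  "l2 = {\<theta>. (\<lambda>\<mu>. (\<theta> \<mu>)\<^sup>2) summable_on {1..}}"

definition l2_norm :: "(nat \<Rightarrow> real) \<Rightarrow> real" where
  "l2_norm \<theta> = sqrt (\<Sum>\<^sub>\<infinity>\<mu>\<in>{1..}. (\<theta> \<mu>)\<^sup>2)"

definition sobolev :: "real \<Rightarrow> (nat \<Rightarrow> real) set" where
  "sobolev s = {\<theta> \<in> l2. (\<lambda>\<mu>. real \<mu> powr (2 * s) * (\<theta> \<mu>)\<^sup>2) summable_on {1..}}"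

definition iid_std_normal :: "'a measure \<Rightarrow> (nat \<Rightarrow> 'a \<Rightarrow> real) \<Rightarrow> bool" where
  "iid_std_normal M \<epsilon> \<longleftrightarrow>
     prob_space.indep_vars M (\<lambda>_. borel) \<epsilon> {1..} \<and>
     (\<forall>\<mu>\<ge>1. distributed M lborel (\<epsilon> \<mu>) std_normal_density)"

definition obs :: "(nat \<Rightarrow> real) \<Rightarrow> (nat \<Rightarrow> 'a \<Rightarrow> real) \<Rightarrow> nat \<Rightarrow> 'a \<Rightarrow> nat \<Rightarrow> real" where
  "obs \<theta>0 \<epsilon> N \<omega> = (\<lambda>\<mu>. \<theta>0 \<mu> + real N powr (-1/2) * \<epsilon> \<mu> \<omega>)"

text \<open>The second parameter is the variance, not the standard deviation.\<close>

definition normal_dist :: "real \<Rightarrow> real \<Rightarrow> real measure" where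
  "normal_dist m v = density lborel (\<lambda>x. ennreal (normal_density m (sqrt v) x))"

definition d_BL :: "real measure \<Rightarrow> real measure \<Rightarrow> real" where
  "d_BL P Q = (SUP h \<in> {h. range h \<subseteq> {-1..1} \<and> 1-lipschitz_on UNIV h}.
                 \<bar>(LINT x|P. h x) - (LINT x|Q. h x)\<bar>)"

text \<open>Stochastic order symbols. The outer measure agrees with the measure on events, and keeps
  the definitions meaningful without assuming that \<open>X N\<close> is measurable.\<close>

definition is_Op :: "'a measure \<Rightarrow> (nat \<Rightarrow> 'a \<Rightarrow> real) \<Rightarrow> (nat \<Rightarrow> real) \<Rightarrow> bool" where
  "is_Op M X r \<longleftrightarrow> (\<forall>\<delta>>0. \<exists>K>0. \<forall>\<^sub>F N in sequentially.
     outer_measure_of M {\<omega> \<in> space M. \<bar>X N \<omega>\<bar> > K * \<bar>r N\<bar>} \<le> ennreal \<delta>)"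

definition is_op :: "'a measure \<Rightarrow> (nat \<Rightarrow> 'a \<Rightarrow> real) \<Rightarrow> (nat \<Rightarrow> real) \<Rightarrow> bool" where
  "is_op M X r \<longleftrightarrow> (\<forall>\<eta>>0. \<forall>\<delta>>0. \<forall>\<^sub>F N in sequentially.
     outer_measure_of M {\<omega> \<in> space M. \<bar>X N \<omega>\<bar> > \<eta> * \<bar>r N\<bar>} \<le> ennreal \<delta>)"

text \<open>\<open>\<real>\<^sup>p\<close> is represented by the extensional functions on \<open>{1..p}\<close>, the space of
  \<open>lborel_p p\<close>.\<close>

definition lborel_p :: "nat \<Rightarrow> (nat \<Rightarrow> real) measure" where
  "lborel_p p = PiM {1..p} (\<lambda>_. lborel)"

definition log_lik :: "nat \<Rightarrow> nat \<Rightarrow> (nat \<Rightarrow> real) \<Rightarrow> (nat \<Rightarrow> real) \<Rightarrow> real" where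
  "log_lik N p Y \<theta> =
     real N * (\<Sum>\<mu>=1..p. Y \<mu> * \<theta> \<mu>) - real N / 2 * (\<Sum>\<mu>=1..p. (\<theta> \<mu>)\<^sup>2)"

definition posterior ::
  "nat \<Rightarrow> nat \<Rightarrow> (nat \<Rightarrow> real) measure \<Rightarrow> (nat \<Rightarrow> real) \<Rightarrow> (nat \<Rightarrow> real) measure" where
  "posterior N p prior Y =
     density prior (\<lambda>\<theta>. ennreal (exp (log_lik N p Y \<theta>)) /
                     (\<integral>\<^sup>+\<theta>'. ennreal (exp (log_lik N p Y \<theta>')) \<partial>prior))"

definition product_prior ::
  "(real \<Rightarrow> real) \<Rightarrow> nat \<Rightarrow> (nat \<Rightarrow> real) \<Rightarrow> (nat \<Rightarrow> real) measure" where
  "product_prior H p \<sigma> =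
     density (lborel_p p) (\<lambda>\<theta>. ennreal (\<Prod>\<mu>=1..p. exp (- H (\<theta> \<mu> / \<sigma> \<mu>)) / \<sigma> \<mu>))"

definition gaussian_prior :: "nat \<Rightarrow> (nat \<Rightarrow> real) \<Rightarrow> (nat \<Rightarrow> real) measure" where
  "gaussian_prior p \<sigma> = PiM {1..p} (\<lambda>\<mu>. normal_dist 0 ((\<sigma> \<mu>)\<^sup>2))"

definition Psi_hat :: "nat \<Rightarrow> nat \<Rightarrow> (nat \<Rightarrow> real) \<Rightarrow> real" where
  "Psi_hat N p Y = (\<Sum>\<mu>=1..p. (Y \<mu>)\<^sup>2 - 1 / real N)"

definition Phi_product ::
  "(real \<Rightarrow> real) \<Rightarrow> nat \<Rightarrow> nat \<Rightarrow> (nat \<Rightarrow> real) \<Rightarrow> (nat \<Rightarrow> real) \<Rightarrow> (nat \<Rightarrow> real) \<Rightarrow> real" where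
  "Phi_product H N p \<sigma> Y \<theta> =
     (\<Sum>\<mu>=1..p. (\<theta> \<mu>)\<^sup>2 + 1 / (real N * \<sigma> \<mu>) * deriv H (\<theta> \<mu> / \<sigma> \<mu>) * (Y \<mu> + \<theta> \<mu>))
     - 2 * real p / real N"

definition Phi_gaussian ::
  "nat \<Rightarrow> nat \<Rightarrow> (nat \<Rightarrow> real) \<Rightarrow> (nat \<Rightarrow> real) \<Rightarrow> (nat \<Rightarrow> real) \<Rightarrow> real" where
  "Phi_gaussian N p \<sigma> Y \<theta> =
     (\<Sum>\<mu>=1..p. (\<theta> \<mu>)\<^sup>2 + 1 / (real N * (\<sigma> \<mu>)\<^sup>2) * \<theta> \<mu> * (Y \<mu> + \<theta> \<mu>))
     - 2 * real p / real N"

text \<open>The posterior \<open>post\<close> and the centring \<open>\<Psi>\<close> depend on \<open>N\<close> and the data;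
  the functional \<open>\<Phi>\<close> may do so as well.\<close>

definition bvm_dist ::
  "(nat \<Rightarrow> 'a \<Rightarrow> (nat \<Rightarrow> real) measure) \<Rightarrow> (nat \<Rightarrow> 'a \<Rightarrow> (nat \<Rightarrow> real) \<Rightarrow> real) \<Rightarrow>
   (nat \<Rightarrow> 'a \<Rightarrow> real) \<Rightarrow> real \<Rightarrow> nat \<Rightarrow> 'a \<Rightarrow> real" where
  "bvm_dist post \<Phi> \<Psi> v N \<omega> =
     d_BL (distr (post N \<omega>) borel (\<lambda>\<theta>. sqrt (real N) * (\<Phi> N \<omega> \<theta> - \<Psi> N \<omega>))) (normal_dist 0 v)"

definition bvm_phenomenon ::
  "'a measure \<Rightarrow> (nat \<Rightarrow> 'a \<Rightarrow> (nat \<Rightarrow> real) measure) \<Rightarrow>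
   (nat \<Rightarrow> 'a \<Rightarrow> (nat \<Rightarrow> real) \<Rightarrow> real) \<Rightarrow> (nat \<Rightarrow> 'a \<Rightarrow> real) \<Rightarrow> real \<Rightarrow> bool" where
  "bvm_phenomenon M post \<Phi> \<Psi> v \<longleftrightarrow> v > 0 \<and> is_op M (bvm_dist post \<Phi> \<Psi> v) (\<lambda>_. 1)"

end

theory Submission
  imports Defs
begin

text \<open>
  Fix the data \<open>y\<close>. The posterior is a product of densities \<open>q\<^sub>i\<close>; let
  \<open>S\<^sub>i = - q\<^sub>i' / (N q\<^sub>i)\<close>, which equals \<open>\<theta>\<^sub>i - y\<^sub>i + h\<^sub>i(\<theta>\<^sub>i) / N\<close> with
  \<open>h\<^sub>i\<close> the derivative of the negative log-prior. The correction terms in the functional are such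
  that the rescaled and centred functional is exactly
  \<open>Z = \<surd>N \<Sum>\<^sub>i ((\<theta>\<^sub>i + y\<^sub>i) S\<^sub>i - 1 / N)\<close>.
  Integration by parts in each coordinate gives \<open>E (Z f(Z)) = E (T f'(Z))\<close> for all bounded
  \<open>f\<close> with bounded derivative, where
  \<open>T = \<Sum>\<^sub>i ((\<theta>\<^sub>i + y\<^sub>i) S\<^sub>i + (\<theta>\<^sub>i + y\<^sub>i)\<^sup>2 S\<^sub>i')\<close>. Stein's method
  for the normal law of variance \<open>v\<close> therefore bounds the distance of the law of \<open>Z\<close> to it by
  \<open>4 / v \<sqdot> E \<bar>T - v\<bar>\<close>, with no remainder of higher order. Second moments of the scores show that \<open>T\<close> is
  close to \<open>4 \<Sum>\<^sub>i y\<^sub>i\<^sup>2\<close>, which under \<open>\<theta>\<^sub>0\<close> is close to \<open>v = 4 \<parallel>\<theta>\<^sub>0\<parallel>\<^sup>2\<close>. All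
  errors are controlled in expectation, and Markov's inequality turns this into the stochastic orders.
\<close>

section \<open>Solutions of the Stein equation\<close>

text \<open>The correction terms come from a factorisation: \<theta>^2 - y^2 + h(\<theta>) (\<theta>
  + y) / N = (\<theta> + y) S. The prior thus enters only through the score, for which integration
  by parts is exact. Near \<theta> = y the factor \<theta> + y is about 2 y and S' about 1, whence
  \<open>T\<close> is about 4 \<Sum> y^2. The deviation has a part linear in the scores, with mean
  zero and uncorrelated over coordinates, hence of total order N^(-1/2); the part quadratic in the
  scores is summed in absolute value and costs p / N. Both are below sqrt (p ln N / N). A prior with
  bounded H' and H'' moves S by at most a / (N \<sigma>) and S' by at most b / (N \<sigma>^2);
  paired with \<Sum> |y|, which is at most of order sqrt p, the first shift gives sqrt p / (N
  \<sigma>), and paired with \<Sum> y^2 the second gives 1 / (N \<sigma>^2). For a Gaussian prior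
  the shift of S is unbounded, but S is affine and can be inverted; what is left is \<Sum> y^2 / (N
  \<sigma>^2), harmless because \<sigma> dominates both N^(-1/2) and the entries of
  \<theta>0.\<close>

lemma antiderivative_tendsto_at_top:
  fixes F g :: "real \<Rightarrow> real"
  assumes "\<And>x. (F has_real_derivative g x) (at x)" and "continuous_on UNIV g" and "integrable lborel g"
  shows "(F \<longlongrightarrow> F 0 + (\<integral>x. indicator {0..} x * g x \<partial>lborel)) at_top"
proof -
  have int: "integrable lborel (\<lambda>x. indicator {0..} x * g x)"
    using integrable_real_mult_indicator[OF _ assms(3), of "{0..}"] by (simp add: mult.commute)
  have "((\<lambda>y. \<integral>x. indicator {..y} x *\<^sub>R (indicator {0..} x * g x) \<partial>lborel) \<longlongrightarrow>
      (\<integral>x. indicator {0..} x * g x \<partial>lborel)) at_top"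
    by (rule tendsto_integral_at_top) (use int in auto)
  moreover have "\<forall>\<^sub>F y in at_top. (\<integral>x. indicator {..y} x *\<^sub>R (indicator {0..} x * g x) \<partial>lborel) = F y - F 0"
    using eventually_ge_at_top[of "0::real"]
  proof eventually_elim
    case (elim y)
    have "(\<integral>x. g x * indicator {0..y} x \<partial>lborel) = F y - F 0"
      using assms(1,2) elim by (intro integral_FTC_Icc_real) (auto simp: continuous_on_eq_continuous_at)
    moreover have "(\<lambda>x. indicator {..y} x *\<^sub>R (indicator {0..} x * g x)) = (\<lambda>x. g x * indicator {0..y} x)"
      by (auto split: split_indicator)
    ultimately show ?case by simp
  qed
  ultimately have "((\<lambda>y. F y - F 0) \<longlongrightarrow> (\<integral>x. indicator {0..} x * g x \<partial>lborel)) at_top"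
    using tendsto_cong by fast
  from tendsto_add[OF tendsto_const[of "F 0"] this] show ?thesis by simp
qed

text \<open>The limits of an antiderivative at the two ends differ by the integral of
  \<open>g\<close>, which vanishes, so one constant normalises both. The left end is expressed by
  reflection, so that bounds proved on the positive half-line apply to it as well.\<close>

lemma centred_antiderivative:
  fixes g :: "real \<Rightarrow> real"
  assumes cont: "continuous_on UNIV g" and int: "integrable lborel g" and "integral\<^sup>L lborel g = 0"
  obtains P where "\<And>x. (P has_real_derivative g x) (at x)"
    "(P \<longlongrightarrow> 0) at_top" "((\<lambda>x. P (- x)) \<longlongrightarrow> 0) at_top"
proof -
  obtain F where F: "\<And>x. (F has_real_derivative g x) (at x)"
    using einterval_antiderivative[of "-\<infinity>" "\<infinity>" g] cont
    by (auto simp: has_real_derivative_iff_has_vector_derivative continuous_on_eq_continuous_at)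
  define c where "c = F 0 + (\<integral>x. indicator {0..} x * g x \<partial>lborel)"
  have 1: "(F \<longlongrightarrow> c) at_top"
    unfolding c_def by (rule antiderivative_tendsto_at_top[OF F cont int])
  have cont': "continuous_on UNIV (\<lambda>x. - g (- x))"
    by (intro continuous_intros continuous_on_compose2[OF cont]) auto
  have int': "integrable lborel (\<lambda>x. - g (- x))"
    using lborel_integrable_real_affine[OF int, of "-1" 0] by simp
  have d': "((\<lambda>x. F (- x)) has_real_derivative - g (- x)) (at x)" for x
    using F[of "- x"] DERIV_mirror by blast
  have 2: "((\<lambda>x. F (- x)) \<longlongrightarrow> F 0 + (\<integral>x. indicator {0..} x * - g (- x) \<partial>lborel)) at_top"
    using antiderivative_tendsto_at_top[OF d' cont' int'] by simp
  have "(\<integral>x. indicator {0..} x * - g (- x) \<partial>lborel) = (\<integral>x. - (indicator {..0} x * g x) \<partial>lborel)"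
    by (subst lborel_integral_real_affine[where c="-1" and t=0])
       (auto intro!: Bochner_Integration.integral_cong split: split_indicator)
  also have "\<dots> = (\<integral>x. indicator {0<..} x * g x - g x \<partial>lborel)"
    by (intro Bochner_Integration.integral_cong) (auto split: split_indicator)
  also have "\<dots> = (\<integral>x. indicator {0<..} x * g x \<partial>lborel) - integral\<^sup>L lborel g"
    using int integrable_real_mult_indicator[OF _ int, of "{0<..}"]
    by (intro Bochner_Integration.integral_diff) (auto simp: mult.commute)
  also have "(\<integral>x. indicator {0<..} x * g x \<partial>lborel) = (\<integral>x. indicator {0..} x * g x \<partial>lborel)"
    using AE_lborel_singleton[of "0::real"] cont borel_measurable_continuous_onI[OF cont]
    by (intro integral_cong_AE) (auto elim!: eventually_mono split: split_indicator)
  finally have 3: "((\<lambda>x. F (- x)) \<longlongrightarrow> c) at_top" using 2 assms(3) by (simp add: c_def)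
  show ?thesis
  proof (rule that[of "\<lambda>x. F x - c"])
    show "((\<lambda>x. F x - c) has_real_derivative g x) (at x)" for x
      using F[of x] by (auto intro!: derivative_eq_intros)
    show "((\<lambda>x. F x - c) \<longlongrightarrow> 0) at_top" "((\<lambda>x. F (- x) - c) \<longlongrightarrow> 0) at_top"
      using tendsto_diff[OF 1 tendsto_const[of c]] tendsto_diff[OF 3 tendsto_const[of c]] by simp_all
  qed
qed

lemma normal_density_has_derivative:
  "v > 0 \<Longrightarrow> (normal_density 0 (sqrt v) has_real_derivative - (x / v) * normal_density 0 (sqrt v) x) (at x)"
  unfolding normal_density_def by (auto intro!: derivative_eq_intros simp: field_simps)

lemma normal_density_tendsto_at_top:
  "v > 0 \<Longrightarrow> (normal_density 0 (sqrt v) \<longlongrightarrow> 0) at_top"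
  unfolding normal_density_def by simp real_asymp

text \<open>The Gaussian tail inequality by monotonicity: for c = 1 and c = -1 the function B v / x
  \<phi> + c P tends to 0 and is nonincreasing on [x, \<infinity>), hence nonnegative at x. The
  coefficient keeps the endpoint x fixed, so the derivative of \<phi> contributes the factor z / x
  \<ge> 1 that beats \<open>g\<close>.\<close>

lemma mills_bound:
  fixes P g :: "real \<Rightarrow> real"
  assumes v: "v > 0" and P: "\<And>x. (P has_real_derivative g x) (at x)" "(P \<longlongrightarrow> 0) at_top"
    and g: "\<And>x. \<bar>g x\<bar> \<le> B * normal_density 0 (sqrt v) x" and x: "x > 0"
  shows "x * \<bar>P x\<bar> \<le> B * v * normal_density 0 (sqrt v) x"
proof -
  let ?\<phi> = "normal_density 0 (sqrt v)"
  have B: "B * ?\<phi> z \<ge> 0" for z using g[of z] by linarith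
  have *: "0 \<le> B * v / x * ?\<phi> x + c * P x" if c: "\<bar>c\<bar> = 1" for c
  proof (rule tendsto_upperbound)
    show "((\<lambda>y. B * v / x * ?\<phi> y + c * P y) \<longlongrightarrow> 0) at_top"
      using tendsto_add[OF tendsto_mult[OF tendsto_const[of "B * v / x"] normal_density_tendsto_at_top[OF v]]
          tendsto_mult[OF tendsto_const[of c] P(2)]] by simp
    show "\<forall>\<^sub>F y in at_top. B * v / x * ?\<phi> y + c * P y \<le> B * v / x * ?\<phi> x + c * P x"
      using eventually_ge_at_top[of x]
    proof eventually_elim
      case (elim y)
      show ?case
      proof (rule DERIV_nonpos_imp_nonincreasing[OF elim])
        fix z assume z: "x \<le> z" "z \<le> y"
        have "((\<lambda>y. B * v / x * ?\<phi> y + c * P y) has_real_derivative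
            B * v / x * (- (z / v) * ?\<phi> z) + c * g z) (at z)"
          by (intro DERIV_add DERIV_cmult P normal_density_has_derivative v)
        moreover have "B * v / x * (- (z / v) * ?\<phi> z) + c * g z \<le> 0"
        proof -
          have "c * g z \<le> B * ?\<phi> z" using g[of z] c by (metis abs_ge_self abs_mult mult_1 order_trans)
          also have "\<dots> \<le> (z / x) * (B * ?\<phi> z)"
            using mult_right_mono[OF _ B[of z], of 1 "z / x"] z x by simp
          finally show ?thesis using v x by (simp add: field_simps)
        qed
        ultimately show "\<exists>d. ((\<lambda>y. B * v / x * ?\<phi> y + c * P y) has_real_derivative d) (at z) \<and> d \<le> 0"
          by blast
      qed
    qed
  qed simp
  have "\<bar>P x\<bar> \<le> B * v / x * ?\<phi> x" using *[of 1] *[of "-1"] by auto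
  then show ?thesis using x by (simp add: field_simps)
qed

lemma prob_space_normal_dist: "v > 0 \<Longrightarrow> prob_space (normal_dist 0 v)"
  unfolding normal_dist_def by (rule prob_space_normal_density) simp

text \<open>Since \<phi>' = - (x / v) \<phi>, multiplying the Stein equation by \<phi> turns its
  left side into the derivative of v \<phi> f. Hence f is the antiderivative of (h - m) \<phi>
  divided by v \<phi>. The constant 4 / v is (2 + 2) / v: both x f and h - m are bounded by 2, and
  the equation expresses v f' as their sum.\<close>

lemma stein_solution:
  fixes h :: "real \<Rightarrow> real"
  assumes v: "v > 0" and cont: "continuous_on UNIV h" and h: "\<And>x. \<bar>h x\<bar> \<le> 1"
  obtains f f' K where "\<And>x. (f has_real_derivative f' x) (at x)" "continuous_on UNIV f'"
    "\<And>x. \<bar>f x\<bar> \<le> K" "\<And>x. \<bar>f' x\<bar> \<le> 4 / v"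
    "\<And>x. v * f' x - x * f x = h x - (LINT z|normal_dist 0 v. h z)"
proof -
  let ?\<phi> = "normal_density 0 (sqrt v)"
  interpret prob_space "normal_dist 0 v" by (rule prob_space_normal_dist[OF v])
  have [measurable]: "h \<in> borel_measurable borel" by (rule borel_measurable_continuous_onI[OF cont])
  define m where "m = (LINT z|normal_dist 0 v. h z)"
  define g where "g = (\<lambda>x. (h x - m) * ?\<phi> x)"
  have hint: "integrable (normal_dist 0 v) h"
    by (rule integrable_const_bound[where B=1]) (use h in \<open>auto simp: normal_dist_def\<close>)
  have m: "\<bar>m\<bar> \<le> 1"
  proof -
    have "\<bar>m\<bar> \<le> (LINT z|normal_dist 0 v. \<bar>h z\<bar>)" unfolding m_def by (rule integral_abs_bound)
    also have "\<dots> \<le> (LINT z|normal_dist 0 v. 1)"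
      by (rule integral_mono) (use h hint in auto)
    finally show ?thesis by (simp add: prob_space)
  qed
  have \<phi>pos: "?\<phi> x > 0" for x using v by (simp add: normal_density_pos)
  have cont\<phi>: "continuous_on UNIV ?\<phi>"
    by (rule DERIV_continuous_on) (rule has_field_derivative_at_within[OF normal_density_has_derivative[OF v]])
  have gcont: "continuous_on UNIV g" unfolding g_def by (intro continuous_intros cont cont\<phi>)
  have hm: "\<bar>h x - m\<bar> \<le> 2" for x using h[of x] m by linarith
  have gb: "\<bar>g x\<bar> \<le> 2 * ?\<phi> x" for x
    unfolding g_def abs_mult using mult_right_mono[OF hm[of x], of "?\<phi> x"] \<phi>pos[of x] by simp
  have \<phi>int: "integrable lborel ?\<phi>" using v by (simp add: integrable_normal_density)
  have gint: "integrable lborel g"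
    using borel_measurable_continuous_onI[OF gcont] gb
    by (intro Bochner_Integration.integrable_bound[OF integrable_mult_right[OF \<phi>int, of 2]] AE_I2)
       (auto intro: order_trans[OF gb abs_ge_self])
  have "integral\<^sup>L lborel g = (LINT z|normal_dist 0 v. h z - m)"
    unfolding normal_dist_def using \<phi>pos
    by (subst integral_density) (auto simp: g_def less_imp_le mult.commute)
  also have "\<dots> = 0" using hint by (simp add: m_def prob_space)
  finally obtain P where P: "\<And>x. (P has_real_derivative g x) (at x)"
    "(P \<longlongrightarrow> 0) at_top" "((\<lambda>x. P (- x)) \<longlongrightarrow> 0) at_top"
    using centred_antiderivative[OF gcont gint] by metis
  have xP: "\<bar>x * P x\<bar> \<le> 2 * v * ?\<phi> x" for x
  proof (cases x "0::real" rule: linorder_cases)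
    case greater
    then show ?thesis using mills_bound[OF v P(1,2) gb greater] by (simp add: abs_mult)
  next
    \<comment> \<open>The reflected antiderivative satisfies the hypotheses of the tail bound with
      the reflected, sign-changed integrand, since \<phi> is even.\<close>
    case less
    have 1: "((\<lambda>x. P (- x)) has_real_derivative - g (- x)) (at x)" for x
      using P(1)[of "- x"] DERIV_mirror by blast
    have 2: "\<bar>- g (- x)\<bar> \<le> 2 * ?\<phi> x" for x using gb[of "- x"] by (simp add: normal_density_def)
    show ?thesis using mills_bound[OF v 1 P(3) 2, of "- x"] less
      by (simp add: abs_mult normal_density_def)
  qed (use v \<phi>pos[of 0] in auto)
  define f where "f = (\<lambda>x. P x / (v * ?\<phi> x))"
  define f' where "f' = (\<lambda>x. (x * f x + (h x - m)) / v)"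
  have der: "(f has_real_derivative f' x) (at x)" for x
  proof -
    have "(f has_real_derivative (g x * (v * ?\<phi> x) - P x * (v * (- (x / v) * ?\<phi> x))) / ((v * ?\<phi> x) * (v * ?\<phi> x))) (at x)"
      unfolding f_def using \<phi>pos[of x] v
      by (intro DERIV_divide P DERIV_cmult normal_density_has_derivative) auto
    also have "(g x * (v * ?\<phi> x) - P x * (v * (- (x / v) * ?\<phi> x))) / ((v * ?\<phi> x) * (v * ?\<phi> x)) = f' x"
      unfolding f'_def f_def g_def using \<phi>pos[of x] v by (simp add: field_simps)
    finally show ?thesis .
  qed
  have fcont: "continuous_on A f" for A
    by (rule DERIV_continuous_on) (rule has_field_derivative_at_within[OF der])
  have xf: "\<bar>x * f x\<bar> \<le> 2" for x
    using xP[of x] v \<phi>pos[of x] by (simp add: f_def abs_mult field_simps)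
  \<comment> \<open>The bound on \<open>x * f x\<close> controls f only away from 0; near 0
    compactness does. The resulting K serves integrability alone and enters no estimate.\<close>
  have "compact (f ` {-1..1})" by (rule compact_continuous_image[OF fcont]) simp
  then obtain K where K: "\<And>x. x \<in> {-1..1} \<Longrightarrow> \<bar>f x\<bar> \<le> K"
    by (fastforce dest!: compact_imp_bounded simp: bounded_iff)
  show ?thesis
  proof (rule that[OF der])
    show "continuous_on UNIV f'" unfolding f'_def using v by (intro continuous_intros fcont cont) auto
    show "\<bar>f x\<bar> \<le> max K 2" for x
    proof (cases "\<bar>x\<bar> \<le> 1")
      case True then show ?thesis using K[of x] by (auto simp: abs_le_iff le_max_iff_disj)
    next
      case False
      then have "\<bar>f x\<bar> \<le> \<bar>x\<bar> * \<bar>f x\<bar>" using mult_right_mono[of 1 "\<bar>x\<bar>" "\<bar>f x\<bar>"] by simp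
      then show ?thesis using xf[of x] by (simp add: abs_mult)
    qed
    show "\<bar>f' x\<bar> \<le> 4 / v" for x
      using xf[of x] hm[of x] v unfolding f'_def by (simp add: divide_right_mono)
    show "v * f' x - x * f x = h x - (LINT z|normal_dist 0 v. h z)" for x
      using v by (simp add: f'_def m_def)
  qed
qed

section \<open>Integration by parts against product densities\<close>

text \<open>Asking for every \<beta> > 0 makes the class closed under products, by halving \<beta>,
  and integrable against any density with some Gaussian tail. All integrands below are built from
  the identity, bounded functions and Lipschitz scores, so closure rules settle their
  integrability.\<close>

definition slow_growth :: "(real \<Rightarrow> real) \<Rightarrow> bool" where
  "slow_growth g \<longleftrightarrow> g \<in> borel_measurable borel \<and>
     (\<forall>\<beta>>0. \<exists>C. \<forall>x. \<bar>g x\<bar> \<le> C * exp (\<beta> * x\<^sup>2))"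

lemma slow_growth_measurable[measurable_dest]: "slow_growth g \<Longrightarrow> g \<in> borel_measurable borel"
  by (simp add: slow_growth_def)

lemma slow_growthD: "slow_growth g \<Longrightarrow> \<beta> > 0 \<Longrightarrow> \<exists>C\<ge>0. \<forall>x. \<bar>g x\<bar> \<le> C * exp (\<beta> * x\<^sup>2)"
proof -
  assume "slow_growth g" "\<beta> > 0"
  then obtain C where C: "\<And>x. \<bar>g x\<bar> \<le> C * exp (\<beta> * x\<^sup>2)" unfolding slow_growth_def by blast
  from C[of 0] have "C \<ge> 0" by simp
  with C show ?thesis by blast
qed

lemma slow_growth_bounded:
  assumes "g \<in> borel_measurable borel" "\<And>x. \<bar>g x\<bar> \<le> K" shows "slow_growth g"
proof -
  have "\<bar>g x\<bar> \<le> K * exp (\<beta> * x\<^sup>2)" if "\<beta> > 0" for \<beta> x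
  proof -
    have "K \<ge> 0" using assms(2)[of 0] by linarith
    then have "K * 1 \<le> K * exp (\<beta> * x\<^sup>2)" using that by (intro mult_left_mono) auto
    then show ?thesis using assms(2)[of x] by linarith
  qed
  then show ?thesis using assms(1) unfolding slow_growth_def by blast
qed

lemma slow_growth_const: "slow_growth (\<lambda>_. c)"
  by (rule slow_growth_bounded[where K="\<bar>c\<bar>"]) auto

lemma slow_growth_id: "slow_growth (\<lambda>x. x)"
proof -
  have "\<bar>x\<bar> \<le> (1 + 1 / \<beta>) * exp (\<beta> * x\<^sup>2)" if "\<beta> > 0" for \<beta> x :: real
  proof -
    have "2 * \<bar>x\<bar> \<le> 1 + x\<^sup>2" using sum_squares_bound[of 1 "\<bar>x\<bar>"] by simp
    moreover have "x\<^sup>2 \<ge> 0" "1 / \<beta> > 0" "\<beta> * x\<^sup>2 \<ge> 0" using that by auto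
    \<comment> \<open>The surplus terms are there to complete a product whose second factor 1 +
      \<beta> x^2 lies below the exponential.\<close>
    ultimately have "\<bar>x\<bar> \<le> 1 + \<beta> * x\<^sup>2 + 1 / \<beta> + x\<^sup>2" by linarith
    also have "\<dots> = (1 + 1 / \<beta>) * (1 + \<beta> * x\<^sup>2)" using that by (simp add: field_simps)
    also have "\<dots> \<le> (1 + 1 / \<beta>) * exp (\<beta> * x\<^sup>2)"
      using that exp_ge_add_one_self[of "\<beta> * x\<^sup>2"] by (intro mult_left_mono) auto
    finally show ?thesis .
  qed
  then show ?thesis unfolding slow_growth_def by auto
qed

lemma slow_growth_add:
  assumes "slow_growth f" "slow_growth g" shows "slow_growth (\<lambda>x. f x + g x)"
proof -
  have "\<exists>C. \<forall>x. \<bar>f x + g x\<bar> \<le> C * exp (\<beta> * x\<^sup>2)" if \<beta>: "\<beta> > 0" for \<beta>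
  proof -
    obtain C D where "\<And>x. \<bar>f x\<bar> \<le> C * exp (\<beta> * x\<^sup>2)" "\<And>x. \<bar>g x\<bar> \<le> D * exp (\<beta> * x\<^sup>2)"
      using slow_growthD[OF assms(1) \<beta>] slow_growthD[OF assms(2) \<beta>] by blast
    then have "\<bar>f x + g x\<bar> \<le> (C + D) * exp (\<beta> * x\<^sup>2)" for x
      by (smt (verit, best) distrib_right)
    then show ?thesis by blast
  qed
  then show ?thesis using assms[THEN slow_growth_measurable] by (auto simp: slow_growth_def)
qed

lemma slow_growth_mult:
  assumes "slow_growth f" "slow_growth g" shows "slow_growth (\<lambda>x. f x * g x)"
proof -
  have "\<exists>C. \<forall>x. \<bar>f x * g x\<bar> \<le> C * exp (\<beta> * x\<^sup>2)" if \<beta>: "\<beta> > 0" for \<beta>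
  proof -
    have \<beta>2: "\<beta> / 2 > 0" using \<beta> by simp
    obtain C D where CD: "C \<ge> 0" "\<And>x. \<bar>f x\<bar> \<le> C * exp (\<beta> / 2 * x\<^sup>2)"
      "D \<ge> 0" "\<And>x. \<bar>g x\<bar> \<le> D * exp (\<beta> / 2 * x\<^sup>2)"
      using slow_growthD[OF assms(1) \<beta>2] slow_growthD[OF assms(2) \<beta>2] by blast
    have "\<bar>f x * g x\<bar> \<le> (C * D) * exp (\<beta> * x\<^sup>2)" for x
    proof -
      have "\<bar>f x * g x\<bar> \<le> (C * exp (\<beta> / 2 * x\<^sup>2)) * (D * exp (\<beta> / 2 * x\<^sup>2))"
        unfolding abs_mult using CD by (intro mult_mono) auto
      also have "\<dots> = (C * D) * exp (\<beta> / 2 * x\<^sup>2 + \<beta> / 2 * x\<^sup>2)" by (simp only: exp_add mult_ac)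
      finally show ?thesis by simp
    qed
    then show ?thesis by blast
  qed
  then show ?thesis using assms[THEN slow_growth_measurable] by (auto simp: slow_growth_def)
qed

lemma slow_growth_power: "slow_growth f \<Longrightarrow> slow_growth (\<lambda>x. f x ^ n)"
  by (induction n) (auto intro: slow_growth_const slow_growth_mult)

lemma slow_growth_diff:
  assumes "slow_growth f" "slow_growth g" shows "slow_growth (\<lambda>x. f x - g x)"
  using slow_growth_add[OF assms(1) slow_growth_mult[OF slow_growth_const[of "-1"] assms(2)]] by simp

lemma slow_growth_abs: "slow_growth f \<Longrightarrow> slow_growth (\<lambda>x. \<bar>f x\<bar>)"
  by (auto simp: slow_growth_def)

lemma slow_growth_lipschitz:
  fixes f :: "real \<Rightarrow> real"
  assumes der: "\<And>x. (f has_real_derivative f' x) (at x)" and "\<And>x. \<bar>f' x\<bar> \<le> L"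
  shows "slow_growth f"
proof -
  have cont: "continuous_on UNIV f"
    by (rule DERIV_continuous_on) (rule has_field_derivative_at_within[OF der])
  have *: "\<bar>f x\<bar> \<le> \<bar>\<bar>f 0\<bar> + L * \<bar>x\<bar>\<bar>" for x
  proof -
    have "norm (f x - f 0) \<le> L * norm (x - 0)"
      by (rule field_differentiable_bound[of UNIV f f'])
         (use assms in \<open>auto intro: has_field_derivative_at_within\<close>)
    then show ?thesis by simp
  qed
  have 1: "slow_growth (\<lambda>x. \<bar>f 0\<bar> + L * \<bar>x\<bar>)"
    by (intro slow_growth_add slow_growth_mult slow_growth_const slow_growth_abs slow_growth_id)
  then show ?thesis
    unfolding slow_growth_def using * borel_measurable_continuous_onI[OF cont]
    by (meson order_trans)
qed

lemmas slow_growth_intros = slow_growth_add slow_growth_diff slow_growth_mult slow_growth_power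
  slow_growth_const slow_growth_id slow_growth_abs

text \<open>A derivative is a pointwise limit of difference quotients. This is what makes
  \<open>S'\<close> measurable: it contains the second derivative of H, which exists but need not be
  continuous.\<close>

lemma borel_measurable_has_real_derivative:
  fixes f :: "real \<Rightarrow> real"
  assumes "\<And>x. (f has_real_derivative f' x) (at x)"
  shows "f' \<in> borel_measurable borel"
proof (rule borel_measurable_LIMSEQ_real)
  have cont: "continuous_on UNIV f"
    by (rule DERIV_continuous_on) (rule has_field_derivative_at_within[OF assms])
  have [measurable]: "f \<in> borel_measurable borel" by (rule borel_measurable_continuous_onI[OF cont])
  show "(\<lambda>n. (f (x + inverse (real (Suc n))) - f x) / inverse (real (Suc n))) \<longlonglongrightarrow> f' x" for x
  proof -
    have "((\<lambda>h. (f (x + h) - f x) / h) \<longlongrightarrow> f' x) (at 0)" using assms[of x] by (simp add: DERIV_def)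
    moreover have "filterlim (\<lambda>n. inverse (real (Suc n))) (at 0) sequentially"
      using LIMSEQ_inverse_real_of_nat by (auto simp: filterlim_at)
    ultimately show ?thesis by (rule filterlim_compose)
  qed
  show "(\<lambda>x. (f (x + inverse (real (Suc n))) - f x) / inverse (real (Suc n))) \<in> borel_measurable borel" for n
    by measurable
qed

lemma integrable_gaussian: "\<alpha> > 0 \<Longrightarrow> integrable lborel (\<lambda>x::real. exp (- \<alpha> * x\<^sup>2))"
proof -
  assume \<alpha>: "\<alpha> > 0"
  have "exp (- \<alpha> * x\<^sup>2) = sqrt (pi / \<alpha>) * normal_density 0 (sqrt (1 / (2 * \<alpha>))) x" for x
    using \<alpha> by (simp add: normal_density_def real_sqrt_divide field_simps)
  then show ?thesis using \<alpha> by (simp add: integrable_normal_density)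
qed

lemma integral_derivative_eq_0:
  fixes G g :: "real \<Rightarrow> real"
  assumes der: "\<And>x. (G has_real_derivative g x) (at x)" and int: "integrable lborel g"
    and \<alpha>: "\<alpha> > 0" and G: "\<And>x. \<bar>G x\<bar> \<le> C * exp (- \<alpha> * x\<^sup>2)"
  shows "integral\<^sup>L lborel g = 0"
proof (rule LIMSEQ_unique)
  show "(\<lambda>n. \<integral>x. indicator {- real n..real n} x *\<^sub>R g x \<partial>lborel) \<longlonglongrightarrow> integral\<^sup>L lborel g"
  proof (rule integral_dominated_convergence[where w="\<lambda>x. \<bar>g x\<bar>"])
    show "AE x in lborel. (\<lambda>n. indicat_real {- real n..real n} x *\<^sub>R g x) \<longlonglongrightarrow> g x"
    proof (rule AE_I2)
      fix x :: real
      have "\<forall>\<^sub>F n in sequentially. indicat_real {- real n..real n} x *\<^sub>R g x = g x"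
        using eventually_ge_at_top[of "nat \<lceil>\<bar>x\<bar>\<rceil>"]
      proof eventually_elim
        case (elim n)
        then have "\<bar>x\<bar> \<le> real n" by linarith
        then show ?case by (simp add: abs_le_iff)
      qed
      then show "(\<lambda>n. indicat_real {- real n..real n} x *\<^sub>R g x) \<longlonglongrightarrow> g x"
        by (rule tendsto_eventually)
    qed
  qed (use int in \<open>auto split: split_indicator\<close>)
  have "(\<integral>x. indicator {- real n..real n} x *\<^sub>R g x \<partial>lborel) = G (real n) - G (- real n)" for n
  proof -
    have si: "set_integrable lborel {- real n..real n} g"
      unfolding set_integrable_def using integrable_real_mult_indicator[OF _ int, of "{- real n..real n}"]
      by (simp add: mult.commute)
    \<comment> \<open>The gauge integral satisfies the fundamental theorem for every derivative;
      integrability of g then identifies it with the Lebesgue integral.\<close>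
    have "(g has_integral (G (real n) - G (- real n))) {- real n..real n}"
      by (rule fundamental_theorem_of_calculus)
         (auto simp: has_real_derivative_iff_has_vector_derivative[symmetric]
               intro: has_field_derivative_at_within[OF der])
    then show ?thesis
      using set_borel_integral_eq_integral(2)[OF si]
      by (simp add: integral_unique set_lebesgue_integral_def)
  qed
  moreover have "(\<lambda>n. G (real n) - G (- real n)) \<longlonglongrightarrow> 0"
  proof (rule tendsto_rabs_zero_cancel, rule tendsto_sandwich[OF _ _ tendsto_const])
    show "\<forall>\<^sub>F n in sequentially. \<bar>G (real n) - G (- real n)\<bar> \<le> 2 * C * exp (- \<alpha> * (real n)\<^sup>2)"
    proof (intro always_eventually allI)
      fix n show "\<bar>G (real n) - G (- real n)\<bar> \<le> 2 * C * exp (- \<alpha> * (real n)\<^sup>2)"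
        using G[of n] G[of "- real n"] by simp
    qed
    show "(\<lambda>n. 2 * C * exp (- \<alpha> * (real n)\<^sup>2)) \<longlonglongrightarrow> 0"
      using \<alpha> by real_asymp
  qed auto
  ultimately show "(\<lambda>n. \<integral>x. indicator {- real n..real n} x *\<^sub>R g x \<partial>lborel) \<longlonglongrightarrow> 0" by simp
qed

text \<open>\<open>S i\<close> is the score of the density \<open>q i\<close>, divided by \<open>- N\<close>.\<close>

locale score_family =
  fixes N :: real and I :: "'i set" and q S S' :: "'i \<Rightarrow> real \<Rightarrow> real"
    and y :: "'i \<Rightarrow> real" and L :: real
  assumes N: "N > 0" and I: "finite I"
    and q_nonneg: "\<And>i x. i \<in> I \<Longrightarrow> q i x \<ge> 0"
    and q_prob: "\<And>i. i \<in> I \<Longrightarrow> (\<integral>\<^sup>+x. ennreal (q i x) \<partial>lborel) = 1"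
    and q_der: "\<And>i x. i \<in> I \<Longrightarrow> (q i has_real_derivative - N * S i x * q i x) (at x)"
    and S_der: "\<And>i x. i \<in> I \<Longrightarrow> (S i has_real_derivative S' i x) (at x)"
    and S'_bound: "\<And>i x. i \<in> I \<Longrightarrow> \<bar>S' i x\<bar> \<le> L"
    and q_gauss: "\<And>i. i \<in> I \<Longrightarrow> \<exists>\<alpha>>0. \<exists>C. \<forall>x. q i x \<le> C * exp (- \<alpha> * x\<^sup>2)"
begin

text \<open>The point mass outside \<open>I\<close> is a dummy: the locale of product probability
  spaces requires a probability measure at every index, whereas the densities are controlled on
  \<open>I\<close> only.\<close>

definition \<nu> :: "'i \<Rightarrow> real measure" where
  "\<nu> i = (if i \<in> I then density lborel (\<lambda>x. ennreal (q i x)) else return borel 0)"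

definition P :: "('i \<Rightarrow> real) measure" where
  "P = PiM I (\<lambda>i. density lborel (\<lambda>x. ennreal (q i x)))"

lemma P_eq: "P = PiM I \<nu>"
  unfolding P_def by (intro PiM_cong) (auto simp: \<nu>_def)

lemma sets_\<nu>[measurable_cong, simp]: "sets (\<nu> i) = sets borel"
  by (simp add: \<nu>_def)

lemma q_measurable: "i \<in> I \<Longrightarrow> q i \<in> borel_measurable borel"
  by (rule borel_measurable_continuous_onI, rule DERIV_continuous_on)
     (rule has_field_derivative_at_within[OF q_der])

lemma S_slow: "i \<in> I \<Longrightarrow> slow_growth (S i)"
  using slow_growth_lipschitz S_der S'_bound by blast

lemma S'_slow: "i \<in> I \<Longrightarrow> slow_growth (S' i)"
  using slow_growth_bounded borel_measurable_has_real_derivative S_der S'_bound by blast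

lemma prob_space_\<nu>: "prob_space (\<nu> i)"
proof (cases "i \<in> I")
  case True
  then show ?thesis using q_measurable[OF True]
    by (auto intro!: prob_spaceI simp: \<nu>_def emeasure_density q_prob)
qed (auto simp: \<nu>_def intro: prob_space_return)

sublocale product_prob_space \<nu> I
  by (simp add: product_prob_space_def product_sigma_finite_def product_prob_space_axioms_def
      prob_space_\<nu> prob_space_imp_sigma_finite)

sublocale finite_product_prob_space \<nu> I
  by standard (rule I)

text \<open>Half of the Gaussian exponent of the density pays for the growth of
  \<open>g\<close>.\<close>

lemma slow_growth_times_density:
  assumes i: "i \<in> I" and g: "slow_growth g"
  shows "\<exists>\<alpha>>0. \<exists>C. \<forall>x. \<bar>g x * q i x\<bar> \<le> C * exp (- \<alpha> * x\<^sup>2)"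
proof -
  obtain \<alpha> C where \<alpha>: "\<alpha> > 0" and C: "\<And>x. q i x \<le> C * exp (- \<alpha> * x\<^sup>2)"
    using q_gauss[OF i] by blast
  have "\<alpha> / 2 > 0" using \<alpha> by simp
  then obtain D where D: "D \<ge> 0" "\<And>x. \<bar>g x\<bar> \<le> D * exp (\<alpha> / 2 * x\<^sup>2)"
    using slow_growthD[OF g] by blast
  have "\<bar>g x * q i x\<bar> \<le> (D * C) * exp (- (\<alpha> / 2) * x\<^sup>2)" for x
  proof -
    have "\<bar>g x * q i x\<bar> \<le> (D * exp (\<alpha> / 2 * x\<^sup>2)) * (C * exp (- \<alpha> * x\<^sup>2))"
      unfolding abs_mult using D C q_nonneg[OF i] by (intro mult_mono) auto
    also have "\<dots> = (D * C) * exp (\<alpha> / 2 * x\<^sup>2 + - \<alpha> * x\<^sup>2)" by (simp only: exp_add mult_ac)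
    also have "\<alpha> / 2 * x\<^sup>2 + - \<alpha> * x\<^sup>2 = - (\<alpha> / 2) * x\<^sup>2" by simp
    finally show ?thesis .
  qed
  then show ?thesis using \<open>\<alpha> / 2 > 0\<close> by blast
qed

lemma integrable_lborel_slow:
  assumes i: "i \<in> I" and g: "slow_growth g"
  shows "integrable lborel (\<lambda>x. g x * q i x)"
proof -
  obtain \<alpha> C where \<alpha>: "\<alpha> > 0" and C: "\<And>x. \<bar>g x * q i x\<bar> \<le> C * exp (- \<alpha> * x\<^sup>2)"
    using slow_growth_times_density[OF assms] by blast
  show ?thesis
  proof (rule Bochner_Integration.integrable_bound)
    show "integrable lborel (\<lambda>x. C * exp (- \<alpha> * x\<^sup>2))" using integrable_gaussian[OF \<alpha>] by simp
    show "(\<lambda>x. g x * q i x) \<in> borel_measurable lborel"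
      using g q_measurable[OF i] by (auto dest: slow_growth_measurable)
    show "AE x in lborel. norm (g x * q i x) \<le> norm (C * exp (- \<alpha> * x\<^sup>2))"
      using order_trans[OF C abs_ge_self] by (intro AE_I2) simp
  qed
qed

lemma integrable_\<nu>: "i \<in> I \<Longrightarrow> slow_growth g \<Longrightarrow> integrable (\<nu> i) g"
  using integrable_lborel_slow[of i g] q_measurable[of i] q_nonneg[of i]
  by (simp add: \<nu>_def integrable_density slow_growth_measurable mult.commute)

lemma integral_\<nu>: "i \<in> I \<Longrightarrow> slow_growth g \<Longrightarrow> integral\<^sup>L (\<nu> i) g = (\<integral>x. g x * q i x \<partial>lborel)"
  using q_measurable[of i] q_nonneg[of i]
  by (simp add: \<nu>_def integral_density slow_growth_measurable mult.commute)

text \<open>The derivative of F q is (F' - N F S) q, and its integral over the line is zero.\<close>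

lemma stein_1d:
  assumes i: "i \<in> I" and F: "\<And>x. (F has_real_derivative F' x) (at x)"
    and slow: "slow_growth F" "slow_growth F'"
  shows "(\<integral>x. F x * S i x \<partial>\<nu> i) = 1 / N * integral\<^sup>L (\<nu> i) F'"
proof -
  let ?g = "\<lambda>x. F' x - N * (F x * S i x)"
  have g: "slow_growth ?g" by (intro slow_growth_intros slow S_slow i)
  have FS: "slow_growth (\<lambda>x. F x * S i x)" by (intro slow_growth_intros slow S_slow i)
  obtain \<alpha> C where \<alpha>: "\<alpha> > 0" and C: "\<And>x. \<bar>F x * q i x\<bar> \<le> C * exp (- \<alpha> * x\<^sup>2)"
    using slow_growth_times_density[OF i slow(1)] by blast
  have "((\<lambda>x. F x * q i x) has_real_derivative ?g x * q i x) (at x)" for x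
    using DERIV_mult[OF F q_der[OF i], of x] by (simp add: algebra_simps)
  then have "(\<integral>x. ?g x * q i x \<partial>lborel) = 0"
    using integrable_lborel_slow[OF i g] \<alpha> C by (rule integral_derivative_eq_0)
  then have "integral\<^sup>L (\<nu> i) ?g = 0" by (simp add: integral_\<nu>[OF i g])
  then have "integral\<^sup>L (\<nu> i) F' - N * (\<integral>x. F x * S i x \<partial>\<nu> i) = 0"
    using integrable_\<nu>[OF i slow(2)] integrable_\<nu>[OF i FS] by simp
  then show ?thesis using N by (simp add: field_simps)
qed

lemma measurable_component_P[measurable]: "i \<in> I \<Longrightarrow> (\<lambda>x. x i) \<in> borel_measurable P"
  unfolding P_eq using measurable_component_singleton[of i I \<nu>] by (simp cong: measurable_cong_sets)

lemma prob_space_P: "prob_space P"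
  unfolding P_eq by (rule prob_space_PiM) (rule prob_space_\<nu>)

lemma component_P:
  assumes "i \<in> I" "slow_growth g"
  shows integrable_component: "integrable P (\<lambda>x. g (x i))"
    and integral_component: "(\<integral>x. g (x i) \<partial>P) = integral\<^sup>L (\<nu> i) g"
proof -
  have d: "distr P (\<nu> i) (\<lambda>x. x i) = \<nu> i"
    unfolding P_eq by (rule distr_PiM_component) (auto intro: prob_space_\<nu> assms)
  have m: "(\<lambda>x. x i) \<in> measurable P (\<nu> i)" using measurable_component_P[OF assms(1)]
    by (simp cong: measurable_cong_sets)
  have g: "g \<in> borel_measurable (\<nu> i)" using slow_growth_measurable[OF assms(2)]
    by (simp cong: measurable_cong_sets)
  show "integrable P (\<lambda>x. g (x i))"
    using integrable_distr[OF m, of g] d integrable_\<nu>[OF assms] by simp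
  show "(\<integral>x. g (x i) \<partial>P) = integral\<^sup>L (\<nu> i) g"
    using integral_distr[OF m g] d by simp
qed

text \<open>Fubini with coordinate \<open>i\<close> integrated first. It reduces identities under
  the product measure to one-dimensional integration by parts with the other coordinates
  frozen.\<close>

lemma integral_coordinate_eq_0:
  fixes \<phi> :: "('i \<Rightarrow> real) \<Rightarrow> real"
  assumes i: "i \<in> I" and int: "integrable P \<phi>"
    and 0: "\<And>x. (\<integral>z. \<phi> (x(i := z)) \<partial>\<nu> i) = 0"
  shows "integral\<^sup>L P \<phi> = 0"
proof -
  have "insert i (I - {i}) = I" using i by auto
  then show ?thesis
    using product_integral_insert[of "I - {i}" i \<phi>] int I 0 by (simp add: P_eq)
qed

end

section \<open>The Stein identity for the posterior functional\<close>

lemma integrable_times_bounded: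
  fixes f b :: "'a \<Rightarrow> real"
  assumes f: "integrable M f" and b: "b \<in> borel_measurable M" "\<And>x. \<bar>b x\<bar> \<le> K"
  shows "integrable M (\<lambda>x. f x * b x)"
proof (rule Bochner_Integration.integrable_bound)
  show "integrable M (\<lambda>x. f x * K)" using f by simp
  show "(\<lambda>x. f x * b x) \<in> borel_measurable M"
    using borel_measurable_integrable[OF f] b(1) by simp
  show "AE x in M. norm (f x * b x) \<le> norm (f x * K)"
    using order_trans[OF b(2) abs_ge_self] by (intro AE_I2) (simp add: abs_mult mult_left_mono)
qed

context score_family
begin

definition Z :: "('i \<Rightarrow> real) \<Rightarrow> real" where
  "Z x = sqrt N * (\<Sum>i\<in>I. (x i + y i) * S i (x i) - 1 / N)"

text \<open>The sum over i of N^(-1/2) (x_i + y_i) times the i-th partial derivative of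
  \<open>Z\<close>: a Stein kernel, which takes the place of the variance in the Gaussian Stein
  identity.\<close>

definition T :: "('i \<Rightarrow> real) \<Rightarrow> real" where
  "T x = (\<Sum>i\<in>I. (x i + y i) * S i (x i) + (x i + y i)\<^sup>2 * S' i (x i))"

lemma Z_measurable[measurable]: "Z \<in> borel_measurable P"
  and T_measurable[measurable]: "T \<in> borel_measurable P"
proof -
  have [measurable]: "(\<lambda>x. S i (x i)) \<in> borel_measurable P" "(\<lambda>x. S' i (x i)) \<in> borel_measurable P" if "i \<in> I" for i
    using measurable_compose[OF measurable_component_P[OF that]] S_slow[OF that] S'_slow[OF that]
    by (auto dest!: slow_growth_measurable)
  show "Z \<in> borel_measurable P" "T \<in> borel_measurable P"
    unfolding Z_def[abs_def] T_def[abs_def] by measurable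
qed

lemma T_integrable: "integrable P T"
  unfolding T_def[abs_def]
  by (intro Bochner_Integration.integrable_sum integrable_component slow_growth_intros S_slow S'_slow)

lemma Z_integrable: "integrable P Z"
  unfolding Z_def[abs_def]
  by (intro integrable_mult_right Bochner_Integration.integrable_sum
      integrable_component[where g="\<lambda>t. (t + y i) * S i t - 1 / N" for i] slow_growth_intros S_slow)

lemma Z_update:
  assumes i: "i \<in> I"
  shows "Z (x(i := w)) = sqrt N * ((w + y i) * S i w - 1 / N) +
           sqrt N * (\<Sum>j\<in>I - {i}. (x j + y j) * S j (x j) - 1 / N)"
proof -
  have "(\<Sum>j\<in>I. ((x(i := w)) j + y j) * S j ((x(i := w)) j) - 1 / N) =
     ((w + y i) * S i w - 1 / N) + (\<Sum>j\<in>I - {i}. ((x(i := w)) j + y j) * S j ((x(i := w)) j) - 1 / N)"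
    by (subst sum.remove[OF I i]) simp
  also have "(\<Sum>j\<in>I - {i}. ((x(i := w)) j + y j) * S j ((x(i := w)) j) - 1 / N) =
      (\<Sum>j\<in>I - {i}. (x j + y j) * S j (x j) - 1 / N)"
    by (intro sum.cong) auto
  finally show ?thesis unfolding Z_def by (simp only: distrib_left)
qed

text \<open>In coordinate i, \<open>stein_1d\<close> is applied to (w + y_i) f(Z), with Z seen as a
  function of w. Its derivative has two parts: differentiating w + y_i yields f(Z) / N, which
  cancels the centring 1 / N in \<open>Z\<close>, and differentiating f(Z) yields the i-th summand
  of \<open>T\<close>.\<close>

lemma stein_identity:
  fixes f f' :: "real \<Rightarrow> real"
  assumes f: "\<And>t. (f has_real_derivative f' t) (at t)" and f'cont: "continuous_on UNIV f'"
    and fb: "\<And>t. \<bar>f t\<bar> \<le> K" and f'b: "\<And>t. \<bar>f' t\<bar> \<le> K'"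
  shows "(\<integral>x. Z x * f (Z x) \<partial>P) = (\<integral>x. T x * f' (Z x) \<partial>P)"
proof -
  have fcont: "continuous_on UNIV f"
    by (rule DERIV_continuous_on) (rule has_field_derivative_at_within[OF f])
  have [measurable]: "f \<in> borel_measurable borel" "f' \<in> borel_measurable borel"
    using fcont f'cont by (auto intro: borel_measurable_continuous_onI)
  \<comment> \<open>The defect of integration by parts in coordinate i; multiplied by sqrt N and
    summed over i it is Z f(Z) - T f'(Z).\<close>
  define \<phi> where "\<phi> i x = (x i + y i) * S i (x i) * f (Z x) - 1 / N *
      (f (Z x) + (x i + y i) * (sqrt N * (S i (x i) + (x i + y i) * S' i (x i))) * f' (Z x))" for i x
  have int1: "integrable P (\<lambda>x. ((x i + y i) * S i (x i)) * f (Z x))" if "i \<in> I" for i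
    by (rule integrable_times_bounded[OF integrable_component[OF that, where g="\<lambda>t. (t + y i) * S i t"]])
       (auto intro!: slow_growth_intros S_slow that fb)
  have int2: "integrable P (\<lambda>x. ((x i + y i) * (sqrt N * (S i (x i) + (x i + y i) * S' i (x i)))) * f' (Z x))"
    if "i \<in> I" for i
    by (rule integrable_times_bounded[OF integrable_component[OF that,
          where g="\<lambda>t. (t + y i) * (sqrt N * (S i t + (t + y i) * S' i t))"]])
       (auto intro!: slow_growth_intros S_slow S'_slow that f'b)
  interpret PP: prob_space P by (rule prob_space_P)
  have int0: "integrable P (\<lambda>x. f (Z x))"
    by (rule PP.integrable_const_bound[where B=K]) (use fb in auto)
  have int: "integrable P (\<phi> i)" if "i \<in> I" for i
    unfolding \<phi>_def using int1[OF that] int2[OF that] int0 by simp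
  have \<phi>0: "integral\<^sup>L P (\<phi> i) = 0" if i: "i \<in> I" for i
  proof (rule integral_coordinate_eq_0[OF i int[OF i]])
    fix x :: "'i \<Rightarrow> real"
    define r where "r = sqrt N * (\<Sum>j\<in>I - {i}. (x j + y j) * S j (x j) - 1 / N)"
    \<comment> \<open>\<open>u\<close> is Z along coordinate i. The remaining coordinates contribute
      only the constant \<open>r\<close>, so u' involves the score of coordinate i alone.\<close>
    define u where "u w = sqrt N * ((w + y i) * S i w - 1 / N) + r" for w
    define u' where "u' w = sqrt N * (S i w + (w + y i) * S' i w)" for w
    define F where "F w = (w + y i) * f (u w)" for w
    define F' where "F' w = f (u w) + (w + y i) * (f' (u w) * u' w)" for w
    have Zu: "Z (x(i := w)) = u w" for w using Z_update[OF i] by (simp add: u_def r_def)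
    have u: "(u has_real_derivative u' w) (at w)" for w
    proof -
      have "((\<lambda>w. sqrt N * ((w + y i) * S i w - 1 / N) + r) has_real_derivative
          sqrt N * ((1 * S i w + S' i w * (w + y i)) - 0) + 0) (at w)"
        by (rule DERIV_add[OF DERIV_cmult[OF DERIV_diff[OF DERIV_mult[OF _ S_der[OF i]]]]])
           (auto intro!: derivative_eq_intros)
      then show ?thesis by (simp add: u_def[abs_def] u'_def algebra_simps)
    qed
    have [measurable]: "u \<in> borel_measurable borel"
      unfolding u_def[abs_def] using slow_growth_measurable[OF S_slow[OF i]] by measurable
    have F: "(F has_real_derivative F' w) (at w)" for w
    proof -
      have "((\<lambda>w. (w + y i) * f (u w)) has_real_derivative 1 * f (u w) + (f' (u w) * u' w) * (w + y i)) (at w)"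
        by (rule DERIV_mult[OF _ DERIV_chain2[OF f u]]) (auto intro!: derivative_eq_intros)
      then show ?thesis by (simp add: F_def[abs_def] F'_def algebra_simps)
    qed
    have fu: "slow_growth (\<lambda>w. f (u w))" by (rule slow_growth_bounded[where K=K]) (auto simp: fb)
    have f'u: "slow_growth (\<lambda>w. f' (u w))" by (rule slow_growth_bounded[where K=K']) (auto simp: f'b)
    have sF: "slow_growth F" unfolding F_def[abs_def] by (intro slow_growth_intros fu)
    have sF': "slow_growth F'"
      unfolding F'_def[abs_def] u'_def by (intro slow_growth_intros fu f'u S_slow S'_slow i)
    have "(\<integral>w. \<phi> i (x(i := w)) \<partial>\<nu> i) = (\<integral>w. F w * S i w - 1 / N * F' w \<partial>\<nu> i)"
      unfolding \<phi>_def Zu fun_upd_same by (simp add: F_def F'_def u'_def mult_ac)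
    also have "\<dots> = (\<integral>w. F w * S i w \<partial>\<nu> i) - 1 / N * integral\<^sup>L (\<nu> i) F'"
      using integrable_\<nu>[OF i slow_growth_mult[OF sF S_slow[OF i]]] integrable_\<nu>[OF i sF'] by simp
    also have "\<dots> = 0" using stein_1d[OF i F sF sF'] by simp
    finally show "(\<integral>w. \<phi> i (x(i := w)) \<partial>\<nu> i) = 0" .
  qed
  have "Z x * f (Z x) - T x * f' (Z x) = (\<Sum>i\<in>I. sqrt N * \<phi> i x)" for x
  proof -
    have "(\<Sum>i\<in>I. sqrt N * \<phi> i x) = (\<Sum>i\<in>I. sqrt N * ((x i + y i) * S i (x i) - 1 / N) * f (Z x)
        - ((x i + y i) * S i (x i) + (x i + y i)\<^sup>2 * S' i (x i)) * f' (Z x))"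
    proof (rule sum.cong[OF refl])
      fix i
      \<comment> \<open>The factor sqrt N from the chain rule and the outer sqrt N cancel 1 / N;
        writing N as r * r makes this a rational identity.\<close>
      have s: "sqrt N * (m * c - 1 / N * (c + a * (sqrt N * b) * c')) = sqrt N * (m - 1 / N) * c - a * b * c'"
        for a b c c' m
      proof -
        define r where "r = sqrt N"
        have r: "N = r * r" "r > 0" using N by (simp_all add: r_def)
        show ?thesis unfolding r_def[symmetric] unfolding r(1) using r(2) by (simp add: field_simps)
      qed
      show "sqrt N * \<phi> i x = sqrt N * ((x i + y i) * S i (x i) - 1 / N) * f (Z x)
        - ((x i + y i) * S i (x i) + (x i + y i)\<^sup>2 * S' i (x i)) * f' (Z x)"
        unfolding \<phi>_def s by (simp add: distrib_left power2_eq_square mult.assoc)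
    qed
    moreover have "Z x * c - T x * c' = (\<Sum>i\<in>I. sqrt N * ((x i + y i) * S i (x i) - 1 / N) * c
        - ((x i + y i) * S i (x i) + (x i + y i)\<^sup>2 * S' i (x i)) * c')" for c c'
      by (simp only: Z_def T_def sum_distrib_left sum_distrib_right sum_subtractf[symmetric])
    ultimately show ?thesis by simp
  qed
  then have "(\<integral>x. Z x * f (Z x) - T x * f' (Z x) \<partial>P) = (\<integral>x. (\<Sum>i\<in>I. sqrt N * \<phi> i x) \<partial>P)" by simp
  also have "\<dots> = (\<Sum>i\<in>I. sqrt N * integral\<^sup>L P (\<phi> i))"
    using int by (subst Bochner_Integration.integral_sum) auto
  also have "\<dots> = 0" using \<phi>0 by simp
  finally have *: "(\<integral>x. Z x * f (Z x) - T x * f' (Z x) \<partial>P) = 0" .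
  have "integrable P (\<lambda>x. Z x * f (Z x))"
    by (rule integrable_times_bounded[OF Z_integrable _ fb]) simp
  moreover have "integrable P (\<lambda>x. T x * f' (Z x))"
    by (rule integrable_times_bounded[OF T_integrable _ f'b]) simp
  ultimately show ?thesis using * by simp
qed

text \<open>With f solving the Stein equation for h, the difference of the integrals of h is E (v
  f'(Z) - Z f(Z)), which \<open>stein_identity\<close> turns into E ((v - T) f'(Z)). Only the
  uniform bound 4 / v on f' is left, independent of h.\<close>

lemma d_BL_le:
  assumes v: "v > 0"
  shows "\<bar>d_BL (distr P borel Z) (normal_dist 0 v)\<bar> \<le> 4 / v * (\<integral>x. \<bar>T x - v\<bar> \<partial>P)"
proof -
  let ?B = "4 / v * (\<integral>x. \<bar>T x - v\<bar> \<partial>P)"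
  let ?H = "{h :: real \<Rightarrow> real. range h \<subseteq> {-1..1} \<and> 1-lipschitz_on UNIV h}"
  let ?d = "\<lambda>h. \<bar>(LINT x|distr P borel Z. h x) - (LINT x|normal_dist 0 v. h x)\<bar>"
  interpret PP: prob_space P by (rule prob_space_P)
  have le: "?d h \<le> ?B" if h: "h \<in> ?H" for h
  proof -
    have cont: "continuous_on UNIV h" using h by (auto intro: lipschitz_on_continuous_on)
    have hb: "\<bar>h x\<bar> \<le> 1" for x using h by (fastforce simp: abs_le_iff)
    obtain f f' K where f: "\<And>x. (f has_real_derivative f' x) (at x)" "continuous_on UNIV f'"
      "\<And>x. \<bar>f x\<bar> \<le> K" "\<And>x. \<bar>f' x\<bar> \<le> 4 / v"
      and eq: "\<And>x. v * f' x - x * f x = h x - (LINT z|normal_dist 0 v. h z)"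
      using stein_solution[OF v cont hb] by metis
    have fcont: "continuous_on UNIV f"
      by (rule DERIV_continuous_on) (rule has_field_derivative_at_within[OF f(1)])
    have [measurable]: "h \<in> borel_measurable borel" "f \<in> borel_measurable borel" "f' \<in> borel_measurable borel"
      using fcont f(2) cont by (auto intro: borel_measurable_continuous_onI)
    have i1: "integrable P (\<lambda>x. Z x * f (Z x))"
      by (rule integrable_times_bounded[OF Z_integrable _ f(3)]) simp
    have i2: "integrable P (\<lambda>x. T x * f' (Z x))"
      by (rule integrable_times_bounded[OF T_integrable _ f(4)]) simp
    have i3: "integrable P (\<lambda>x. f' (Z x))"
      by (rule PP.integrable_const_bound[where B="4 / v"]) (use f(4) in auto)
    have i4: "integrable P (\<lambda>x. h (Z x))"
      by (rule PP.integrable_const_bound[where B=1]) (use hb in auto)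
    have "(LINT x|distr P borel Z. h x) - (LINT x|normal_dist 0 v. h x)
        = (\<integral>x. h (Z x) - (LINT z|normal_dist 0 v. h z) \<partial>P)"
      using i4 by (simp add: integral_distr PP.prob_space)
    also have "\<dots> = (\<integral>x. v * f' (Z x) - Z x * f (Z x) \<partial>P)" by (simp add: eq)
    also have "\<dots> = (\<integral>x. v * f' (Z x) - T x * f' (Z x) \<partial>P)"
      using i1 i2 i3 stein_identity[OF f] by simp
    finally have "?d h = \<bar>\<integral>x. v * f' (Z x) - T x * f' (Z x) \<partial>P\<bar>" by simp
    also have "\<dots> \<le> (\<integral>x. \<bar>v * f' (Z x) - T x * f' (Z x)\<bar> \<partial>P)" by (rule integral_abs_bound)
    also have "\<dots> \<le> (\<integral>x. 4 / v * \<bar>T x - v\<bar> \<partial>P)"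
    proof (rule integral_mono)
      fix x
      have "\<bar>v * f' (Z x) - T x * f' (Z x)\<bar> = \<bar>f' (Z x)\<bar> * \<bar>T x - v\<bar>"
        by (simp add: left_diff_distrib[symmetric] abs_mult abs_minus_commute)
      also have "\<dots> \<le> 4 / v * \<bar>T x - v\<bar>" by (rule mult_right_mono[OF f(4)]) simp
      finally show "\<bar>v * f' (Z x) - T x * f' (Z x)\<bar> \<le> 4 / v * \<bar>T x - v\<bar>" .
    qed (use i2 i3 T_integrable in auto)
    finally show ?thesis by simp
  qed
  \<comment> \<open>The zero function makes the supremum range over a nonempty set and bounds it
    below by 0, which gives the absolute value in the claim.\<close>
  have 0: "(\<lambda>_. 0) \<in> ?H" by (auto simp: lipschitz_on_def)
  have "d_BL (distr P borel Z) (normal_dist 0 v) \<le> ?B"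
    unfolding d_BL_def by (rule cSUP_least) (use 0 le in blast)+
  moreover have "d_BL (distr P borel Z) (normal_dist 0 v) \<ge> ?d (\<lambda>_. 0)"
    unfolding d_BL_def by (rule cSUP_upper[OF 0]) (use le in \<open>auto intro!: bdd_aboveI2\<close>)
  ultimately show ?thesis by simp
qed

text \<open>The test functions 1 and \<open>S i\<close> in \<open>stein_1d\<close>. The second case
  is the Fisher information identity, rescaled by N.\<close>

lemma score_moments:
  assumes i: "i \<in> I"
  shows score_mean: "(\<integral>x. S i (x i) \<partial>P) = 0"
    and score_second_moment: "(\<integral>x. (S i (x i))\<^sup>2 \<partial>P) = 1 / N * (\<integral>x. S' i (x i) \<partial>P)"
proof -
  have "integral\<^sup>L (\<nu> i) (S i) = 0"
    using stein_1d[OF i, of "\<lambda>_. 1" "\<lambda>_. 0"] by (simp add: slow_growth_const)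
  then show "(\<integral>x. S i (x i) \<partial>P) = 0" using integral_component[OF i S_slow[OF i]] by simp
  have "(\<integral>x. (S i x)\<^sup>2 \<partial>\<nu> i) = 1 / N * integral\<^sup>L (\<nu> i) (S' i)"
    using stein_1d[OF i S_der[OF i] S_slow[OF i] S'_slow[OF i]] by (simp add: power2_eq_square)
  then show "(\<integral>x. (S i (x i))\<^sup>2 \<partial>P) = 1 / N * (\<integral>x. S' i (x i) \<partial>P)"
    using integral_component[OF i S'_slow[OF i]]
      integral_component[OF i slow_growth_power[OF S_slow[OF i]], of 2] by simp
qed

lemma score_second_moment_le:
  assumes i: "i \<in> I"
  shows "(\<integral>x. (S i (x i))\<^sup>2 \<partial>P) \<le> L / N"
proof -
  interpret PP: prob_space P by (rule prob_space_P)
  have "(\<integral>x. S' i (x i) \<partial>P) \<le> (\<integral>x. L \<partial>P)"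
    by (rule integral_mono) (use integrable_component[OF i S'_slow[OF i]] S'_bound[OF i] in
        \<open>auto intro: order_trans[OF abs_ge_self]\<close>)
  then show ?thesis using score_second_moment[OF i] N by (simp add: PP.prob_space divide_right_mono)
qed

lemma score_square_integrable: "i \<in> I \<Longrightarrow> integrable P (\<lambda>x. (S i (x i))\<^sup>2)"
  by (rule integrable_component[where g="\<lambda>t. (S i t)\<^sup>2"]) (auto intro: slow_growth_power S_slow)

text \<open>With coordinate j frozen, the inner integral is a multiple of the mean of
  \<open>S i\<close>, which is zero.\<close>

lemma score_uncorrelated:
  assumes i: "i \<in> I" and j: "j \<in> I" and "i \<noteq> j"
  shows "integrable P (\<lambda>x. S i (x i) * S j (x j))" "(\<integral>x. S i (x i) * S j (x j) \<partial>P) = 0"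
proof -
  have [measurable]: "(\<lambda>x. S k (x k)) \<in> borel_measurable P" if "k \<in> I" for k
    using integrable_component[OF that S_slow[OF that]] by simp
  show *: "integrable P (\<lambda>x. S i (x i) * S j (x j))"
  proof (rule Bochner_Integration.integrable_bound)
    show "integrable P (\<lambda>x. (S i (x i))\<^sup>2 + (S j (x j))\<^sup>2)"
      using score_square_integrable[OF i] score_square_integrable[OF j] by simp
    show "AE x in P. norm (S i (x i) * S j (x j)) \<le> norm ((S i (x i))\<^sup>2 + (S j (x j))\<^sup>2)"
    proof (rule AE_I2)
      fix x
      have "2 * (\<bar>S i (x i)\<bar> * \<bar>S j (x j)\<bar>) \<le> (S i (x i))\<^sup>2 + (S j (x j))\<^sup>2"
        using sum_squares_bound[of "\<bar>S i (x i)\<bar>" "\<bar>S j (x j)\<bar>"] by simp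
      moreover have "\<bar>S i (x i)\<bar> * \<bar>S j (x j)\<bar> \<ge> 0" by simp
      ultimately show "norm (S i (x i) * S j (x j)) \<le> norm ((S i (x i))\<^sup>2 + (S j (x j))\<^sup>2)"
        unfolding real_norm_def abs_mult by linarith
    qed
  qed (use i j in measurable)
  have "(\<integral>z. S i z * S j (x j) \<partial>\<nu> i) = 0" for x
    using score_mean[OF i] integral_component[OF i S_slow[OF i]] by simp
  then show "(\<integral>x. S i (x i) * S j (x j) \<partial>P) = 0"
    using \<open>i \<noteq> j\<close> by (intro integral_coordinate_eq_0[OF i *]) simp
qed

end

text \<open>The square of the first absolute moment is at most the second moment, in which the cross
  terms vanish. It is used twice: for the scores under the posterior and for the noise under the law
  of the data.\<close>

lemma (in prob_space) expectation_abs_sum_uncorrelated_le: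
  fixes X :: "'i \<Rightarrow> 'a \<Rightarrow> real"
  assumes I: "finite I"
    and sq: "\<And>i. i \<in> I \<Longrightarrow> integrable M (\<lambda>\<omega>. (X i \<omega>)\<^sup>2)"
    and un: "\<And>i j. i \<in> I \<Longrightarrow> j \<in> I \<Longrightarrow> i \<noteq> j \<Longrightarrow> integrable M (\<lambda>\<omega>. X i \<omega> * X j \<omega>)"
      "\<And>i j. i \<in> I \<Longrightarrow> j \<in> I \<Longrightarrow> i \<noteq> j \<Longrightarrow> expectation (\<lambda>\<omega>. X i \<omega> * X j \<omega>) = 0"
    and m: "\<And>i. i \<in> I \<Longrightarrow> X i \<in> borel_measurable M"
    and B: "(\<Sum>i\<in>I. expectation (\<lambda>\<omega>. (X i \<omega>)\<^sup>2)) \<le> B"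
  shows "integrable M (\<lambda>\<omega>. \<bar>\<Sum>i\<in>I. X i \<omega>\<bar>)" "expectation (\<lambda>\<omega>. \<bar>\<Sum>i\<in>I. X i \<omega>\<bar>) \<le> sqrt B"
proof -
  let ?V = "\<lambda>\<omega>. \<bar>\<Sum>i\<in>I. X i \<omega>\<bar>"
  have exp: "(?V \<omega>)\<^sup>2 = (\<Sum>i\<in>I. \<Sum>j\<in>I. X i \<omega> * X j \<omega>)" for \<omega>
    by (simp add: power2_eq_square sum_product)
  have int: "integrable M (\<lambda>\<omega>. X i \<omega> * X j \<omega>)" if "i \<in> I" "j \<in> I" for i j
    using that sq[of i] un(1)[of i j] by (cases "i = j") (auto simp: power2_eq_square)
  have isq: "integrable M (\<lambda>\<omega>. (?V \<omega>)\<^sup>2)" unfolding exp using int by (intro Bochner_Integration.integrable_sum) auto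
  have mV: "?V \<in> borel_measurable M" using m by measurable
  show iV: "integrable M ?V"
    by (rule square_integrable_imp_integrable[OF mV isq])
  have "expectation (\<lambda>\<omega>. (?V \<omega>)\<^sup>2) = (\<Sum>i\<in>I. \<Sum>j\<in>I. expectation (\<lambda>\<omega>. X i \<omega> * X j \<omega>))"
    unfolding exp using int by (simp add: Bochner_Integration.integral_sum)
  also have "\<dots> = (\<Sum>i\<in>I. expectation (\<lambda>\<omega>. (X i \<omega>)\<^sup>2))"
  proof (rule sum.cong[OF refl])
    fix i assume i: "i \<in> I"
    show "(\<Sum>j\<in>I. expectation (\<lambda>\<omega>. X i \<omega> * X j \<omega>)) = expectation (\<lambda>\<omega>. (X i \<omega>)\<^sup>2)"
      using un(2)[OF i] by (subst sum.remove[OF I i]) (auto simp: power2_eq_square intro!: sum.neutral)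
  qed
  finally have "expectation (\<lambda>\<omega>. (?V \<omega>)\<^sup>2) \<le> B" using B by simp
  moreover have "(expectation ?V)\<^sup>2 \<le> expectation (\<lambda>\<omega>. (?V \<omega>)\<^sup>2)"
    using variance_positive[of ?V] variance_eq[OF iV isq] by linarith
  ultimately show "expectation ?V \<le> sqrt B"
    by (intro real_le_rsqrt) linarith
qed

text \<open>Each score has second moment at most L / N, and uncorrelatedness brings in the Euclidean
  norm of the coefficients rather than their absolute sum.\<close>

lemma (in score_family) expectation_abs_sum_score:
  shows "integrable P (\<lambda>x. \<bar>\<Sum>i\<in>I. a i * S i (x i)\<bar>)"
    "(\<integral>x. \<bar>\<Sum>i\<in>I. a i * S i (x i)\<bar> \<partial>P) \<le> sqrt (L / N * (\<Sum>i\<in>I. (a i)\<^sup>2))"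
proof -
  interpret PP: prob_space P by (rule prob_space_P)
  have 1: "integrable P (\<lambda>x. (a i * S i (x i))\<^sup>2)" if "i \<in> I" for i
    using score_square_integrable[OF that] by (simp add: power_mult_distrib)
  have prod: "a i * S i (x i) * (a j * S j (x j)) = a i * a j * (S i (x i) * S j (x j))" for i j x by simp
  have 2: "integrable P (\<lambda>x. a i * S i (x i) * (a j * S j (x j)))"
    "(\<integral>x. a i * S i (x i) * (a j * S j (x j)) \<partial>P) = 0" if "i \<in> I" "j \<in> I" "i \<noteq> j" for i j
    unfolding prod using score_uncorrelated[OF that] by simp_all
  have 3: "(\<lambda>x. a i * S i (x i)) \<in> borel_measurable P" if "i \<in> I" for i
    using integrable_component[OF that S_slow[OF that]] by simp
  have "(\<integral>x. (a i * S i (x i))\<^sup>2 \<partial>P) \<le> L / N * (a i)\<^sup>2" if "i \<in> I" for i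
    using mult_left_mono[OF score_second_moment_le[OF that], of "(a i)\<^sup>2"]
    by (simp add: power_mult_distrib mult.commute)
  then have 4: "(\<Sum>i\<in>I. (\<integral>x. (a i * S i (x i))\<^sup>2 \<partial>P)) \<le> L / N * (\<Sum>i\<in>I. (a i)\<^sup>2)"
    unfolding sum_distrib_left by (intro sum_mono) auto
  show "integrable P (\<lambda>x. \<bar>\<Sum>i\<in>I. a i * S i (x i)\<bar>)"
    "(\<integral>x. \<bar>\<Sum>i\<in>I. a i * S i (x i)\<bar> \<partial>P) \<le> sqrt (L / N * (\<Sum>i\<in>I. (a i)\<^sup>2))"
    using PP.expectation_abs_sum_uncorrelated_le[of I "\<lambda>i x. a i * S i (x i)", OF I 1 2 3 4] by blast+
qed

section \<open>Posteriors as product measures\<close>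

text \<open>The two measures need only be compared on rectangles, where indicator and density both
  factorise and the integral of the product is the product of the integrals.\<close>

lemma density_PiM:
  fixes f :: "'i \<Rightarrow> 'a \<Rightarrow> ennreal"
  assumes I: "finite I" and "product_sigma_finite M"
    and "product_sigma_finite (\<lambda>i. density (M i) (f i))"
    and f[measurable]: "\<And>i. i \<in> I \<Longrightarrow> f i \<in> borel_measurable (M i)"
  shows "density (PiM I M) (\<lambda>x. \<Prod>i\<in>I. f i (x i)) = PiM I (\<lambda>i. density (M i) (f i))"
proof -
  interpret M: product_sigma_finite M by fact
  interpret D: product_sigma_finite "\<lambda>i. density (M i) (f i)" by fact
  have [measurable]: "(\<lambda>x. f i (x i)) \<in> borel_measurable (PiM I M)" if "i \<in> I" for i
    using f[OF that] measurable_component_singleton[OF that] by (rule measurable_compose[rotated])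
  show ?thesis
  proof (rule D.PiM_eqI[OF I])
    show "sets (density (PiM I M) (\<lambda>x. \<Prod>i\<in>I. f i (x i))) = sets (PiM I (\<lambda>i. density (M i) (f i)))"
      unfolding sets_density by (rule sets_PiM_cong) auto
    fix A assume "\<And>i. i \<in> I \<Longrightarrow> A i \<in> sets (density (M i) (f i))"
    then have A[measurable]: "A i \<in> sets (M i)" if "i \<in> I" for i using that by simp
    have "emeasure (density (PiM I M) (\<lambda>x. \<Prod>i\<in>I. f i (x i))) (Pi\<^sub>E I A) =
        (\<integral>\<^sup>+x. (\<Prod>i\<in>I. f i (x i)) * indicator (Pi\<^sub>E I A) x \<partial>PiM I M)"
      by (rule emeasure_density) (use A I in \<open>auto intro!: sets_PiM_I_finite\<close>)
    also have "\<dots> = (\<integral>\<^sup>+x. (\<Prod>i\<in>I. f i (x i) * indicator (A i) (x i)) \<partial>PiM I M)"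
    proof (rule nn_integral_cong)
      fix x assume x: "x \<in> space (PiM I M)"
      show "(\<Prod>i\<in>I. f i (x i)) * indicator (Pi\<^sub>E I A) x = (\<Prod>i\<in>I. f i (x i) * indicator (A i) (x i))"
      proof (cases "x \<in> Pi\<^sub>E I A")
        case True
        then show ?thesis by (auto intro!: prod.cong simp: PiE_iff)
      next
        case False
        then obtain i where "i \<in> I" "x i \<notin> A i" using x by (auto simp: space_PiM PiE_iff)
        then have "(\<Prod>i\<in>I. f i (x i) * indicator (A i) (x i)) = 0"
          using I \<open>i \<in> I\<close> \<open>x i \<notin> A i\<close> by (intro prod_zero bexI[of _ i]) auto
        then show ?thesis using False by simp
      qed
    qed
    also have "\<dots> = (\<Prod>i\<in>I. (\<integral>\<^sup>+x. f i x * indicator (A i) x \<partial>M i))"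
      by (rule M.product_nn_integral_prod) (use I in auto)
    also have "\<dots> = (\<Prod>i\<in>I. emeasure (density (M i) (f i)) (A i))"
      by (intro prod.cong) (auto simp: emeasure_density)
    finally show "emeasure (density (PiM I M) (\<lambda>x. \<Prod>i\<in>I. f i (x i))) (Pi\<^sub>E I A) =
        (\<Prod>i\<in>I. emeasure (density (M i) (f i)) (A i))" .
  qed
qed

lemma product_sigma_finite_density_lborel:
  fixes f :: "'i \<Rightarrow> real \<Rightarrow> real"
  assumes "\<And>i. f i \<in> borel_measurable borel"
  shows "product_sigma_finite (\<lambda>i. density lborel (\<lambda>x. ennreal (f i x)))"
  using assms by (auto simp: product_sigma_finite_def sigma_finite_measure.sigma_finite_iff_density_finite[OF sigma_finite_lborel])

lemma density_lborel_p:
  fixes f :: "nat \<Rightarrow> real \<Rightarrow> real"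
  assumes "\<And>i. f i \<in> borel_measurable borel"
  shows "density (lborel_p p) (\<lambda>x. \<Prod>i=1..p. ennreal (f i (x i))) =
    PiM {1..p} (\<lambda>i. density lborel (\<lambda>x. ennreal (f i x)))"
  unfolding lborel_p_def
  by (rule density_PiM[OF _ _ product_sigma_finite_density_lborel])
     (use assms in \<open>auto simp: product_sigma_finite_def sigma_finite_lborel\<close>)

text \<open>The likelihood factorises over coordinates, so the normalising constant is the product
  of the one-dimensional ones. These are finite and positive, which keeps the extended division in
  \<open>posterior\<close> a genuine one; the weights \<open>w i\<close> themselves may have
  infinite mass, as for an improper prior.\<close>

lemma posterior_eq_PiM:
  fixes w :: "nat \<Rightarrow> real \<Rightarrow> real"
  assumes w[measurable]: "\<And>i. w i \<in> borel_measurable borel"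
    and w0: "\<And>i x. i \<in> {1..p} \<Longrightarrow> w i x \<ge> 0"
    and c: "\<And>i. i \<in> {1..p} \<Longrightarrow>
      (\<integral>\<^sup>+x. ennreal (w i x * exp (real N * (Y i * x - x\<^sup>2 / 2))) \<partial>lborel) = ennreal (c i)"
    and c0: "\<And>i. i \<in> {1..p} \<Longrightarrow> c i > 0"
  shows "posterior N p (density (lborel_p p) (\<lambda>\<theta>. \<Prod>i=1..p. ennreal (w i (\<theta> i)))) Y =
    PiM {1..p} (\<lambda>i. density lborel (\<lambda>x. ennreal (w i x * exp (real N * (Y i * x - x\<^sup>2 / 2)) / c i)))"
proof -
  define e where "e i x = exp (real N * (Y i * x - x\<^sup>2 / 2))" for i x
  have [measurable]: "e i \<in> borel_measurable borel" for i unfolding e_def[abs_def] by measurable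
  have e0: "e i x > 0" for i x by (simp add: e_def)
  have lik: "exp (log_lik N p Y \<theta>) = (\<Prod>i=1..p. e i (\<theta> i))" for \<theta>
    by (simp add: log_lik_def e_def exp_sum[symmetric] sum_distrib_left sum_subtractf[symmetric] algebra_simps)
  have [measurable]: "(\<lambda>\<theta>. \<theta> i) \<in> borel_measurable (lborel_p p)" if "i \<in> {1..p}" for i
    using measurable_component_singleton[OF that, of "\<lambda>_. lborel"] by (simp add: lborel_p_def cong: measurable_cong_sets)
  have [measurable]: "(\<lambda>\<theta>. g i (\<theta> i)) \<in> borel_measurable (lborel_p p)"
    if "i \<in> {1..p}" "\<And>i. g i \<in> borel_measurable borel" for i and g :: "nat \<Rightarrow> real \<Rightarrow> real"
    using that by measurable
  have mw: "(\<lambda>\<theta>. \<Prod>i=1..p. ennreal (w i (\<theta> i))) \<in> borel_measurable (lborel_p p)" by measurable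
  have me: "(\<lambda>\<theta>. ennreal (\<Prod>i=1..p. e i (\<theta> i))) \<in> borel_measurable (lborel_p p)" by measurable
  interpret product_sigma_finite "\<lambda>_::nat. lborel :: real measure"
    by (simp add: product_sigma_finite_def sigma_finite_lborel)
  have prod: "(\<Prod>i=1..p. ennreal (w i (\<theta> i))) * ennreal (\<Prod>i=1..p. e i (\<theta> i)) =
     (\<Prod>i=1..p. ennreal (w i (\<theta> i) * e i (\<theta> i)))" for \<theta>
    using w0 e0 by (simp add: prod_ennreal[symmetric] less_imp_le prod.distrib[symmetric] ennreal_mult)
  have "(\<integral>\<^sup>+\<theta>. ennreal (\<Prod>i=1..p. e i (\<theta> i)) \<partial>density (lborel_p p) (\<lambda>\<theta>. \<Prod>i=1..p. ennreal (w i (\<theta> i))))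
     = (\<integral>\<^sup>+\<theta>. (\<Prod>i=1..p. ennreal (w i (\<theta> i) * e i (\<theta> i))) \<partial>lborel_p p)"
    by (subst nn_integral_density[OF mw me]) (simp only: prod)
  also have "\<dots> = (\<Prod>i=1..p. ennreal (c i))"
    unfolding lborel_p_def using c
    by (subst product_nn_integral_prod) (auto intro!: prod.cong simp: e_def)
  also have "\<dots> = ennreal (\<Prod>i=1..p. c i)" using c0 by (intro prod_ennreal) (auto intro: less_imp_le)
  finally have Cn: "(\<integral>\<^sup>+\<theta>. ennreal (\<Prod>i=1..p. e i (\<theta> i)) \<partial>density (lborel_p p) (\<lambda>\<theta>. \<Prod>i=1..p. ennreal (w i (\<theta> i))))
    = ennreal (\<Prod>i=1..p. c i)" .
  have Cpos: "(\<Prod>i=1..p. c i) > 0" using c0 by (intro prod_pos) auto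
  have "posterior N p (density (lborel_p p) (\<lambda>\<theta>. \<Prod>i=1..p. ennreal (w i (\<theta> i)))) Y =
    density (lborel_p p) (\<lambda>\<theta>. (\<Prod>i=1..p. ennreal (w i (\<theta> i))) *
        (ennreal (\<Prod>i=1..p. e i (\<theta> i)) / ennreal (\<Prod>i=1..p. c i)))"
    unfolding posterior_def lik Cn using mw me by (intro density_density_eq) auto
  also have "(\<lambda>\<theta>. (\<Prod>i=1..p. ennreal (w i (\<theta> i))) * (ennreal (\<Prod>i=1..p. e i (\<theta> i)) / ennreal (\<Prod>i=1..p. c i)))
      = (\<lambda>\<theta>. \<Prod>i=1..p. ennreal (w i (\<theta> i) * e i (\<theta> i) / c i))"
  proof
    fix \<theta>
    have "(\<Prod>i=1..p. ennreal (w i (\<theta> i))) * (ennreal (\<Prod>i=1..p. e i (\<theta> i)) / ennreal (\<Prod>i=1..p. c i))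
      = ennreal (\<Prod>i=1..p. w i (\<theta> i) * e i (\<theta> i)) / ennreal (\<Prod>i=1..p. c i)"
      using w0 e0 prod[of \<theta>] prod_ennreal[of "{1..p}" "\<lambda>i. w i (\<theta> i) * e i (\<theta> i)"]
      by (subst ennreal_times_divide) (simp only: prod, simp add: less_imp_le)
    also have "\<dots> = ennreal ((\<Prod>i=1..p. w i (\<theta> i) * e i (\<theta> i)) / (\<Prod>i=1..p. c i))"
      using Cpos w0 e0 by (intro divide_ennreal prod_nonneg) (auto simp: less_imp_le)
    also have "\<dots> = (\<Prod>i=1..p. ennreal (w i (\<theta> i) * e i (\<theta> i) / c i))"
      unfolding prod_dividef[symmetric] using c0 w0 e0
      by (subst prod_ennreal) (auto simp: less_imp_le)
    finally show "(\<Prod>i=1..p. ennreal (w i (\<theta> i))) * (ennreal (\<Prod>i=1..p. e i (\<theta> i)) / ennreal (\<Prod>i=1..p. c i))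
      = (\<Prod>i=1..p. ennreal (w i (\<theta> i) * e i (\<theta> i) / c i))" .
  qed
  also have "density (lborel_p p) \<dots> = PiM {1..p} (\<lambda>i. density lborel (\<lambda>x. ennreal (w i x * e i x / c i)))"
    by (rule density_lborel_p) measurable
  finally show ?thesis by (simp add: e_def)
qed

lemma nn_integral_pos_lborel:
  fixes f :: "real \<Rightarrow> real"
  assumes "f \<in> borel_measurable borel" "\<And>x. f x > 0"
  shows "(\<integral>\<^sup>+x. ennreal (f x) \<partial>lborel) > 0"
proof (rule ccontr)
  assume "\<not> ?thesis"
  then have "(\<integral>\<^sup>+x. ennreal (f x) \<partial>lborel) = 0" by (simp add: not_gr_zero)
  then have "AE x in (lborel :: real measure). ennreal (f x) = 0"
    using assms(1) by (subst (asm) nn_integral_0_iff_AE) auto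
  then have "AE x in (lborel :: real measure). False"
    by eventually_elim (use assms(2) in \<open>auto simp: ennreal_eq_0_iff not_le less_imp_le\<close>, metis not_less)
  then have "ae_filter (lborel :: real measure) = bot" by (simp add: trivial_limit_def)
  then have "emeasure (lborel :: real measure) UNIV = 0" by (simp add: ae_filter_eq_bot_iff)
  then show False by simp
qed

text \<open>Common entry point for both priors: \<open>G i\<close> is the negative log-prior up to
  the constant \<open>k i\<close>. Since - G grows at most linearly, the quadratic log-likelihood
  dominates and gives the posterior its Gaussian tail.\<close>

lemma posterior_score_family:
  fixes G h h' :: "nat \<Rightarrow> real \<Rightarrow> real"
  assumes N: "N > 0"
    and Gm[measurable]: "\<And>i. G i \<in> borel_measurable borel"
    and G: "\<And>i x. i \<in> {1..p} \<Longrightarrow> (G i has_real_derivative h i x) (at x)"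
    and h: "\<And>i x. i \<in> {1..p} \<Longrightarrow> (h i has_real_derivative h' i x) (at x)"
    and h': "\<And>i x. i \<in> {1..p} \<Longrightarrow> \<bar>h' i x\<bar> \<le> b"
    and Gb: "\<And>i. i \<in> {1..p} \<Longrightarrow> \<exists>K\<ge>0. \<forall>x. - G i x \<le> K * (1 + \<bar>x\<bar>)"
    and k: "\<And>i. i \<in> {1..p} \<Longrightarrow> k i > 0"
  obtains q where "score_family (real N) {1..p} q (\<lambda>i x. x - Y i + h i x / N) (\<lambda>i x. 1 + h' i x / N) (1 + b / N)"
    "posterior N p (density (lborel_p p) (\<lambda>\<theta>. \<Prod>i=1..p. ennreal (k i * exp (- G i (\<theta> i))))) Y =
       score_family.P {1..p} q"
proof -
  define g where "g i x = k i * exp (- G i x) * exp (real N * (Y i * x - x\<^sup>2 / 2))" for i x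
  have [measurable]: "g i \<in> borel_measurable borel" for i unfolding g_def[abs_def] by measurable
  have g0: "g i x > 0" if "i \<in> {1..p}" for i x using k[OF that] by (simp add: g_def)
  have gauss: "\<exists>C. \<forall>x. g i x \<le> C * exp (- (real N / 4) * x\<^sup>2)" if i: "i \<in> {1..p}" for i
  proof -
    obtain K where K: "K \<ge> 0" "\<And>x. - G i x \<le> K * (1 + \<bar>x\<bar>)" using Gb[OF i] by blast
    \<comment> \<open>\<open>m\<close> collects all linear growth in the exponent. Half of the term
      N x^2 / 2 absorbs it, by completing the square in m - N |x| / 2; the other half remains as the
      Gaussian tail.\<close>
    define m where "m = K + real N * \<bar>Y i\<bar>"
    have "g i x \<le> (k i * exp (K + m\<^sup>2 / N)) * exp (- (real N / 4) * x\<^sup>2)" for x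
    proof -
      have "m * \<bar>x\<bar> - real N / 4 * x\<^sup>2 \<le> m\<^sup>2 / N"
      proof -
        have "0 \<le> (m - real N / 2 * \<bar>x\<bar>)\<^sup>2" by simp
        then have "real N * (m * \<bar>x\<bar> - real N / 4 * x\<^sup>2) \<le> m\<^sup>2"
          by (simp add: power2_eq_square algebra_simps)
        then show ?thesis using N by (simp add: field_simps)
      qed
      moreover have "Y i * x \<le> \<bar>Y i\<bar> * \<bar>x\<bar>" by (metis abs_ge_self abs_mult)
      then have "real N * (Y i * x) \<le> real N * (\<bar>Y i\<bar> * \<bar>x\<bar>)" by (intro mult_left_mono) auto
      ultimately have "- G i x + real N * (Y i * x - x\<^sup>2 / 2) \<le> (K + m\<^sup>2 / N) + - (real N / 4) * x\<^sup>2"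
        using K(2)[of x] by (simp add: m_def algebra_simps)
      then have "exp (- G i x + real N * (Y i * x - x\<^sup>2 / 2)) \<le> exp ((K + m\<^sup>2 / N) + - (real N / 4) * x\<^sup>2)" by simp
      then show ?thesis unfolding g_def mult.assoc exp_add[symmetric] using k[OF i] by (intro mult_left_mono) auto
    qed
    then show ?thesis by blast
  qed
  have c: "\<exists>c>0. (\<integral>\<^sup>+x. ennreal (g i x) \<partial>lborel) = ennreal c" if i: "i \<in> {1..p}" for i
  proof -
    obtain C where C: "\<And>x. g i x \<le> C * exp (- (real N / 4) * x\<^sup>2)" using gauss[OF i] by blast
    have "integrable lborel (\<lambda>x. C * exp (- (real N / 4) * x\<^sup>2))"
      using integrable_gaussian[of "real N / 4"] N by (intro integrable_mult_right) auto
    then have "integrable lborel (g i)"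
      by (rule Bochner_Integration.integrable_bound)
         (use order_trans[OF C abs_ge_self] g0[OF i] in \<open>auto intro!: AE_I2 simp: less_imp_le\<close>)
    then have e: "(\<integral>\<^sup>+x. ennreal (g i x) \<partial>lborel) = ennreal (integral\<^sup>L lborel (g i))"
      using g0[OF i] by (intro nn_integral_eq_integral) (auto simp: less_imp_le)
    have "(\<integral>\<^sup>+x. ennreal (g i x) \<partial>lborel) > 0" by (rule nn_integral_pos_lborel) (use g0[OF i] in auto)
    then show ?thesis using e by auto
  qed
  then obtain c where c: "\<And>i. i \<in> {1..p} \<Longrightarrow> c i > 0"
    "\<And>i. i \<in> {1..p} \<Longrightarrow> (\<integral>\<^sup>+x. ennreal (g i x) \<partial>lborel) = ennreal (c i)" by metis
  define q where "q i x = g i x / c i" for i x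
  have sf: "score_family (real N) {1..p} q (\<lambda>i x. x - Y i + h i x / N) (\<lambda>i x. 1 + h' i x / N) (1 + b / N)"
  proof
    show "real N > 0" using N by simp
    fix i x assume i: "i \<in> {1..p}"
    show "0 \<le> q i x" using g0[OF i, of x] c(1)[OF i] by (simp add: q_def)
    show "(\<integral>\<^sup>+x. ennreal (q i x) \<partial>lborel) = 1"
    proof -
      have "(\<integral>\<^sup>+x. ennreal (q i x) \<partial>lborel) = (\<integral>\<^sup>+x. ennreal (g i x) / ennreal (c i) \<partial>lborel)"
        using g0[OF i] c(1)[OF i] by (intro nn_integral_cong) (simp add: q_def divide_ennreal less_imp_le)
      also have "\<dots> = ennreal (c i) / ennreal (c i)" by (subst nn_integral_divide) (auto simp: c(2)[OF i])
      also have "\<dots> = 1" using c(1)[OF i] by (simp add: divide_ennreal less_imp_le)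
      finally show ?thesis .
    qed
    have "((\<lambda>x. k i * exp (- G i x) * exp (real N * (Y i * x - x\<^sup>2 / 2)) / c i) has_real_derivative
        - real N * (x - Y i + h i x / N) * q i x) (at x)"
      using N c(1)[OF i] unfolding q_def g_def
      by (auto intro!: derivative_eq_intros G[OF i] simp: field_simps power2_eq_square)
    then show "(q i has_real_derivative - real N * (x - Y i + h i x / N) * q i x) (at x)"
      by (simp add: q_def[abs_def] g_def)
    show "((\<lambda>x. x - Y i + h i x / N) has_real_derivative 1 + h' i x / N) (at x)"
      using N by (auto intro!: derivative_eq_intros h[OF i])
    show "\<bar>1 + h' i x / real N\<bar> \<le> 1 + b / real N"
    proof -
      have "\<bar>h' i x / real N\<bar> \<le> b / real N" using h'[OF i, of x] N by (simp add: divide_right_mono)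
      then show ?thesis by linarith
    qed
    obtain C where C: "\<And>x. g i x \<le> C * exp (- (real N / 4) * x\<^sup>2)" using gauss[OF i] by blast
    have "q i x \<le> C / c i * exp (- (real N / 4) * x\<^sup>2)" for x
      using C[of x] c(1)[OF i] by (simp add: q_def divide_right_mono)
    then show "\<exists>\<alpha>>0. \<exists>C. \<forall>x. q i x \<le> C * exp (- \<alpha> * x\<^sup>2)"
      using N by (intro exI[of _ "real N / 4"] conjI exI[of _ "C / c i"]) auto
  qed simp
  have "posterior N p (density (lborel_p p) (\<lambda>\<theta>. \<Prod>i=1..p. ennreal (k i * exp (- G i (\<theta> i))))) Y =
       score_family.P {1..p} q"
    unfolding score_family.P_def[OF sf] q_def g_def
    by (rule posterior_eq_PiM) (use c k in \<open>auto simp: g_def less_imp_le\<close>)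
  with sf show ?thesis by (rule that)
qed

section \<open>Mean deviation of the Stein kernel from the target variance\<close>

context score_family
begin

text \<open>Without a prior the score is x - y with derivative 1; A and B measure how far the prior
  moves them. The part linear in the scores is treated as a sum, to profit from uncorrelatedness,
  and the rest coordinatewise in absolute value.\<close>

lemma expectation_T_perturbed:
  assumes A: "\<And>i x. i \<in> I \<Longrightarrow> \<bar>S i x - (x - y i)\<bar> \<le> A" "A \<ge> 0"
    and B: "\<And>i x. i \<in> I \<Longrightarrow> \<bar>S' i x - 1\<bar> \<le> B" "B \<ge> 0"
  defines "Q \<equiv> \<Sum>i\<in>I. (y i)\<^sup>2"
  shows "(\<integral>x. \<bar>T x - v\<bar> \<partial>P) \<le> 6 * sqrt (L / N * Q) +
      real (card I) * ((4 + 4 * B) * (L / N) + (3 + 4 * B) * A\<^sup>2)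
      + 4 * A * (\<Sum>i\<in>I. \<bar>y i\<bar>) + 8 * B * Q + \<bar>4 * Q - v\<bar>"
proof -
  interpret PP: prob_space P by (rule prob_space_P)
  define R where "R = (\<Sum>i\<in>I. (3 + 4 * B) * A\<^sup>2 + 4 * A * \<bar>y i\<bar> + 8 * B * (y i)\<^sup>2) + \<bar>4 * Q - v\<bar>"
  have pw: "\<bar>T x - v\<bar> \<le> 6 * \<bar>\<Sum>i\<in>I. y i * S i (x i)\<bar> + (\<Sum>i\<in>I. (4 + 4 * B) * (S i (x i))\<^sup>2) + R" for x
  proof -
    \<comment> \<open>Put x + y = 2 y + u with u close to S. The product (x + y) S contributes 2 y S
      and the square (x + y)^2 contributes 4 y u, together 6 y S up to a prior error; 4 y^2 is the
      leading term.\<close>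
    define D where "D i = (x i + y i) * S i (x i) + (x i + y i)\<^sup>2 * S' i (x i) - 4 * (y i)\<^sup>2 - 6 * (y i * S i (x i))" for i
    have D: "\<bar>D i\<bar> \<le> (4 + 4 * B) * (S i (x i))\<^sup>2 + ((3 + 4 * B) * A\<^sup>2 + 4 * A * \<bar>y i\<bar> + 8 * B * (y i)\<^sup>2)" if i: "i \<in> I" for i
    proof -
      define s where "s = S i (x i)"
      define \<eta> where "\<eta> = s - (x i - y i)"
      define \<beta> where "\<beta> = S' i (x i) - 1"
      define u where "u = x i - y i"
      have su: "s = u + \<eta>" by (simp add: u_def \<eta>_def)
      have \<eta>: "\<bar>\<eta>\<bar> \<le> A" using A(1)[OF i, of "x i"] by (simp add: \<eta>_def s_def)
      have \<beta>: "\<bar>\<beta>\<bar> \<le> B" using B(1)[OF i, of "x i"] by (simp add: \<beta>_def)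
      have \<eta>2: "\<eta>\<^sup>2 \<le> A\<^sup>2" using \<eta> A(2) by (metis abs_ge_zero power_mono power2_abs)
      have u2: "u\<^sup>2 \<le> 2 * s\<^sup>2 + 2 * A\<^sup>2"
      proof -
        have "u\<^sup>2 = 2 * s\<^sup>2 + 2 * \<eta>\<^sup>2 - (s + \<eta>)\<^sup>2" by (simp add: su power2_eq_square algebra_simps)
        then show ?thesis using \<eta>2 zero_le_power2[of "s + \<eta>"] by linarith
      qed
      have us: "\<bar>u * s\<bar> \<le> 2 * s\<^sup>2 + A\<^sup>2"
      proof -
        have "2 * \<bar>u * s\<bar> \<le> u\<^sup>2 + s\<^sup>2" using sum_squares_bound[of "\<bar>u\<bar>" "\<bar>s\<bar>"] by (simp add: abs_mult)
        then show ?thesis using u2 zero_le_power2[of s] by linarith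
      qed
      have xy2: "(x i + y i)\<^sup>2 \<le> 4 * s\<^sup>2 + 4 * A\<^sup>2 + 8 * (y i)\<^sup>2"
      proof -
        have "(x i + y i)\<^sup>2 = 2 * u\<^sup>2 + 8 * (y i)\<^sup>2 - (u - 2 * y i)\<^sup>2"
          by (simp add: u_def power2_eq_square algebra_simps)
        then show ?thesis using u2 zero_le_power2[of "u - 2 * y i"] by linarith
      qed
      have "D i = u * s + u\<^sup>2 - 4 * (y i * \<eta>) + (x i + y i)\<^sup>2 * \<beta>"
        unfolding D_def s_def[symmetric] \<beta>_def by (simp add: \<eta>_def u_def power2_eq_square algebra_simps)
      then have "\<bar>D i\<bar> \<le> \<bar>u * s\<bar> + u\<^sup>2 + 4 * \<bar>y i * \<eta>\<bar> + \<bar>(x i + y i)\<^sup>2 * \<beta>\<bar>"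
        using zero_le_power2[of u] by linarith
      moreover have "\<bar>y i * \<eta>\<bar> \<le> A * \<bar>y i\<bar>" unfolding abs_mult using mult_right_mono[OF \<eta>, of "\<bar>y i\<bar>"] by (simp add: mult.commute)
      moreover have "\<bar>(x i + y i)\<^sup>2 * \<beta>\<bar> \<le> (4 * s\<^sup>2 + 4 * A\<^sup>2 + 8 * (y i)\<^sup>2) * B"
        unfolding abs_mult using xy2 \<beta> by (intro mult_mono) auto
      ultimately have "\<bar>D i\<bar> \<le> (2 * s\<^sup>2 + A\<^sup>2) + (2 * s\<^sup>2 + 2 * A\<^sup>2) + 4 * (A * \<bar>y i\<bar>) + (4 * s\<^sup>2 + 4 * A\<^sup>2 + 8 * (y i)\<^sup>2) * B"
        using us u2 by linarith
      then show ?thesis unfolding s_def by (simp add: algebra_simps)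
    qed
    have "T x - v = (\<Sum>i\<in>I. D i) + 6 * (\<Sum>i\<in>I. y i * S i (x i)) + (4 * Q - v)"
      by (simp add: T_def D_def Q_def sum.distrib sum_subtractf sum_distrib_left)
    then have "\<bar>T x - v\<bar> \<le> \<bar>\<Sum>i\<in>I. D i\<bar> + 6 * \<bar>\<Sum>i\<in>I. y i * S i (x i)\<bar> + \<bar>4 * Q - v\<bar>" by linarith
    moreover have "\<bar>\<Sum>i\<in>I. D i\<bar> \<le> (\<Sum>i\<in>I. (4 + 4 * B) * (S i (x i))\<^sup>2 + ((3 + 4 * B) * A\<^sup>2 + 4 * A * \<bar>y i\<bar> + 8 * B * (y i)\<^sup>2))"
      by (rule order_trans[OF sum_abs sum_mono[OF D]])
    ultimately show ?thesis by (simp add: R_def sum.distrib)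
  qed
  have i1: "integrable P (\<lambda>x. \<Sum>i\<in>I. (4 + 4 * B) * (S i (x i))\<^sup>2)"
    by (intro Bochner_Integration.integrable_sum integrable_mult_right score_square_integrable)
  have i2: "integrable P (\<lambda>x. 6 * \<bar>\<Sum>i\<in>I. y i * S i (x i)\<bar>)"
    by (intro integrable_mult_right expectation_abs_sum_score)
  have "(\<integral>x. \<bar>T x - v\<bar> \<partial>P) \<le> (\<integral>x. 6 * \<bar>\<Sum>i\<in>I. y i * S i (x i)\<bar> + (\<Sum>i\<in>I. (4 + 4 * B) * (S i (x i))\<^sup>2) + R \<partial>P)"
    by (rule integral_mono) (use i1 i2 T_integrable pw in auto)
  also have "\<dots> = 6 * (\<integral>x. \<bar>\<Sum>i\<in>I. y i * S i (x i)\<bar> \<partial>P) + (\<Sum>i\<in>I. (4 + 4 * B) * (\<integral>x. (S i (x i))\<^sup>2 \<partial>P)) + R"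
    using i1 i2 score_square_integrable by (simp add: PP.prob_space Bochner_Integration.integral_sum)
  also have "\<dots> \<le> 6 * sqrt (L / N * Q) + (\<Sum>i\<in>I. (4 + 4 * B) * (L / N)) + R"
    unfolding Q_def using B(2)
    by (intro add_mono mult_left_mono expectation_abs_sum_score sum_mono score_second_moment_le) auto
  also have "\<dots> = 6 * sqrt (L / N * Q) +
      real (card I) * ((4 + 4 * B) * (L / N) + (3 + 4 * B) * A\<^sup>2)
      + 4 * A * (\<Sum>i\<in>I. \<bar>y i\<bar>) + 8 * B * Q + \<bar>4 * Q - v\<bar>"
    unfolding R_def Q_def sum.distrib sum_distrib_left[symmetric] sum_constant by (simp add: algebra_simps)
  finally show ?thesis .
qed

text \<open>Here S - (x - y) = \<tau> x is unbounded in x unless \<tau> = 0, so no constant A is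
  available. Instead the affine score is solved for x, which makes each summand of \<open>T\<close>
  an explicit quadratic polynomial in S.\<close>

lemma expectation_T_linear:
  assumes S: "\<And>i x. i \<in> I \<Longrightarrow> S i x = (1 + \<tau> i) * x - y i"
    and S': "\<And>i x. i \<in> I \<Longrightarrow> S' i x = 1 + \<tau> i" and \<tau>: "\<And>i. i \<in> I \<Longrightarrow> \<tau> i \<ge> 0" and L: "L \<ge> 0"
  defines "Q \<equiv> \<Sum>i\<in>I. (y i)\<^sup>2"
  shows "(\<integral>x. \<bar>T x - v\<bar> \<partial>P) \<le> 6 * sqrt (L / N * Q) + 2 * real (card I) * (L / N)
      + (\<Sum>i\<in>I. \<tau> i * (y i)\<^sup>2) + \<bar>4 * Q - v\<bar>"
proof -
  interpret PP: prob_space P by (rule prob_space_P)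
  define a where "a i = (2 + \<tau> i) / (1 + \<tau> i) * y i" for i
  have pw: "\<bar>T x - v\<bar> \<le> 3 * \<bar>\<Sum>i\<in>I. a i * S i (x i)\<bar> + (\<Sum>i\<in>I. 2 * (S i (x i))\<^sup>2)
     + ((\<Sum>i\<in>I. \<tau> i * (y i)\<^sup>2) + \<bar>4 * Q - v\<bar>)" for x
  proof -
    \<comment> \<open>From x + y = (S + (2 + \<tau>) y) / (1 + \<tau>). The y^2 coefficient is (2 +
      \<tau>)^2 / (1 + \<tau>) = 4 + \<tau>^2 / (1 + \<tau>), so the leading term 4 y^2 is exact up
      to at most \<tau> y^2; the coefficient \<open>a\<close> of the linear part stays below 2 |y|
      in modulus.\<close>
    define D where "D i = 2 * (S i (x i))\<^sup>2 / (1 + \<tau> i) + (\<tau> i)\<^sup>2 / (1 + \<tau> i) * (y i)\<^sup>2" for i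
    have TD: "(x i + y i) * S i (x i) + (x i + y i)\<^sup>2 * S' i (x i) = D i + 3 * (a i * S i (x i)) + 4 * (y i)\<^sup>2"
      if i: "i \<in> I" for i
    proof -
      have t: "1 + \<tau> i > 0" using \<tau>[OF i] by simp
      define s where "s = S i (x i)"
      have x: "x i = (s + y i) / (1 + \<tau> i)" using S[OF i, of "x i"] t by (simp add: s_def field_simps)
      have xy: "x i + y i = (s + (2 + \<tau> i) * y i) / (1 + \<tau> i)"
        unfolding x using t by (simp add: field_simps)
      show ?thesis unfolding xy D_def a_def S'[OF i] s_def[symmetric] using t
        by (simp add: divide_simps power2_eq_square) (simp add: algebra_simps)
    qed
    have D: "\<bar>D i\<bar> \<le> 2 * (S i (x i))\<^sup>2 + \<tau> i * (y i)\<^sup>2" if i: "i \<in> I" for i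
    proof -
      have t: "\<tau> i \<ge> 0" "1 + \<tau> i > 0" using \<tau>[OF i] by simp_all
      have "2 * (S i (x i))\<^sup>2 / (1 + \<tau> i) \<le> 2 * (S i (x i))\<^sup>2"
        using t by (simp add: divide_le_eq mult_left_mono[of 1 "1 + \<tau> i" "2 * (S i (x i))\<^sup>2", simplified])
      moreover have "(\<tau> i)\<^sup>2 / (1 + \<tau> i) \<le> \<tau> i" using t by (simp add: divide_le_eq power2_eq_square algebra_simps)
      then have "(\<tau> i)\<^sup>2 / (1 + \<tau> i) * (y i)\<^sup>2 \<le> \<tau> i * (y i)\<^sup>2" by (rule mult_right_mono) simp
      moreover have "D i \<ge> 0" using t by (simp add: D_def)
      ultimately show ?thesis by (simp add: D_def)
    qed
    have "T x - v = (\<Sum>i\<in>I. D i) + 3 * (\<Sum>i\<in>I. a i * S i (x i)) + (4 * Q - v)"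
      unfolding T_def by (simp add: TD Q_def sum.distrib sum_distrib_left)
    then have "\<bar>T x - v\<bar> \<le> \<bar>\<Sum>i\<in>I. D i\<bar> + 3 * \<bar>\<Sum>i\<in>I. a i * S i (x i)\<bar> + \<bar>4 * Q - v\<bar>" by linarith
    moreover have "\<bar>\<Sum>i\<in>I. D i\<bar> \<le> (\<Sum>i\<in>I. 2 * (S i (x i))\<^sup>2 + \<tau> i * (y i)\<^sup>2)"
      by (rule order_trans[OF sum_abs sum_mono[OF D]])
    ultimately show ?thesis by (simp add: sum.distrib)
  qed
  have "(\<Sum>i\<in>I. (a i)\<^sup>2) \<le> (\<Sum>i\<in>I. 4 * (y i)\<^sup>2)"
  proof (rule sum_mono)
    fix i assume i: "i \<in> I"
    have "0 \<le> (2 + \<tau> i) / (1 + \<tau> i)" "(2 + \<tau> i) / (1 + \<tau> i) \<le> 2" using \<tau>[OF i] by (simp_all add: field_simps)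
    then have "((2 + \<tau> i) / (1 + \<tau> i))\<^sup>2 \<le> 2\<^sup>2" by (intro power_mono)
    then show "(a i)\<^sup>2 \<le> 4 * (y i)\<^sup>2" unfolding a_def power_mult_distrib by (intro mult_right_mono) auto
  qed
  then have "L / N * (\<Sum>i\<in>I. (a i)\<^sup>2) \<le> 2\<^sup>2 * (L / N * Q)"
    using mult_left_mono[of "\<Sum>i\<in>I. (a i)\<^sup>2" "4 * Q" "L / N"] L N
    unfolding Q_def sum_distrib_left[symmetric] by (simp add: mult_ac)
  then have "sqrt (L / N * (\<Sum>i\<in>I. (a i)\<^sup>2)) \<le> sqrt (2\<^sup>2 * (L / N * Q))" by (rule real_sqrt_le_mono)
  also have "\<dots> = 2 * sqrt (L / N * Q)" unfolding real_sqrt_mult by simp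
  finally have sq: "sqrt (L / N * (\<Sum>i\<in>I. (a i)\<^sup>2)) \<le> 2 * sqrt (L / N * Q)" .
  have i1: "integrable P (\<lambda>x. \<Sum>i\<in>I. 2 * (S i (x i))\<^sup>2)"
    by (intro Bochner_Integration.integrable_sum integrable_mult_right score_square_integrable)
  have i2: "integrable P (\<lambda>x. 3 * \<bar>\<Sum>i\<in>I. a i * S i (x i)\<bar>)"
    by (intro integrable_mult_right expectation_abs_sum_score)
  have "(\<integral>x. \<bar>T x - v\<bar> \<partial>P) \<le> (\<integral>x. 3 * \<bar>\<Sum>i\<in>I. a i * S i (x i)\<bar> + (\<Sum>i\<in>I. 2 * (S i (x i))\<^sup>2)
     + ((\<Sum>i\<in>I. \<tau> i * (y i)\<^sup>2) + \<bar>4 * Q - v\<bar>) \<partial>P)"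
    by (rule integral_mono) (use i1 i2 T_integrable pw in auto)
  also have "\<dots> = 3 * (\<integral>x. \<bar>\<Sum>i\<in>I. a i * S i (x i)\<bar> \<partial>P) + (\<Sum>i\<in>I. 2 * (\<integral>x. (S i (x i))\<^sup>2 \<partial>P))
      + ((\<Sum>i\<in>I. \<tau> i * (y i)\<^sup>2) + \<bar>4 * Q - v\<bar>)"
    using i1 i2 score_square_integrable by (simp add: PP.prob_space Bochner_Integration.integral_sum)
  also have "\<dots> \<le> 3 * (2 * sqrt (L / N * Q)) + (\<Sum>i\<in>I. 2 * (L / N)) + ((\<Sum>i\<in>I. \<tau> i * (y i)\<^sup>2) + \<bar>4 * Q - v\<bar>)"
    by (intro add_mono mult_left_mono order_trans[OF expectation_abs_sum_score(2) sq] sum_mono score_second_moment_le) (use \<tau> in auto)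
  finally show ?thesis by (simp add: mult_ac)
qed

end

section \<open>The frequentist error of the energy\<close>

text \<open>Markov's inequality is applied to an integrable majorant \<open>D\<close>;
  \<open>X N\<close> itself may fail to be measurable, and monotonicity of the outer measure bridges
  the gap.\<close>

lemma is_Op_of_expectation_le:
  assumes M: "prob_space M"
    and bnd: "\<forall>\<^sub>F N in sequentially. \<exists>D. integrable M D \<and> (\<forall>\<omega>\<in>space M. \<bar>X N \<omega>\<bar> \<le> D \<omega>)
        \<and> integral\<^sup>L M D \<le> K * r N"
    and r: "\<forall>\<^sub>F N in sequentially. r N > 0"
  shows "is_Op M X r"
  unfolding is_Op_def
proof (intro allI impI)
  interpret prob_space M by fact
  fix \<delta> :: real assume \<delta>: "\<delta> > 0"
  \<comment> \<open>The summand 1 keeps the constant positive, and the maximum covers a nonpositive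
    K.\<close>
  define K' where "K' = max K 0 / \<delta> + 1"
  have K': "K' > 0" using \<delta> by (simp add: K'_def add_nonneg_pos)
  show "\<exists>K>0. \<forall>\<^sub>F N in sequentially. outer_measure_of M {\<omega> \<in> space M. \<bar>X N \<omega>\<bar> > K * \<bar>r N\<bar>} \<le> ennreal \<delta>"
  proof (intro exI[of _ K'] conjI K')
    show "\<forall>\<^sub>F N in sequentially. outer_measure_of M {\<omega> \<in> space M. \<bar>X N \<omega>\<bar> > K' * \<bar>r N\<bar>} \<le> ennreal \<delta>"
      using bnd r
    proof eventually_elim
      case (elim N)
      then obtain D where D: "integrable M D" "\<And>\<omega>. \<omega> \<in> space M \<Longrightarrow> \<bar>X N \<omega>\<bar> \<le> D \<omega>"
        "integral\<^sup>L M D \<le> K * r N" by blast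
      have pos: "K' * r N > 0" using K' elim(2) by simp
      have [measurable]: "D \<in> borel_measurable M" using D(1) by simp
      let ?S = "{\<omega> \<in> space M. D \<omega> \<ge> K' * r N}"
      have "outer_measure_of M {\<omega> \<in> space M. \<bar>X N \<omega>\<bar> > K' * \<bar>r N\<bar>} \<le> outer_measure_of M ?S"
        using D(2) elim(2) by (intro outer_measure_of_mono) fastforce
      also have "\<dots> = emeasure M ?S" by (rule outer_measure_of_eq) measurable
      also have "\<dots> = ennreal (prob ?S)" by (rule emeasure_eq_measure)
      also have "prob ?S \<le> integral\<^sup>L M D / (K' * r N)"
        by (rule integral_Markov_inequality_measure[where A="space M"])
           (use D pos in \<open>auto intro: order_trans[OF abs_ge_zero]\<close>)
      also have "\<dots> \<le> (K * r N) / (K' * r N)" using D(3) pos by (intro divide_right_mono) auto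
      also have "\<dots> \<le> \<delta>"
      proof -
        have "\<delta> * K' = max K 0 + \<delta>" using \<delta> by (simp add: K'_def field_simps)
        then have "K \<le> \<delta> * K'" using \<delta> by linarith
        then have "K * r N \<le> \<delta> * (K' * r N)" using elim(2) by (simp add: mult.assoc[symmetric])
        then show ?thesis by (rule mult_imp_div_pos_le[OF pos])
      qed
      finally show ?case by (simp add: ennreal_leI)
    qed
  qed
qed

lemma is_op_of_is_Op:
  assumes X: "is_Op M X r" and r: "r \<longlonglongrightarrow> 0"
  shows "is_op M X (\<lambda>_. 1)"
  unfolding is_op_def
proof (intro allI impI)
  fix \<eta> \<delta> :: real assume \<eta>: "\<eta> > 0" and \<delta>: "\<delta> > 0"
  obtain K where K: "K > 0" "\<forall>\<^sub>F N in sequentially. outer_measure_of M {\<omega> \<in> space M. \<bar>X N \<omega>\<bar> > K * \<bar>r N\<bar>} \<le> ennreal \<delta>"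
    using X \<delta> unfolding is_Op_def by blast
  have "\<forall>\<^sub>F N in sequentially. \<bar>r N\<bar> < \<eta> / K"
    using tendstoD[OF r, of "\<eta> / K"] \<eta> K(1) by simp
  with K(2) show "\<forall>\<^sub>F N in sequentially. outer_measure_of M {\<omega> \<in> space M. \<bar>X N \<omega>\<bar> > \<eta> * \<bar>1\<bar>} \<le> ennreal \<delta>"
  proof eventually_elim
    case (elim N)
    then have "K * \<bar>r N\<bar> \<le> \<eta>" using K(1) by (simp add: field_simps)
    then have "outer_measure_of M {\<omega> \<in> space M. \<bar>X N \<omega>\<bar> > \<eta> * \<bar>1\<bar>} \<le> outer_measure_of M {\<omega> \<in> space M. \<bar>X N \<omega>\<bar> > K * \<bar>r N\<bar>}"
      by (intro outer_measure_of_mono) auto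
    then show ?case using elim(1) by simp
  qed
qed

text \<open>For N \<ge> 3 the logarithm is at least 1, so both the parametric error N^(-1/2) and the
  quadratic error p / N \<le> sqrt (p / N) are absorbed by the stated rate.\<close>

lemma log_rate_bounds:
  assumes N: "N \<ge> 3" and p: "1 \<le> p" "p \<le> N"
  shows "0 \<le> sqrt (real p * ln (real N) / real N)"
    "sqrt (1 / real N) \<le> sqrt (real p * ln (real N) / real N)"
    "real p / real N \<le> sqrt (real p * ln (real N) / real N)"
proof -
  have ln1: "ln (real N) \<ge> 1"
    using N exp_le ln_mono[of "exp 1" "real N"] by simp
  have pN: "real p \<le> real p * ln (real N)" using mult_left_mono[OF ln1, of "real p"] by simp
  show "0 \<le> sqrt (real p * ln (real N) / real N)" using ln1 by simp
  show "sqrt (1 / real N) \<le> sqrt (real p * ln (real N) / real N)" unfolding real_sqrt_le_iff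
    using pN p by (intro divide_right_mono) linarith+
  have le1: "real p / real N \<le> 1" using p N by simp
  have "(real p / real N)\<^sup>2 \<le> real p / real N"
    using mult_left_mono[OF le1, of "real p / real N"] by (simp add: power2_eq_square)
  also have "\<dots> \<le> real p * ln (real N) / real N" using pN by (intro divide_right_mono) auto
  finally show "real p / real N \<le> sqrt (real p * ln (real N) / real N)" by (rule real_le_rsqrt)
qed

text \<open>Beyond p the Sobolev weight is at least p^(2 s), so the tail is at most C p^(-2
  s).\<close>

lemma sobolev_tail:
  assumes s: "s > 0" and \<theta>: "\<theta> \<in> sobolev s" and p: "p \<ge> 1"
  defines "C \<equiv> (\<Sum>\<^sub>\<infinity>\<mu>\<in>{1..}. real \<mu> powr (2 * s) * (\<theta> \<mu>)\<^sup>2)"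
  shows "(\<Sum>\<mu>=1..p. (\<theta> \<mu>)\<^sup>2) \<le> (l2_norm \<theta>)\<^sup>2"
    "(l2_norm \<theta>)\<^sup>2 - (\<Sum>\<mu>=1..p. (\<theta> \<mu>)\<^sup>2) \<le> C * real p powr (- s)" "C \<ge> 0"
proof -
  have sum: "(\<lambda>\<mu>. (\<theta> \<mu>)\<^sup>2) summable_on {1..}" "(\<lambda>\<mu>. real \<mu> powr (2 * s) * (\<theta> \<mu>)\<^sup>2) summable_on {1..}"
    using \<theta> by (auto simp: sobolev_def l2_def)
  have norm: "(l2_norm \<theta>)\<^sup>2 = (\<Sum>\<^sub>\<infinity>\<mu>\<in>{1..}. (\<theta> \<mu>)\<^sup>2)"
    unfolding l2_norm_def by (rule real_sqrt_pow2) (auto intro: infsum_nonneg)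
  have U: "{1..} = {1..p} \<union> {p<..}" using p by auto
  have sub: "(\<lambda>\<mu>. (\<theta> \<mu>)\<^sup>2) summable_on {p<..}" "(\<lambda>\<mu>. real \<mu> powr (2 * s) * (\<theta> \<mu>)\<^sup>2) summable_on {p<..}"
    using sum by (auto intro: summable_on_subset_banach[of _ "{1..}"])
  have split: "(l2_norm \<theta>)\<^sup>2 = (\<Sum>\<mu>=1..p. (\<theta> \<mu>)\<^sup>2) + (\<Sum>\<^sub>\<infinity>\<mu>\<in>{p<..}. (\<theta> \<mu>)\<^sup>2)"
    unfolding norm U using sub(1) by (subst infsum_Un_disjoint) auto
  have "(\<Sum>\<^sub>\<infinity>\<mu>\<in>{p<..}. (\<theta> \<mu>)\<^sup>2) \<ge> 0" by (rule infsum_nonneg) simp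
  then show "(\<Sum>\<mu>=1..p. (\<theta> \<mu>)\<^sup>2) \<le> (l2_norm \<theta>)\<^sup>2" using split by simp
  show C: "C \<ge> 0" unfolding C_def by (rule infsum_nonneg) simp
  have "(\<Sum>\<^sub>\<infinity>\<mu>\<in>{p<..}. (\<theta> \<mu>)\<^sup>2) \<le> (\<Sum>\<^sub>\<infinity>\<mu>\<in>{p<..}. real p powr (- (2 * s)) * (real \<mu> powr (2 * s) * (\<theta> \<mu>)\<^sup>2))"
  proof (rule infsum_mono[OF sub(1) summable_on_cmult_right[OF sub(2)]])
    fix \<mu> assume \<mu>: "\<mu> \<in> {p<..}"
    have "real p powr (2 * s) \<le> real \<mu> powr (2 * s)" using \<mu> s p by (intro powr_mono2) auto
    then have "1 \<le> real p powr (- (2 * s)) * real \<mu> powr (2 * s)"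
      using p by (simp add: powr_minus field_simps)
    from mult_right_mono[OF this, of "(\<theta> \<mu>)\<^sup>2"]
    show "(\<theta> \<mu>)\<^sup>2 \<le> real p powr (- (2 * s)) * (real \<mu> powr (2 * s) * (\<theta> \<mu>)\<^sup>2)" by (simp add: mult.assoc)
  qed
  also have "\<dots> = real p powr (- (2 * s)) * (\<Sum>\<^sub>\<infinity>\<mu>\<in>{p<..}. real \<mu> powr (2 * s) * (\<theta> \<mu>)\<^sup>2)"
    by (rule infsum_cmult_right) (use sub(2) in simp)
  also have "\<dots> \<le> real p powr (- (2 * s)) * C"
    unfolding C_def by (intro mult_left_mono infsum_mono_neutral sub sum) (use p in auto)
  \<comment> \<open>The exponent is weakened from 2 s to s, the form in which the truncation error
    enters the rate.\<close>
  also have "\<dots> \<le> real p powr (- s) * C"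
    using p s C by (intro mult_right_mono powr_mono) auto
  finally show "(l2_norm \<theta>)\<^sup>2 - (\<Sum>\<mu>=1..p. (\<theta> \<mu>)\<^sup>2) \<le> C * real p powr (- s)"
    using split by (simp add: mult.commute)
qed

section \<open>The Gaussian sequence observation and its energy\<close>

locale white_noise = prob_space M for M :: "'a measure" +
  fixes \<epsilon> :: "nat \<Rightarrow> 'a \<Rightarrow> real"
  assumes iid: "iid_std_normal M \<epsilon>"
begin

lemma noise_distributed: "\<mu> \<ge> 1 \<Longrightarrow> distributed M lborel (\<epsilon> \<mu>) std_normal_density"
  using iid by (simp add: iid_std_normal_def)

lemma noise_measurable[measurable]: "\<mu> \<ge> 1 \<Longrightarrow> \<epsilon> \<mu> \<in> borel_measurable M"
  using distributed_measurable[OF noise_distributed] by simp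

lemma noise_mean: "\<mu> \<ge> 1 \<Longrightarrow> expectation (\<epsilon> \<mu>) = 0"
  by (rule standard_normal_distributed_expectation[OF noise_distributed])

lemma noise_square_integrable: "\<mu> \<ge> 1 \<Longrightarrow> integrable M (\<lambda>\<omega>. (\<epsilon> \<mu> \<omega>)\<^sup>2)"
  using distributed_integrable[OF noise_distributed, of \<mu> "\<lambda>x. x\<^sup>2"] integrable_std_normal_moment[of 2]
  by simp

lemma noise_integrable: "\<mu> \<ge> 1 \<Longrightarrow> integrable M (\<epsilon> \<mu>)"
  by (rule square_integrable_imp_integrable) (auto intro: noise_square_integrable)

lemma noise_second_moment: "\<mu> \<ge> 1 \<Longrightarrow> expectation (\<lambda>\<omega>. (\<epsilon> \<mu> \<omega>)\<^sup>2) = 1"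
  using standard_normal_distributed_variance[OF noise_distributed] by (simp add: noise_mean)

lemma noise_uncorrelated:
  assumes "i \<ge> 1" "j \<ge> 1" "i \<noteq> j"
  shows "integrable M (\<lambda>\<omega>. \<epsilon> i \<omega> * \<epsilon> j \<omega>)" "expectation (\<lambda>\<omega>. \<epsilon> i \<omega> * \<epsilon> j \<omega>) = 0"
proof -
  have indep: "indep_vars (\<lambda>_. borel) \<epsilon> {i, j}"
    using iid assms by (auto simp: iid_std_normal_def intro: indep_vars_subset)
  show "integrable M (\<lambda>\<omega>. \<epsilon> i \<omega> * \<epsilon> j \<omega>)" "expectation (\<lambda>\<omega>. \<epsilon> i \<omega> * \<epsilon> j \<omega>) = 0"
    using indep_vars_integrable[OF _ indep noise_integrable] indep_vars_lebesgue_integral[OF _ indep noise_integrable] assms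
    by (auto simp: noise_mean)
qed

lemma obs_square:
  "N \<ge> 1 \<Longrightarrow> (obs \<theta> \<epsilon> N \<omega> \<mu>)\<^sup>2 = (\<theta> \<mu>)\<^sup>2 + 2 * real N powr (-1/2) * (\<theta> \<mu> * \<epsilon> \<mu> \<omega>) + 1 / real N * (\<epsilon> \<mu> \<omega>)\<^sup>2"
proof -
  assume N: "N \<ge> 1"
  have "(real N powr (-1/2))\<^sup>2 = 1 / real N"
    using N by (simp add: power2_eq_square powr_add[symmetric] powr_minus_divide)
  moreover have "(\<theta> \<mu> + w * \<epsilon> \<mu> \<omega>)\<^sup>2 = (\<theta> \<mu>)\<^sup>2 + 2 * w * (\<theta> \<mu> * \<epsilon> \<mu> \<omega>) + w\<^sup>2 * (\<epsilon> \<mu> \<omega>)\<^sup>2" for w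
    by (simp add: power2_eq_square algebra_simps)
  ultimately show ?thesis unfolding obs_def by metis
qed

lemma obs_square_integrable:
  "N \<ge> 1 \<Longrightarrow> \<mu> \<ge> 1 \<Longrightarrow> integrable M (\<lambda>\<omega>. (obs \<theta> \<epsilon> N \<omega> \<mu>)\<^sup>2)"
  unfolding obs_square using noise_integrable noise_square_integrable by simp

lemma expectation_obs_square:
  "N \<ge> 1 \<Longrightarrow> \<mu> \<ge> 1 \<Longrightarrow> expectation (\<lambda>\<omega>. (obs \<theta> \<epsilon> N \<omega> \<mu>)\<^sup>2) = (\<theta> \<mu>)\<^sup>2 + 1 / real N"
  unfolding obs_square using noise_integrable[of \<mu>] noise_square_integrable[of \<mu>]
  by (simp add: prob_space noise_mean noise_second_moment)

lemma expectation_obs_energy: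
  assumes N: "N \<ge> 1"
  shows "integrable M (\<lambda>\<omega>. \<Sum>\<mu>=1..p. (obs \<theta> \<epsilon> N \<omega> \<mu>)\<^sup>2)"
    "expectation (\<lambda>\<omega>. \<Sum>\<mu>=1..p. (obs \<theta> \<epsilon> N \<omega> \<mu>)\<^sup>2) = (\<Sum>\<mu>=1..p. (\<theta> \<mu>)\<^sup>2) + real p / real N"
  using N by (auto simp: Bochner_Integration.integral_sum obs_square_integrable expectation_obs_square sum.distrib
      intro!: Bochner_Integration.integrable_sum)

text \<open>The square of the observation splits the error into three parts: truncation of \<theta>,
  a linear noise term of standard deviation at most 2 N^(-1/2) times the norm of \<theta>, and the
  noise energy, which is kept uncentred because its mean p / N is already within the rate.\<close>

lemma expectation_energy_error:
  assumes N: "N \<ge> 1" and p: "p \<ge> 1" and s: "s > 0" and \<theta>: "\<theta> \<in> sobolev s"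
  defines "C \<equiv> (\<Sum>\<^sub>\<infinity>\<mu>\<in>{1..}. real \<mu> powr (2 * s) * (\<theta> \<mu>)\<^sup>2)"
  shows "integrable M (\<lambda>\<omega>. \<bar>4 * (\<Sum>\<mu>=1..p. (obs \<theta> \<epsilon> N \<omega> \<mu>)\<^sup>2) - 4 * (l2_norm \<theta>)\<^sup>2\<bar>)" (is "integrable M ?E")
    "expectation (\<lambda>\<omega>. \<bar>4 * (\<Sum>\<mu>=1..p. (obs \<theta> \<epsilon> N \<omega> \<mu>)\<^sup>2) - 4 * (l2_norm \<theta>)\<^sup>2\<bar>) \<le>
      4 * C * real p powr (- s) + 8 * sqrt (1 / real N) * l2_norm \<theta> + 4 * (real p / real N)"
proof -
  let ?V = "\<lambda>\<omega>. \<bar>\<Sum>\<mu>=1..p. \<theta> \<mu> * \<epsilon> \<mu> \<omega>\<bar>"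
  let ?W = "\<lambda>\<omega>. \<Sum>\<mu>=1..p. (\<epsilon> \<mu> \<omega>)\<^sup>2"
  have iE: "integrable M (\<lambda>\<omega>. \<Sum>\<mu>=1..p. (obs \<theta> \<epsilon> N \<omega> \<mu>)\<^sup>2)"
    by (rule expectation_obs_energy[OF N])
  show 1: "integrable M ?E"
    by (intro integrable_abs Bochner_Integration.integrable_diff integrable_mult_right iE) simp
  have l0: "l2_norm \<theta> \<ge> 0" by (simp add: l2_norm_def infsum_nonneg)
  have prod: "\<theta> i * \<epsilon> i \<omega> * (\<theta> j * \<epsilon> j \<omega>) = \<theta> i * \<theta> j * (\<epsilon> i \<omega> * \<epsilon> j \<omega>)" for i j \<omega> by simp
  have "(\<Sum>\<mu>=1..p. expectation (\<lambda>\<omega>. (\<theta> \<mu> * \<epsilon> \<mu> \<omega>)\<^sup>2)) \<le> (l2_norm \<theta>)\<^sup>2"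
    using sobolev_tail(1)[OF s \<theta> p] by (simp add: power_mult_distrib noise_second_moment)
  note V = expectation_abs_sum_uncorrelated_le[of "{1..p}" "\<lambda>\<mu> \<omega>. \<theta> \<mu> * \<epsilon> \<mu> \<omega>", OF _ _ _ _ _ this]
  have V1: "integrable M ?V"
    by (rule V(1)) (use noise_uncorrelated in \<open>auto simp: power_mult_distrib prod noise_square_integrable\<close>)
  have V2: "expectation ?V \<le> sqrt ((l2_norm \<theta>)\<^sup>2)"
    by (rule V(2)) (use noise_uncorrelated in \<open>auto simp: power_mult_distrib prod noise_square_integrable\<close>)
  have W1: "integrable M ?W" by (intro Bochner_Integration.integrable_sum noise_square_integrable) auto
  have W2: "expectation ?W = real p"
    by (subst Bochner_Integration.integral_sum) (auto simp: noise_square_integrable noise_second_moment)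
  have sq: "real N powr (-1/2) = sqrt (1 / real N)"
    using N by (simp add: powr_minus_divide powr_half_sqrt real_sqrt_divide)
  have pw: "?E \<omega> \<le> 4 * C * real p powr (- s) + 8 * sqrt (1 / real N) * ?V \<omega> + 4 / real N * ?W \<omega>" for \<omega>
  proof -
    have "(\<Sum>\<mu>=1..p. (obs \<theta> \<epsilon> N \<omega> \<mu>)\<^sup>2) =
        (\<Sum>\<mu>=1..p. (\<theta> \<mu>)\<^sup>2) + 2 * sqrt (1 / real N) * (\<Sum>\<mu>=1..p. \<theta> \<mu> * \<epsilon> \<mu> \<omega>) + 1 / real N * ?W \<omega>"
      unfolding obs_square[OF N] sum.distrib sum_distrib_left[symmetric] sq ..
    then have "\<bar>(\<Sum>\<mu>=1..p. (obs \<theta> \<epsilon> N \<omega> \<mu>)\<^sup>2) - (l2_norm \<theta>)\<^sup>2\<bar> \<le> ((l2_norm \<theta>)\<^sup>2 - (\<Sum>\<mu>=1..p. (\<theta> \<mu>)\<^sup>2))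
        + \<bar>2 * sqrt (1 / real N) * (\<Sum>\<mu>=1..p. \<theta> \<mu> * \<epsilon> \<mu> \<omega>)\<bar> + \<bar>1 / real N * ?W \<omega>\<bar>"
      using sobolev_tail(1)[OF s \<theta> p] by linarith
    also have "\<dots> \<le> C * real p powr (- s) + 2 * sqrt (1 / real N) * ?V \<omega> + 1 / real N * ?W \<omega>"
      using sobolev_tail(2)[OF s \<theta> p] by (intro add_mono) (simp_all add: abs_mult C_def sum_nonneg)
    finally have "\<bar>(\<Sum>\<mu>=1..p. (obs \<theta> \<epsilon> N \<omega> \<mu>)\<^sup>2) - (l2_norm \<theta>)\<^sup>2\<bar> \<le>
        C * real p powr (- s) + 2 * sqrt (1 / real N) * ?V \<omega> + 1 / real N * ?W \<omega>" .
    then have "4 * \<bar>(\<Sum>\<mu>=1..p. (obs \<theta> \<epsilon> N \<omega> \<mu>)\<^sup>2) - (l2_norm \<theta>)\<^sup>2\<bar> \<le>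
        4 * (C * real p powr (- s) + 2 * sqrt (1 / real N) * ?V \<omega> + 1 / real N * ?W \<omega>)" by (rule mult_left_mono) simp
    moreover have "?E \<omega> = 4 * \<bar>(\<Sum>\<mu>=1..p. (obs \<theta> \<epsilon> N \<omega> \<mu>)\<^sup>2) - (l2_norm \<theta>)\<^sup>2\<bar>"
      by (metis abs_mult abs_numeral right_diff_distrib)
    ultimately have "?E \<omega> \<le> 4 * (C * real p powr (- s) + 2 * sqrt (1 / real N) * ?V \<omega> + 1 / real N * ?W \<omega>)"
      by linarith
    then show ?thesis by (simp add: distrib_left mult.assoc[symmetric])
  qed
  have "expectation ?E \<le> expectation (\<lambda>\<omega>. 4 * C * real p powr (- s) + 8 * sqrt (1 / real N) * ?V \<omega> + 4 / real N * ?W \<omega>)"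
    by (rule integral_mono[OF 1 _ pw]) (use V1 W1 in simp)
  also have "\<dots> = 4 * C * real p powr (- s) + 8 * sqrt (1 / real N) * expectation ?V + 4 / real N * expectation ?W"
    using V1 W1 by (simp add: prob_space)
  also have "\<dots> \<le> 4 * C * real p powr (- s) + 8 * sqrt (1 / real N) * l2_norm \<theta> + 4 * (real p / real N)"
    using V2 l0 unfolding W2 by (intro add_mono order_refl mult_left_mono) auto
  finally show "expectation ?E \<le> 4 * C * real p powr (- s) + 8 * sqrt (1 / real N) * l2_norm \<theta> + 4 * (real p / real N)" .
qed

text \<open>The interface between the bounds at fixed data and the law of the data. The majorant is
  linear in the squares of the observations apart from the energy error, so their second moments
  suffice. The weights \<open>\<tau>\<close> accommodate the Gaussian prior.\<close>

lemma is_Op_of_energy_bound: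
  assumes s: "s > 0" and \<theta>: "\<theta> \<in> sobolev s" and K: "K \<ge> 0" and v: "v = 4 * (l2_norm \<theta>)\<^sup>2"
    and X: "\<forall>\<^sub>F N in sequentially. \<forall>\<omega>. \<bar>X N \<omega>\<bar> \<le>
      K * (r N * (1 + (\<Sum>\<mu>=1..p N. (obs \<theta> \<epsilon> N \<omega> \<mu>)\<^sup>2)) + (\<Sum>\<mu>=1..p N. \<tau> N \<mu> * (obs \<theta> \<epsilon> N \<omega> \<mu>)\<^sup>2)
        + \<bar>4 * (\<Sum>\<mu>=1..p N. (obs \<theta> \<epsilon> N \<omega> \<mu>)\<^sup>2) - v\<bar>)"
    and \<tau>: "\<forall>\<^sub>F N in sequentially. (\<Sum>\<mu>=1..p N. \<tau> N \<mu> * ((\<theta> \<mu>)\<^sup>2 + 1 / real N)) \<le> K * r N"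
    and r: "\<forall>\<^sub>F N in sequentially. real (p N) powr (- s) + sqrt (real (p N) * ln (real N) / real N) \<le> r N"
    and p: "\<forall>\<^sub>F N in sequentially. 1 \<le> p N \<and> p N \<le> N"
  shows "is_Op M X r"
proof -
  define C where "C = (\<Sum>\<^sub>\<infinity>\<mu>\<in>{1..}. real \<mu> powr (2 * s) * (\<theta> \<mu>)\<^sup>2)"
  define l where "l = l2_norm \<theta>"
  have l: "l \<ge> 0" by (simp add: l_def l2_norm_def infsum_nonneg)
  have C: "C \<ge> 0" unfolding C_def by (rule sobolev_tail(3)[OF s \<theta>, of 1]) simp
  show ?thesis
  \<comment> \<open>2 + l^2 bounds 1 plus the mean energy, using p \<le> N; the inner K comes from
    the weighted sum; the last three terms come from the energy error.\<close>
  proof (rule is_Op_of_expectation_le[where K="K * (2 + l\<^sup>2 + K + 4 * C + 8 * l + 4)"])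
    show "\<forall>\<^sub>F N in sequentially. r N > 0" using r p
    proof eventually_elim
      case (elim N)
      have "real (p N) powr (- s) > 0" using elim by simp
      moreover have "sqrt (real (p N) * ln (real N) / real N) \<ge> 0" using elim by simp
      ultimately show ?case using elim by linarith
    qed
    show "\<forall>\<^sub>F N in sequentially. \<exists>D. integrable M D \<and> (\<forall>\<omega>\<in>space M. \<bar>X N \<omega>\<bar> \<le> D \<omega>) \<and>
       integral\<^sup>L M D \<le> K * (2 + l\<^sup>2 + K + 4 * C + 8 * l + 4) * r N"
      using X \<tau> r p eventually_ge_at_top[of 3]
    proof eventually_elim
      case (elim N)
      have N: "N \<ge> 1" and p1: "p N \<ge> 1" using elim by auto
      let ?Q = "\<lambda>\<omega>. \<Sum>\<mu>=1..p N. (obs \<theta> \<epsilon> N \<omega> \<mu>)\<^sup>2"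
      let ?W = "\<lambda>\<omega>. \<Sum>\<mu>=1..p N. \<tau> N \<mu> * (obs \<theta> \<epsilon> N \<omega> \<mu>)\<^sup>2"
      define \<rho> where "\<rho> = sqrt (real (p N) * ln (real N) / real N)"
      have \<rho>0: "\<rho> \<ge> 0" and \<rho>1: "sqrt (1 / real N) \<le> \<rho>" and \<rho>2: "real (p N) / real N \<le> \<rho>"
        unfolding \<rho>_def using log_rate_bounds[of N "p N"] elim by auto
      have ps: "real (p N) powr (- s) \<ge> 0" by simp
      have r1: "real (p N) powr (- s) \<le> r N" "\<rho> \<le> r N" using elim ps \<rho>0 unfolding \<rho>_def by linarith+
      have r0: "r N \<ge> 0" using r1 ps by linarith
      define D where "D = (\<lambda>\<omega>. K * (r N * (1 + ?Q \<omega>) + ?W \<omega> + \<bar>4 * ?Q \<omega> - 4 * (l2_norm \<theta>)\<^sup>2\<bar>))"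
      have iQ: "integrable M ?Q" by (rule expectation_obs_energy[OF N])
      have iW: "integrable M ?W"
        using N by (intro Bochner_Integration.integrable_sum integrable_mult_right obs_square_integrable) auto
      note E = expectation_energy_error[OF N p1 s \<theta>, folded C_def l_def]
      have iD: "integrable M D" unfolding D_def using iQ iW E(1) unfolding l_def by simp
      have "integral\<^sup>L M D = K * (r N * (1 + expectation ?Q) + expectation ?W +
          expectation (\<lambda>\<omega>. \<bar>4 * ?Q \<omega> - 4 * (l2_norm \<theta>)\<^sup>2\<bar>))"
        unfolding D_def using iQ iW E(1) unfolding l_def by (simp add: prob_space)
      also have "\<dots> \<le> K * (r N * (2 + l\<^sup>2) + K * r N + (4 * C * r N + 8 * r N * l + 4 * r N))"
      proof -
        have "expectation ?Q \<le> l\<^sup>2 + 1"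
          unfolding expectation_obs_energy(2)[OF N] l_def using elim N
          by (intro add_mono sobolev_tail(1)[OF s \<theta> p1]) simp
        then have a: "1 + expectation ?Q \<le> 2 + l\<^sup>2" by simp
        have "expectation ?W = (\<Sum>\<mu>=1..p N. \<tau> N \<mu> * ((\<theta> \<mu>)\<^sup>2 + 1 / real N))"
          using N by (subst Bochner_Integration.integral_sum) (auto simp: obs_square_integrable expectation_obs_square)
        then have b: "expectation ?W \<le> K * r N" using elim(2) by simp
        have "expectation (\<lambda>\<omega>. \<bar>4 * ?Q \<omega> - 4 * (l2_norm \<theta>)\<^sup>2\<bar>) \<le>
            4 * C * real (p N) powr (- s) + 8 * sqrt (1 / real N) * l + 4 * (real (p N) / real N)"
          using E(2) unfolding l_def .
        also have "\<dots> \<le> 4 * C * r N + 8 * r N * l + 4 * r N"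
          using r1 \<rho>1 \<rho>2 C l by (intro add_mono mult_left_mono mult_right_mono) auto
        finally have c: "expectation (\<lambda>\<omega>. \<bar>4 * ?Q \<omega> - 4 * (l2_norm \<theta>)\<^sup>2\<bar>) \<le> 4 * C * r N + 8 * r N * l + 4 * r N" .
        show ?thesis by (rule mult_left_mono[OF add_mono[OF add_mono[OF mult_left_mono[OF a r0] b] c] K])
      qed
      also have "\<dots> = K * (2 + l\<^sup>2 + K + 4 * C + 8 * l + 4) * r N" by (simp add: algebra_simps)
      finally have D: "integral\<^sup>L M D \<le> K * (2 + l\<^sup>2 + K + 4 * C + 8 * l + 4) * r N" .
      have "\<forall>\<omega>\<in>space M. \<bar>X N \<omega>\<bar> \<le> D \<omega>" using elim(1) unfolding D_def v by blast
      then show ?case using iD D by blast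
    qed
  qed (rule prob_space_axioms)
qed

end

section \<open>Posterior bounds at fixed data\<close>

text \<open>The bounds on H' and H'' scale by 1 / \<sigma>0 and 1 / \<sigma>0^2 under x / \<sigma>,
  and by a further 1 / N in the normalised score. This is the origin of \<open>A\<close> and
  \<open>B\<close>.\<close>

lemma product_posterior_d_BL_le:
  fixes H H' H'' :: "real \<Rightarrow> real" and \<sigma> y :: "nat \<Rightarrow> real"
  assumes N: "N > 0" and v: "v > 0"
    and H: "\<And>x. (H has_real_derivative H' x) (at x)" and H': "\<And>x. (H' has_real_derivative H'' x) (at x)"
    and a: "\<And>x. \<bar>H' x\<bar> \<le> a" and b: "\<And>x. \<bar>H'' x\<bar> \<le> b"
    and \<sigma>0: "\<sigma>0 > 0" and \<sigma>: "\<And>i. i \<in> {1..p} \<Longrightarrow> \<sigma>0 \<le> \<sigma> i"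
  defines "A \<equiv> a / (real N * \<sigma>0)" and "B \<equiv> b / (real N * \<sigma>0\<^sup>2)" and "Q \<equiv> \<Sum>i=1..p. (y i)\<^sup>2"
  shows "\<bar>d_BL (distr (posterior N p (product_prior H p \<sigma>) y) borel
      (\<lambda>\<theta>. sqrt (real N) * (Phi_product H N p \<sigma> y \<theta> - Psi_hat N p y))) (normal_dist 0 v)\<bar> \<le>
    4 / v * (6 * sqrt ((1 + B) / N * Q) + p * ((4 + 4 * B) * ((1 + B) / N) + (3 + 4 * B) * A\<^sup>2)
      + 4 * A * (\<Sum>i=1..p. \<bar>y i\<bar>) + 8 * B * Q + \<bar>4 * Q - v\<bar>)"
proof -
  have \<sigma>pos: "\<sigma> i > 0" if "i \<in> {1..p}" for i using \<sigma>[OF that] \<sigma>0 by linarith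
  have a0: "a \<ge> 0" and b0: "b \<ge> 0" using a[of 0] b[of 0] by linarith+
  define G where "G i x = H (x / \<sigma> i)" for i x
  define h where "h i x = H' (x / \<sigma> i) / \<sigma> i" for i x
  define h' where "h' i x = H'' (x / \<sigma> i) / (\<sigma> i)\<^sup>2" for i x
  have Hcont: "continuous_on UNIV H"
    by (rule DERIV_continuous_on) (rule has_field_derivative_at_within[OF H])
  have [measurable]: "H \<in> borel_measurable borel" by (rule borel_measurable_continuous_onI[OF Hcont])
  have Gm: "G i \<in> borel_measurable borel" for i unfolding G_def[abs_def] by measurable
  have dG: "(G i has_real_derivative h i x) (at x)" if i: "i \<in> {1..p}" for i x
    unfolding G_def[abs_def] h_def
    using DERIV_chain2[where f=H and g="\<lambda>x. x / \<sigma> i" and x=x and s=UNIV, OF H DERIV_cdivide[OF DERIV_ident]] by simp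
  have dh: "(h i has_real_derivative h' i x) (at x)" if i: "i \<in> {1..p}" for i x
    unfolding h_def[abs_def] h'_def power2_eq_square
    using DERIV_cdivide[OF DERIV_chain2[where f=H' and g="\<lambda>x. x / \<sigma> i" and x=x and s=UNIV,
        OF H' DERIV_cdivide[OF DERIV_ident]], of "\<sigma> i"] by simp
  have h'b: "\<bar>h' i x\<bar> \<le> b / \<sigma>0\<^sup>2" if i: "i \<in> {1..p}" for i x
    unfolding h'_def abs_divide using b b0 \<sigma>[OF i] \<sigma>0 by (intro frac_le) (auto intro: power_mono)
  have hb: "\<bar>h i x\<bar> \<le> a / \<sigma>0" if i: "i \<in> {1..p}" for i x
    unfolding h_def abs_divide using a a0 \<sigma>[OF i] \<sigma>0 by (intro frac_le) auto
  \<comment> \<open>H is Lipschitz, so the prior density grows at most exponentially, even when it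
    is improper.\<close>
  have Gb: "\<exists>K\<ge>0. \<forall>x. - G i x \<le> K * (1 + \<bar>x\<bar>)" if i: "i \<in> {1..p}" for i
  proof (intro exI conjI allI)
    show "\<bar>H 0\<bar> + a / \<sigma>0 \<ge> 0" using a0 \<sigma>0 by simp
    fix x
    have "norm (G i x - G i 0) \<le> a / \<sigma>0 * norm (x - 0)"
      by (rule field_differentiable_bound[of UNIV "G i" "h i"])
         (use dG[OF i] hb[OF i] in \<open>auto intro: has_field_derivative_at_within\<close>)
    then have "- G i x \<le> \<bar>H 0\<bar> + a / \<sigma>0 * \<bar>x\<bar>" using abs_ge_minus_self[of "H 0"] by (simp add: G_def abs_le_iff)
    also have "\<dots> \<le> (\<bar>H 0\<bar> + a / \<sigma>0) * (1 + \<bar>x\<bar>)"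
      using a0 \<sigma>0 by (simp add: distrib_left distrib_right)
    finally show "- G i x \<le> (\<bar>H 0\<bar> + a / \<sigma>0) * (1 + \<bar>x\<bar>)" .
  qed
  have k: "1 / \<sigma> i > 0" if "i \<in> {1..p}" for i using \<sigma>pos[OF that] by simp
  obtain q where sf: "score_family (real N) {1..p} q (\<lambda>i x. x - y i + h i x / N) (\<lambda>i x. 1 + h' i x / N) (1 + (b / \<sigma>0\<^sup>2) / N)"
    and post: "posterior N p (density (lborel_p p) (\<lambda>\<theta>. \<Prod>i=1..p. ennreal (1 / \<sigma> i * exp (- G i (\<theta> i))))) y =
       score_family.P {1..p} q"
    by (rule posterior_score_family[OF N Gm dG dh h'b Gb k, where Y=y])
  interpret score_family "real N" "{1..p}" q "\<lambda>i x. x - y i + h i x / N" "\<lambda>i x. 1 + h' i x / N" y "1 + (b / \<sigma>0\<^sup>2) / N"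
    by (rule sf)
  have prior: "product_prior H p \<sigma> = density (lborel_p p) (\<lambda>\<theta>. \<Prod>i=1..p. ennreal (1 / \<sigma> i * exp (- G i (\<theta> i))))"
    unfolding product_prior_def G_def using k
    by (subst prod_ennreal) (auto simp: less_imp_le)
  have dH: "deriv H x = H' x" for x by (rule DERIV_imp_deriv[OF H])
  have "sqrt (real N) * (Phi_product H N p \<sigma> y \<theta> - Psi_hat N p y) = Z \<theta>" for \<theta>
  proof -
    \<comment> \<open>The shift - 2 p / N and the + p / N from the centring leave - 1 / N per
      coordinate; then \<theta>^2 - y^2 and the correction term share the factor \<theta> +
      y.\<close>
    have "Phi_product H N p \<sigma> y \<theta> - Psi_hat N p y =
        (\<Sum>i=1..p. (\<theta> i)\<^sup>2 + h i (\<theta> i) / real N * (y i + \<theta> i)) - (\<Sum>i=1..p. (y i)\<^sup>2 + 1 / real N)"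
      unfolding Phi_product_def Psi_hat_def dH h_def by (simp add: sum.distrib sum_subtractf field_simps)
    also have "\<dots> = (\<Sum>i=1..p. (\<theta> i + y i) * (\<theta> i - y i + h i (\<theta> i) / real N) - 1 / real N)"
      unfolding sum_subtractf[symmetric] by (intro sum.cong) (auto simp: algebra_simps power2_eq_square add_divide_distrib)
    finally show ?thesis by (simp only: Z_def)
  qed
  then have "\<bar>d_BL (distr (posterior N p (product_prior H p \<sigma>) y) borel
      (\<lambda>\<theta>. sqrt (real N) * (Phi_product H N p \<sigma> y \<theta> - Psi_hat N p y))) (normal_dist 0 v)\<bar> =
      \<bar>d_BL (distr P borel Z) (normal_dist 0 v)\<bar>"
    unfolding prior post by simp
  also have "\<dots> \<le> 4 / v * (\<integral>x. \<bar>T x - v\<bar> \<partial>P)" by (rule d_BL_le[OF v])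
  finally have le: "\<bar>d_BL (distr (posterior N p (product_prior H p \<sigma>) y) borel
      (\<lambda>\<theta>. sqrt (real N) * (Phi_product H N p \<sigma> y \<theta> - Psi_hat N p y))) (normal_dist 0 v)\<bar> \<le> 4 / v * (\<integral>x. \<bar>T x - v\<bar> \<partial>P)" .
  have "(\<integral>x. \<bar>T x - v\<bar> \<partial>P) \<le> 6 * sqrt ((1 + B) / N * Q) + real p * ((4 + 4 * B) * ((1 + B) / N) + (3 + 4 * B) * A\<^sup>2)
      + 4 * A * (\<Sum>i=1..p. \<bar>y i\<bar>) + 8 * B * Q + \<bar>4 * Q - v\<bar>"
  proof -
    have card: "card {1..p} = p" by simp
    have BN: "1 + (b / \<sigma>0\<^sup>2) / N = 1 + B" by (simp add: B_def mult.commute)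
    have "\<bar>(x - y i + h i x / N) - (x - y i)\<bar> \<le> A" if i: "i \<in> {1..p}" for i x
      using hb[OF i, of x] N by (simp add: A_def field_simps)
    moreover have "\<bar>(1 + h' i x / N) - 1\<bar> \<le> B" if i: "i \<in> {1..p}" for i x
      using divide_right_mono[OF h'b[OF i, of x], of "real N"] N by (simp add: B_def mult.commute)
    moreover have "A \<ge> 0" "B \<ge> 0" using a0 b0 \<sigma>0 by (simp_all add: A_def B_def)
    ultimately show ?thesis
      using expectation_T_perturbed[of A B v] unfolding BN Q_def card by blast
  qed
  from mult_left_mono[OF this, of "4 / v"] v le show ?thesis by (meson divide_nonneg_pos order_trans zero_le_numeral)
qed

lemma normal_density_eq_exp:
  "\<sigma> > 0 \<Longrightarrow> normal_density 0 (sqrt (\<sigma>\<^sup>2)) x = 1 / sqrt (2 * pi * \<sigma>\<^sup>2) * exp (- (x\<^sup>2 / (2 * \<sigma>\<^sup>2)))"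
  by (simp add: normal_density_def)

text \<open>The lower bound on \<sigma>^2 limits the curvature of the negative log-prior to N / c^2,
  so the Lipschitz constant \<open>L\<close> of the score is free of N.\<close>

lemma gaussian_posterior_d_BL_le:
  fixes \<sigma> y :: "nat \<Rightarrow> real"
  assumes N: "N > 0" and v: "v > 0" and c: "c > 0"
    and \<sigma>: "\<And>i. i \<in> {1..p} \<Longrightarrow> \<sigma> i > 0" "\<And>i. i \<in> {1..p} \<Longrightarrow> (\<sigma> i)\<^sup>2 \<ge> c\<^sup>2 / real N"
  defines "L \<equiv> 1 + 1 / c\<^sup>2" and "Q \<equiv> \<Sum>i=1..p. (y i)\<^sup>2"
  shows "\<bar>d_BL (distr (posterior N p (gaussian_prior p \<sigma>) y) borel
      (\<lambda>\<theta>. sqrt (real N) * (Phi_gaussian N p \<sigma> y \<theta> - Psi_hat N p y))) (normal_dist 0 v)\<bar> \<le>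
    4 / v * (6 * sqrt (L / N * Q) + 2 * real p * (L / N) + (\<Sum>i=1..p. 1 / (N * (\<sigma> i)\<^sup>2) * (y i)\<^sup>2) + \<bar>4 * Q - v\<bar>)"
proof -
  define G where "G i x = x\<^sup>2 / (2 * (\<sigma> i)\<^sup>2)" for i x
  define h where "h i x = x / (\<sigma> i)\<^sup>2" for i x
  define h' where "h' i x = 1 / (\<sigma> i)\<^sup>2" for i and x :: real
  define k where "k i = 1 / sqrt (2 * pi * (\<sigma> i)\<^sup>2)" for i
  have Gm: "G i \<in> borel_measurable borel" for i unfolding G_def[abs_def] by measurable
  have dG: "(G i has_real_derivative h i x) (at x)" if i: "i \<in> {1..p}" for i x
    unfolding G_def[abs_def] h_def using DERIV_cdivide[OF DERIV_power[OF DERIV_ident, of 2 x UNIV], of "2 * (\<sigma> i)\<^sup>2"] by simp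
  have dh: "(h i has_real_derivative h' i x) (at x)" if i: "i \<in> {1..p}" for i x
    unfolding h_def[abs_def] h'_def by (rule DERIV_cdivide[OF DERIV_ident])
  have h'b: "\<bar>h' i x\<bar> \<le> real N / c\<^sup>2" if i: "i \<in> {1..p}" for i x
    unfolding h'_def using \<sigma>[OF i] c N by (simp add: field_simps)
  have Gb: "\<exists>K\<ge>0. \<forall>x. - G i x \<le> K * (1 + \<bar>x\<bar>)" if i: "i \<in> {1..p}" for i
    by (intro exI[of _ 0]) (simp add: G_def)
  have k: "k i > 0" if "i \<in> {1..p}" for i using \<sigma>(1)[OF that] by (simp add: k_def)
  obtain q where sf: "score_family (real N) {1..p} q (\<lambda>i x. x - y i + h i x / N) (\<lambda>i x. 1 + h' i x / N) (1 + (N / c\<^sup>2) / N)"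
    and post: "posterior N p (density (lborel_p p) (\<lambda>\<theta>. \<Prod>i=1..p. ennreal (k i * exp (- G i (\<theta> i))))) y =
       score_family.P {1..p} q"
    by (rule posterior_score_family[OF N Gm dG dh h'b Gb k, where Y=y])
  interpret score_family "real N" "{1..p}" q "\<lambda>i x. x - y i + h i x / N" "\<lambda>i x. 1 + h' i x / N" y "1 + (N / c\<^sup>2) / N"
    by (rule sf)
  have "gaussian_prior p \<sigma> = PiM {1..p} (\<lambda>i. density lborel (\<lambda>x. ennreal (k i * exp (- G i x))))"
    unfolding gaussian_prior_def normal_dist_def k_def G_def
    by (intro PiM_cong refl) (simp only: normal_density_eq_exp[OF \<sigma>(1)])
  also have "\<dots> = density (lborel_p p) (\<lambda>\<theta>. \<Prod>i=1..p. ennreal (k i * exp (- G i (\<theta> i))))"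
    by (rule density_lborel_p[symmetric]) (use Gm in measurable)
  finally have prior: "gaussian_prior p \<sigma> = density (lborel_p p) (\<lambda>\<theta>. \<Prod>i=1..p. ennreal (k i * exp (- G i (\<theta> i))))" .
  have "sqrt (real N) * (Phi_gaussian N p \<sigma> y \<theta> - Psi_hat N p y) = Z \<theta>" for \<theta>
  proof -
    have "Phi_gaussian N p \<sigma> y \<theta> - Psi_hat N p y =
        (\<Sum>i=1..p. (\<theta> i)\<^sup>2 + h i (\<theta> i) / real N * (y i + \<theta> i)) - (\<Sum>i=1..p. (y i)\<^sup>2 + 1 / real N)"
      unfolding Phi_gaussian_def Psi_hat_def h_def by (simp add: sum.distrib sum_subtractf field_simps)
    also have "\<dots> = (\<Sum>i=1..p. (\<theta> i + y i) * (\<theta> i - y i + h i (\<theta> i) / real N) - 1 / real N)"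
      unfolding sum_subtractf[symmetric] by (intro sum.cong) (auto simp: algebra_simps power2_eq_square add_divide_distrib)
    finally show ?thesis by (simp only: Z_def)
  qed
  then have "\<bar>d_BL (distr (posterior N p (gaussian_prior p \<sigma>) y) borel
      (\<lambda>\<theta>. sqrt (real N) * (Phi_gaussian N p \<sigma> y \<theta> - Psi_hat N p y))) (normal_dist 0 v)\<bar> =
      \<bar>d_BL (distr P borel Z) (normal_dist 0 v)\<bar>"
    unfolding prior post by simp
  also have "\<dots> \<le> 4 / v * (\<integral>x. \<bar>T x - v\<bar> \<partial>P)" by (rule d_BL_le[OF v])
  finally have le: "\<bar>d_BL (distr (posterior N p (gaussian_prior p \<sigma>) y) borel
      (\<lambda>\<theta>. sqrt (real N) * (Phi_gaussian N p \<sigma> y \<theta> - Psi_hat N p y))) (normal_dist 0 v)\<bar> \<le> 4 / v * (\<integral>x. \<bar>T x - v\<bar> \<partial>P)" .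
  have "(\<integral>x. \<bar>T x - v\<bar> \<partial>P) \<le> 6 * sqrt (L / N * Q) + 2 * real p * (L / N)
      + (\<Sum>i=1..p. 1 / (N * (\<sigma> i)\<^sup>2) * (y i)\<^sup>2) + \<bar>4 * Q - v\<bar>"
  proof -
    have card: "card {1..p} = p" by simp
    have LN: "1 + (N / c\<^sup>2) / N = L" using N by (simp add: L_def)
    have L0: "L \<ge> 0" by (simp add: L_def)
    have "x - y i + h i x / N = (1 + 1 / (N * (\<sigma> i)\<^sup>2)) * x - y i" for i x
      by (simp add: h_def algebra_simps)
    moreover have "1 + h' i x / N = 1 + 1 / (N * (\<sigma> i)\<^sup>2)" for i x by (simp add: h'_def mult.commute)
    moreover have "1 / (N * (\<sigma> i)\<^sup>2) \<ge> 0" for i by simp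
    ultimately show ?thesis
      using expectation_T_linear[of "\<lambda>i. 1 / (N * (\<sigma> i)\<^sup>2)" v] L0 unfolding LN Q_def card by blast
  qed
  from mult_left_mono[OF this, of "4 / v"] v le show ?thesis by (meson divide_nonneg_pos order_trans zero_le_numeral)
qed

text \<open>Square roots of the energy are traded for 1 + Q, so that the later expectation over the
  data involves Q only linearly.\<close>

lemma sqrt_energy_le:
  assumes "N > 0" and "L \<ge> 0" "L \<le> M" "1 \<le> M" and "Q \<ge> 0"
  shows "sqrt (L / real N * Q) \<le> M * (sqrt (1 / real N) * (1 + Q))"
proof (rule real_le_lsqrt)
  have "L / real N * Q \<le> M\<^sup>2 / real N * (1 + Q)\<^sup>2"
  proof (intro mult_mono divide_right_mono)
    have "M * 1 \<le> M * M" using assms by (intro mult_left_mono) auto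
    then show "L \<le> M\<^sup>2" using assms unfolding power2_eq_square by linarith
    show "Q \<le> (1 + Q)\<^sup>2" using assms by (simp add: power2_eq_square algebra_simps)
  qed (use assms in auto)
  also have "\<dots> = (M * (sqrt (1 / real N) * (1 + Q)))\<^sup>2"
    using assms by (simp add: power_mult_distrib power_divide)
  finally show "L / real N * Q \<le> (M * (sqrt (1 / real N) * (1 + Q)))\<^sup>2" .
qed (use assms in auto)

text \<open>Cauchy-Schwarz, followed by the same passage from Q to (1 + Q)^2.\<close>

lemma sum_abs_le_sqrt_energy:
  fixes y :: "nat \<Rightarrow> real"
  shows "(\<Sum>i=1..p. \<bar>y i\<bar>) \<le> sqrt (real p) * (1 + (\<Sum>i=1..p. (y i)\<^sup>2))"
proof -
  define Q where "Q = (\<Sum>i=1..p. (y i)\<^sup>2)"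
  have Q: "Q \<ge> 0" by (simp add: Q_def sum_nonneg)
  have "(\<Sum>i=1..p. \<bar>y i\<bar>)\<^sup>2 \<le> Q * real p"
    using sum_squared_le_sum_of_squares[of "\<lambda>i. \<bar>y i\<bar>" "{1..p}"] by (simp add: Q_def)
  also have "\<dots> \<le> (1 + Q)\<^sup>2 * real p"
    using Q by (intro mult_right_mono) (auto simp: power2_eq_square algebra_simps)
  also have "\<dots> = (sqrt (real p) * (1 + Q))\<^sup>2" by (simp add: power_mult_distrib mult.commute)
  finally show ?thesis unfolding Q_def[symmetric] by (rule power2_le_imp_le) (use Q in simp)
qed

text \<open>The smallness conditions give B \<le> 1, so every term is a constant times one summand
  of r times 1 + Q. The constant sums the contributions: 12 from the linear part, 16 from the
  squared scores, 7 a^2 = (3 + 4) a^2 and 4 a from the shift of S, 8 b from that of S', and 1 for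
  the energy error.\<close>

lemma product_posterior_rate:
  fixes H H' H'' :: "real \<Rightarrow> real" and \<sigma> y :: "nat \<Rightarrow> real"
  assumes N: "N \<ge> 3" and p: "1 \<le> p" "p \<le> N" and v: "v > 0"
    and H: "\<And>x. (H has_real_derivative H' x) (at x)" and H': "\<And>x. (H' has_real_derivative H'' x) (at x)"
    and a: "\<And>x. \<bar>H' x\<bar> \<le> a" and b: "\<And>x. \<bar>H'' x\<bar> \<le> b"
    and \<sigma>0: "\<sigma>0 > 0" and \<sigma>: "\<And>i. i \<in> {1..p} \<Longrightarrow> \<sigma>0 \<le> \<sigma> i"
    and u: "1 / (real N * \<sigma>0\<^sup>2) \<le> 1" "b * (1 / (real N * \<sigma>0\<^sup>2)) \<le> 1"
    and r: "r = real p powr (- s) + sqrt (real p * ln (real N) / real N) + 1 / (real N * \<sigma>0\<^sup>2)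
      + sqrt (real p) / (real N * \<sigma>0)"
  defines "Q \<equiv> \<Sum>i=1..p. (y i)\<^sup>2"
  shows "\<bar>d_BL (distr (posterior N p (product_prior H p \<sigma>) y) borel
      (\<lambda>\<theta>. sqrt (real N) * (Phi_product H N p \<sigma> y \<theta> - Psi_hat N p y))) (normal_dist 0 v)\<bar> \<le>
    4 / v * (29 + 7 * a\<^sup>2 + 4 * a + 8 * b) * (r * (1 + Q) + \<bar>4 * Q - v\<bar>)" (is "?lhs \<le> _")
proof -
  have N0: "N > 0" using N by simp
  have a0: "a \<ge> 0" and b0: "b \<ge> 0" using a[of 0] b[of 0] by linarith+
  have Q: "Q \<ge> 0" by (simp add: Q_def sum_nonneg)
  define A where "A = a / (real N * \<sigma>0)"
  define B where "B = b / (real N * \<sigma>0\<^sup>2)"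
  define \<rho> where "\<rho> = sqrt (real p * ln (real N) / real N)"
  define w where "w = sqrt (real p) / (real N * \<sigma>0)"
  define t where "t = 1 / (real N * \<sigma>0\<^sup>2)"
  note \<rho> = log_rate_bounds[OF N p, folded \<rho>_def]
  have A0: "A \<ge> 0" and B0: "B \<ge> 0" and w0: "w \<ge> 0" and t0: "t \<ge> 0"
    using a0 b0 \<sigma>0 by (simp_all add: A_def B_def w_def t_def)
  have B1: "B \<le> 1" using u(2) by (simp add: B_def)
  have t1: "t \<le> 1" using u(1) by (simp add: t_def)
  have r': "r = real p powr (- s) + \<rho> + t + w" by (simp add: r \<rho>_def t_def w_def)
  have rb: "\<rho> \<le> r" "t \<le> r" "w \<le> r" "0 \<le> r" using r' \<rho>(1) w0 t0 powr_ge_zero[of "real p" "- s"] by linarith+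
  have r1: "r \<le> r * (1 + Q)" using rb(4) Q by (simp add: distrib_left)
  have 1: "6 * sqrt ((1 + B) / N * Q) \<le> 12 * (r * (1 + Q))"
  proof -
    have "sqrt ((1 + B) / N * Q) \<le> 2 * (sqrt (1 / real N) * (1 + Q))"
      by (rule sqrt_energy_le[OF N0]) (use B0 B1 Q in auto)
    also have "\<dots> \<le> 2 * (r * (1 + Q))"
      using \<rho>(2) rb(1) Q by (intro mult_left_mono mult_right_mono) auto
    finally show ?thesis by simp
  qed
  have 2: "p * ((4 + 4 * B) * ((1 + B) / N)) \<le> 16 * (r * (1 + Q))"
  proof -
    have "(4 + 4 * B) * (1 + B) \<le> 8 * 2" using B0 B1 by (intro mult_mono) auto
    then have "real p / N * ((4 + 4 * B) * (1 + B)) \<le> \<rho> * 16" using \<rho>(1,3) B0 by (intro mult_mono) auto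
    also have "\<dots> \<le> 16 * (r * (1 + Q))" using rb(1) r1 by simp
    finally show ?thesis by simp
  qed
  \<comment> \<open>A^2 equals a^2 t / N, so p copies cost a^2 (p / N) t, and t \<le> 1 reduces this
    to p / N.\<close>
  have 3: "p * ((3 + 4 * B) * A\<^sup>2) \<le> 7 * a\<^sup>2 * (r * (1 + Q))"
  proof -
    have "p * ((3 + 4 * B) * A\<^sup>2) = (3 + 4 * B) * a\<^sup>2 * ((real p / N) * t)"
      by (simp add: A_def t_def power2_eq_square mult_ac)
    also have "\<dots> \<le> 7 * a\<^sup>2 * (\<rho> * 1)"
      using B0 B1 \<rho>(1,3) t0 t1 by (intro mult_mono) auto
    also have "\<dots> \<le> 7 * a\<^sup>2 * (r * (1 + Q))" using rb(1) r1 by (intro mult_left_mono) auto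
    finally show ?thesis .
  qed
  have 4: "4 * A * (\<Sum>i=1..p. \<bar>y i\<bar>) \<le> 4 * a * (r * (1 + Q))"
  proof -
    have "4 * A * (\<Sum>i=1..p. \<bar>y i\<bar>) \<le> 4 * A * (sqrt (real p) * (1 + Q))"
      unfolding Q_def using A0 by (intro mult_left_mono sum_abs_le_sqrt_energy) auto
    also have "\<dots> = 4 * a * (w * (1 + Q))" by (simp add: A_def w_def)
    also have "\<dots> \<le> 4 * a * (r * (1 + Q))" using rb(3) Q a0 by (intro mult_left_mono mult_right_mono) auto
    finally show ?thesis .
  qed
  have 5: "8 * B * Q \<le> 8 * b * (r * (1 + Q))"
  proof -
    have "8 * B * Q = 8 * b * (t * Q)" by (simp add: B_def t_def)
    also have "\<dots> \<le> 8 * b * (r * (1 + Q))" using rb(2,4) t0 Q b0 by (intro mult_left_mono mult_mono) auto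
    finally show ?thesis .
  qed
  have 6: "r * (1 + Q) \<ge> 0" using rb(4) Q by simp
  have "\<bar>4 * Q - v\<bar> \<le> (29 + 7 * a\<^sup>2 + 4 * a + 8 * b) * \<bar>4 * Q - v\<bar>"
    using mult_right_mono[of 1 "29 + 7 * a\<^sup>2 + 4 * a + 8 * b" "\<bar>4 * Q - v\<bar>"] a0 b0 by simp
  then have "6 * sqrt ((1 + B) / N * Q) + p * ((4 + 4 * B) * ((1 + B) / N) + (3 + 4 * B) * A\<^sup>2)
      + 4 * A * (\<Sum>i=1..p. \<bar>y i\<bar>) + 8 * B * Q + \<bar>4 * Q - v\<bar> \<le>
      (29 + 7 * a\<^sup>2 + 4 * a + 8 * b) * (r * (1 + Q)) + (29 + 7 * a\<^sup>2 + 4 * a + 8 * b) * \<bar>4 * Q - v\<bar>"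
    using 1 2 3 4 5 6 unfolding distrib_left[of "real p"] distrib_right[of _ _ "r * (1 + Q)"] by linarith
  then have "4 / v * (6 * sqrt ((1 + B) / N * Q) + p * ((4 + 4 * B) * ((1 + B) / N) + (3 + 4 * B) * A\<^sup>2)
      + 4 * A * (\<Sum>i=1..p. \<bar>y i\<bar>) + 8 * B * Q + \<bar>4 * Q - v\<bar>) \<le>
      4 / v * ((29 + 7 * a\<^sup>2 + 4 * a + 8 * b) * (r * (1 + Q) + \<bar>4 * Q - v\<bar>))"
    using v by (intro mult_left_mono) (auto simp: distrib_left)
  moreover have "?lhs \<le> 4 / v * (6 * sqrt ((1 + B) / N * Q) + p * ((4 + 4 * B) * ((1 + B) / N) + (3 + 4 * B) * A\<^sup>2)
      + 4 * A * (\<Sum>i=1..p. \<bar>y i\<bar>) + 8 * B * Q + \<bar>4 * Q - v\<bar>)"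
    unfolding A_def B_def Q_def by (rule product_posterior_d_BL_le[OF N0 v H H' a b \<sigma>0 \<sigma>])
  ultimately show ?thesis by (simp only: mult.assoc)
qed

text \<open>The constant 8 L is 6 L from the linear part plus 2 L from the squared scores. The
  weighted sum stays explicit, because the link between \<sigma> and \<theta>0 can only be exploited
  after averaging over the data.\<close>

lemma gaussian_posterior_rate:
  fixes \<sigma> y :: "nat \<Rightarrow> real"
  assumes N: "N \<ge> 3" and p: "1 \<le> p" "p \<le> N" and v: "v > 0" and c: "c > 0"
    and \<sigma>: "\<And>i. i \<in> {1..p} \<Longrightarrow> \<sigma> i > 0" "\<And>i. i \<in> {1..p} \<Longrightarrow> (\<sigma> i)\<^sup>2 \<ge> c\<^sup>2 / real N"
    and r: "r = real p powr (- s) + sqrt (real p * ln (real N) / real N)"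
  defines "L \<equiv> 1 + 1 / c\<^sup>2" and "Q \<equiv> \<Sum>i=1..p. (y i)\<^sup>2"
  shows "\<bar>d_BL (distr (posterior N p (gaussian_prior p \<sigma>) y) borel
      (\<lambda>\<theta>. sqrt (real N) * (Phi_gaussian N p \<sigma> y \<theta> - Psi_hat N p y))) (normal_dist 0 v)\<bar> \<le>
    4 / v * (8 * L) * (r * (1 + Q) + (\<Sum>i=1..p. 1 / (N * (\<sigma> i)\<^sup>2) * (y i)\<^sup>2) + \<bar>4 * Q - v\<bar>)" (is "?lhs \<le> _")
proof -
  have N0: "N > 0" using N by simp
  have Q: "Q \<ge> 0" by (simp add: Q_def sum_nonneg)
  have L: "L \<ge> 1" by (simp add: L_def)
  define \<rho> where "\<rho> = sqrt (real p * ln (real N) / real N)"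
  define W where "W = (\<Sum>i=1..p. 1 / (N * (\<sigma> i)\<^sup>2) * (y i)\<^sup>2)"
  have W: "W \<ge> 0" unfolding W_def by (intro sum_nonneg) simp
  note \<rho> = log_rate_bounds[OF N p, folded \<rho>_def]
  have rb: "\<rho> \<le> r" "0 \<le> r" using \<rho>(1) powr_ge_zero[of "real p" "- s"] unfolding r \<rho>_def[symmetric] by linarith+
  have r1: "r \<le> r * (1 + Q)" using rb Q by (simp add: distrib_left)
  have 1: "6 * sqrt (L / N * Q) \<le> 6 * (L * (r * (1 + Q)))"
  proof -
    have "sqrt (L / N * Q) \<le> L * (sqrt (1 / real N) * (1 + Q))"
      by (rule sqrt_energy_le[OF N0]) (use L Q in auto)
    also have "\<dots> \<le> L * (r * (1 + Q))"
      using \<rho>(2) rb(1) Q L by (intro mult_left_mono mult_right_mono) auto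
    finally show ?thesis by simp
  qed
  have 2: "2 * real p * (L / N) \<le> 2 * (L * (r * (1 + Q)))"
  proof -
    have "L * (real p / N) \<le> L * (r * (1 + Q))" using \<rho>(3) rb(1) r1 L by (intro mult_left_mono) auto
    then have "2 * (L * (real p / N)) \<le> 2 * (L * (r * (1 + Q)))" by simp
    then show ?thesis by (simp add: mult_ac)
  qed
  define e where "e = \<bar>4 * Q - v\<bar>"
  have 3: "1 * (W + e) \<le> 8 * L * (W + e)" using L W by (intro mult_right_mono) (auto simp: e_def)
  then have "6 * sqrt (L / N * Q) + 2 * real p * (L / N) + W + e \<le> 8 * (L * (r * (1 + Q))) + 8 * L * (W + e)"
    using add_mono[OF add_mono[OF 1 2] 3] by (simp only: mult_1 add.assoc[symmetric] distrib_right[symmetric]) simp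
  then have "4 / v * (6 * sqrt (L / N * Q) + 2 * real p * (L / N) + W + e) \<le> 4 / v * (8 * L * (r * (1 + Q) + W + e))"
    using v by (intro mult_left_mono) (auto simp: distrib_left)
  moreover have "?lhs \<le> 4 / v * (6 * sqrt (L / N * Q) + 2 * real p * (L / N) + W + e)"
    unfolding L_def Q_def W_def e_def by (rule gaussian_posterior_d_BL_le[OF N0 v c \<sigma>])
  ultimately show ?thesis unfolding W_def[symmetric] e_def by (simp only: mult.assoc)
qed

section \<open>Asymptotics\<close>

lemma sobolev_dimension_tendsto:
  assumes s: "s > 0" and o: "(\<lambda>N. real N powr (1 / (4 * s))) \<in> o(\<lambda>N. real (p N))"
  shows "filterlim (\<lambda>N. real (p N)) at_top sequentially"
proof (rule filterlim_at_top_mono)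
  show "filterlim (\<lambda>N. real N powr (1 / (4 * s))) at_top sequentially"
    using s by real_asymp
  show "\<forall>\<^sub>F N in sequentially. real N powr (1 / (4 * s)) \<le> real (p N)"
    using landau_o.smallD[OF o, of 1] by simp
qed

lemma log_rate_tendsto:
  assumes "(\<lambda>N. real (p N)) \<in> o(\<lambda>N. real N / ln (real N))"
  shows "(\<lambda>N. real (p N) * ln (real N) / real N) \<longlonglongrightarrow> 0"
  using smalloD_tendsto[OF assms] by simp

lemma dimension_le_sample_size:
  assumes o: "(\<lambda>N. real (p N)) \<in> o(\<lambda>N. real N / ln (real N))"
  shows "\<forall>\<^sub>F N in sequentially. p N \<le> N"
  using order_tendstoD(2)[OF log_rate_tendsto[OF o] zero_less_one] eventually_ge_at_top[of 3]
proof eventually_elim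
  case (elim N)
  have "ln (real N) \<ge> 1" using elim exp_le ln_mono[of "exp 1" "real N"] by simp
  then have "real (p N) * 1 \<le> real (p N) * ln (real N)" by (intro mult_left_mono) auto
  also have "\<dots> \<le> real N" using elim by (simp add: field_simps)
  finally show ?case by simp
qed

lemma base_rate_tendsto:
  assumes s: "s > 0" and p: "filterlim (\<lambda>N. real (p N)) at_top sequentially"
    and o: "(\<lambda>N. real (p N)) \<in> o(\<lambda>N. real N / ln (real N))"
  shows "(\<lambda>N. real (p N) powr (- s) + sqrt (real (p N) * ln (real N) / real N)) \<longlonglongrightarrow> 0"
  using tendsto_add[OF tendsto_neg_powr[OF _ p] tendsto_real_sqrt[OF log_rate_tendsto[OF o]], of "- s"] s
  by simp

text \<open>Everything is compared with N^(-1/2) / \<sigma>0: the first sequence is its square, and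
  the second lies below it because p \<le> N.\<close>

lemma scale_rate_tendsto:
  assumes \<sigma>0: "(\<lambda>N. real N powr (-1/2)) \<in> o(\<sigma>0)"
    and pos: "\<forall>\<^sub>F N in sequentially. \<sigma>0 N > 0" and p: "\<forall>\<^sub>F N in sequentially. p N \<le> N"
  shows "(\<lambda>N. 1 / (real N * (\<sigma>0 N)\<^sup>2)) \<longlonglongrightarrow> 0"
    "(\<lambda>N. sqrt (real (p N)) / (real N * \<sigma>0 N)) \<longlonglongrightarrow> 0"
proof -
  have lim: "(\<lambda>N. real N powr (-1/2) / \<sigma>0 N) \<longlonglongrightarrow> 0" by (rule smalloD_tendsto[OF \<sigma>0])
  have sq: "real N powr (-1/2) = 1 / sqrt (real N)" for N
    by (simp add: powr_minus_divide powr_half_sqrt)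
  have "(real N powr (-1/2) / \<sigma>0 N)\<^sup>2 = 1 / (real N * (\<sigma>0 N)\<^sup>2)" for N
    unfolding sq by (simp add: power_divide power_mult_distrib)
  with tendsto_power[OF lim, of 2] show "(\<lambda>N. 1 / (real N * (\<sigma>0 N)\<^sup>2)) \<longlonglongrightarrow> 0"
    by (simp only: zero_power2)
  show "(\<lambda>N. sqrt (real (p N)) / (real N * \<sigma>0 N)) \<longlonglongrightarrow> 0"
  proof (rule tendsto_sandwich[OF _ _ tendsto_const lim])
    show "\<forall>\<^sub>F N in sequentially. 0 \<le> sqrt (real (p N)) / (real N * \<sigma>0 N)"
      using pos by eventually_elim simp
    show "\<forall>\<^sub>F N in sequentially. sqrt (real (p N)) / (real N * \<sigma>0 N) \<le> real N powr (-1/2) / \<sigma>0 N"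
      using pos p eventually_gt_at_top[of 0]
    proof eventually_elim
      case (elim N)
      have "sqrt (real (p N)) / (real N * \<sigma>0 N) \<le> sqrt (real N) / (real N * \<sigma>0 N)"
        using elim by (intro divide_right_mono) auto
      also have "\<dots> = real N powr (-1/2) / \<sigma>0 N"
        unfolding sq using elim by (simp add: field_simps)
      finally show ?case .
    qed
  qed
qed

theorem corollary2:
  fixes M :: "'a measure" and \<epsilon> :: "nat \<Rightarrow> 'a \<Rightarrow> real"
    and \<theta>0 :: "nat \<Rightarrow> real" and s :: real
    and p :: "nat \<Rightarrow> nat" and \<sigma> :: "nat \<Rightarrow> nat \<Rightarrow> real"
  defines "Y \<equiv> obs \<theta>0 \<epsilon>"
    and "\<Psi> \<equiv> \<lambda>N \<omega>. Psi_hat N (p N) (obs \<theta>0 \<epsilon> N \<omega>)"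
    and "v \<equiv> 4 * (l2_norm \<theta>0)\<^sup>2"
  assumes "prob_space M" and "iid_std_normal M \<epsilon>"
    and "s > 0" and "\<theta>0 \<in> sobolev s" and "\<exists>\<mu>\<ge>1. \<theta>0 \<mu> \<noteq> 0"
    and "(\<lambda>N. real N powr (1 / (4 * s))) \<in> o(\<lambda>N. real (p N))"
  shows
    "(\<forall>H :: real \<Rightarrow> real.
        (\<forall>x. H differentiable (at x)) \<longrightarrow> (\<forall>x. deriv H differentiable (at x)) \<longrightarrow>
        bounded (range (deriv H)) \<longrightarrow> bounded (range (deriv (deriv H))) \<longrightarrow>
        (\<lambda>_. 1) \<in> o(\<lambda>N. real (p N)) \<longrightarrow>
        (\<lambda>N. real (p N)) \<in> o(\<lambda>N. real N / ln (real N)) \<longrightarrow>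
        (\<forall>N\<ge>1. \<forall>\<mu>\<in>{1..p N}. \<sigma> N \<mu> > 0) \<longrightarrow>
        (\<lambda>N. real N powr (-1/2)) \<in> o(\<lambda>N. Min (\<sigma> N ` {1..p N})) \<longrightarrow>
        (let post = (\<lambda>N \<omega>. posterior N (p N) (product_prior H (p N) (\<sigma> N)) (Y N \<omega>));
             \<Phi> = (\<lambda>N \<omega>. Phi_product H N (p N) (\<sigma> N) (Y N \<omega>));
             \<sigma>min = (\<lambda>N. Min (\<sigma> N ` {1..p N}))
         in is_Op M (bvm_dist post \<Phi> \<Psi> v)
              (\<lambda>N. real (p N) powr (-s) + sqrt (real (p N) * ln (real N) / real N)
                    + 1 / (real N * (\<sigma>min N)\<^sup>2) + sqrt (real (p N)) / (real N * \<sigma>min N)) \<and>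
            is_op M (bvm_dist post \<Phi> \<Psi> v) (\<lambda>_. 1) \<and>
            (s > 1/4 \<longrightarrow>
             (\<lambda>N. real N powr (1 / (4 * s))) \<in> o(\<lambda>N. real (p N)) \<longrightarrow>
             (\<lambda>N. real (p N)) \<in> o(\<lambda>N. real N / ln (real N)) \<longrightarrow>
             bvm_phenomenon M post \<Phi> \<Psi> v))) \<and>
     (\<forall>c>0.
        (\<forall>N\<ge>1. \<forall>\<mu>\<in>{1..p N}. \<sigma> N \<mu> \<ge> c * max (real N powr (-1/2)) \<bar>\<theta>0 \<mu>\<bar>) \<longrightarrow>
        (\<lambda>N. real (p N)) \<in> o(\<lambda>N. real N / ln (real N)) \<longrightarrow>
        (let post = (\<lambda>N \<omega>. posterior N (p N) (gaussian_prior (p N) (\<sigma> N)) (Y N \<omega>));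
             \<Phi> = (\<lambda>N \<omega>. Phi_gaussian N (p N) (\<sigma> N) (Y N \<omega>))
         in is_Op M (bvm_dist post \<Phi> \<Psi> v)
              (\<lambda>N. real (p N) powr (-s) + sqrt (real (p N) * ln (real N) / real N)) \<and>
            is_op M (bvm_dist post \<Phi> \<Psi> v) (\<lambda>_. 1) \<and>
            (s > 1/4 \<longrightarrow>
             (\<lambda>N. real N powr (1 / (4 * s))) \<in> o(\<lambda>N. real (p N)) \<longrightarrow>
             (\<lambda>N. real (p N)) \<in> o(\<lambda>N. real N / ln (real N)) \<longrightarrow>
             bvm_phenomenon M post \<Phi> \<Psi> v)))"
proof -
  interpret white_noise M \<epsilon>
    using \<open>prob_space M\<close> \<open>iid_std_normal M \<epsilon>\<close> by (simp add: white_noise_def white_noise_axioms_def)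
  note s = \<open>s > 0\<close> and sob = \<open>\<theta>0 \<in> sobolev s\<close>
  have v: "v > 0"
  proof -
    obtain \<mu> where \<mu>: "\<mu> \<ge> 1" "\<theta>0 \<mu> \<noteq> 0" using \<open>\<exists>\<mu>\<ge>1. \<theta>0 \<mu> \<noteq> 0\<close> by blast
    have "0 < (\<theta>0 \<mu>)\<^sup>2" using \<mu> by simp
    also have "\<dots> \<le> (\<Sum>\<nu>=1..\<mu>. (\<theta>0 \<nu>)\<^sup>2)" using \<mu> by (intro member_le_sum) auto
    also have "\<dots> \<le> (l2_norm \<theta>0)\<^sup>2" by (rule sobolev_tail(1)[OF s sob \<mu>(1)])
    finally show ?thesis by (simp add: v_def)
  qed
  have pinf: "filterlim (\<lambda>N. real (p N)) at_top sequentially"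
    by (rule sobolev_dimension_tendsto[OF s]) fact
  have p1: "\<forall>\<^sub>F N in sequentially. 1 \<le> p N"
    using filterlim_at_top[THEN iffD1, OF pinf, rule_format, of 1] by simp
  \<comment> \<open>The rate is a variable bound by an equation, so that reflexivity supplies it at
    the point of use; its convergence to 0 is recorded alongside, to pass from O_p to o_p.\<close>
  have part1: "is_Op M (bvm_dist (\<lambda>N \<omega>. posterior N (p N) (product_prior H (p N) (\<sigma> N)) (Y N \<omega>))
          (\<lambda>N \<omega>. Phi_product H N (p N) (\<sigma> N) (Y N \<omega>)) \<Psi> v) r \<and> r \<longlonglongrightarrow> 0"
    if H: "\<forall>x. H differentiable (at x)" "\<forall>x. deriv H differentiable (at x)"
      "bounded (range (deriv H))" "bounded (range (deriv (deriv H)))"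
      and o: "(\<lambda>N. real (p N)) \<in> o(\<lambda>N. real N / ln (real N))"
      and \<sigma>pos: "\<forall>N\<ge>1. \<forall>\<mu>\<in>{1..p N}. \<sigma> N \<mu> > 0"
      and \<sigma>o: "(\<lambda>N. real N powr (-1/2)) \<in> o(\<lambda>N. Min (\<sigma> N ` {1..p N}))"
      and r: "r = (\<lambda>N. real (p N) powr (-s) + sqrt (real (p N) * ln (real N) / real N)
                    + 1 / (real N * (Min (\<sigma> N ` {1..p N}))\<^sup>2) + sqrt (real (p N)) / (real N * Min (\<sigma> N ` {1..p N})))"
    for H r
  proof -
    define \<sigma>0 where "\<sigma>0 N = Min (\<sigma> N ` {1..p N})" for N
    have dH: "(H has_real_derivative deriv H x) (at x)" for x
      using H(1) by (metis DERIV_deriv_iff_real_differentiable)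
    have dH': "(deriv H has_real_derivative deriv (deriv H) x) (at x)" for x
      using H(2) by (metis DERIV_deriv_iff_real_differentiable)
    obtain a where a: "\<And>x. \<bar>deriv H x\<bar> \<le> a" using H(3) by (auto simp: bounded_iff)
    obtain b where b: "\<And>x. \<bar>deriv (deriv H) x\<bar> \<le> b" using H(4) by (auto simp: bounded_iff)
    have a0: "a \<ge> 0" and b0: "b \<ge> 0" using a[of 0] b[of 0] by linarith+
    note pN = dimension_le_sample_size[OF o]
    \<comment> \<open>Once p is at least 1 the minimum is over a nonempty set and is attained by a
      positive scale.\<close>
    have pos: "\<forall>\<^sub>F N in sequentially. \<sigma>0 N > 0"
      using p1 eventually_ge_at_top[of 1]
    proof eventually_elim
      case (elim N)
      then show ?case using \<sigma>pos by (auto simp: \<sigma>0_def)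
    qed
    note u = scale_rate_tendsto[OF \<sigma>o[folded \<sigma>0_def] pos pN]
    have r': "r = (\<lambda>N. real (p N) powr (-s) + sqrt (real (p N) * ln (real N) / real N)
                    + 1 / (real N * (\<sigma>0 N)\<^sup>2) + sqrt (real (p N)) / (real N * \<sigma>0 N))"
      unfolding r \<sigma>0_def ..
    have lim: "r \<longlonglongrightarrow> 0"
      using tendsto_add[OF tendsto_add[OF base_rate_tendsto[OF s pinf o] u(1)] u(2)] by (simp add: r')
    have u1: "\<forall>\<^sub>F N in sequentially. 1 / (real N * (\<sigma>0 N)\<^sup>2) < 1"
      by (rule order_tendstoD(2)[OF u(1)]) simp
    have u2: "\<forall>\<^sub>F N in sequentially. b * (1 / (real N * (\<sigma>0 N)\<^sup>2)) < 1"
      by (rule order_tendstoD(2)[OF tendsto_mult_right_zero[OF u(1)]]) simp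
    define K where "K = 4 / v * (29 + 7 * a\<^sup>2 + 4 * a + 8 * b)"
    have K: "K \<ge> 0" using v a0 b0 by (simp add: K_def)
    have "is_Op M (bvm_dist (\<lambda>N \<omega>. posterior N (p N) (product_prior H (p N) (\<sigma> N)) (Y N \<omega>))
          (\<lambda>N \<omega>. Phi_product H N (p N) (\<sigma> N) (Y N \<omega>)) \<Psi> v) r"
    \<comment> \<open>No weighted sum occurs here: the bound on H'' lets the rate itself carry the
      factor 1 / (N \<sigma>0^2) in front of the energy.\<close>
    proof (rule is_Op_of_energy_bound[OF s sob K, where \<tau>="\<lambda>_ _. 0" and p=p and v=v])
      show "v = 4 * (l2_norm \<theta>0)\<^sup>2" by (simp add: v_def)
      show "\<forall>\<^sub>F N in sequentially. 1 \<le> p N \<and> p N \<le> N" using p1 pN by eventually_elim simp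
      show "\<forall>\<^sub>F N in sequentially. real (p N) powr (- s) + sqrt (real (p N) * ln (real N) / real N) \<le> r N"
        using pos by eventually_elim (simp add: r')
      then show "\<forall>\<^sub>F N in sequentially. (\<Sum>\<mu>=1..p N. 0 * ((\<theta>0 \<mu>)\<^sup>2 + 1 / real N)) \<le> K * r N"
        using p1 pN eventually_ge_at_top[of 3]
      proof eventually_elim
        case (elim N)
        then have "r N \<ge> 0"
          using log_rate_bounds(1)[of N "p N"] powr_ge_zero[of "real (p N)" "- s"] by linarith
        then show ?case using K by simp
      qed
      show "\<forall>\<^sub>F N in sequentially. \<forall>\<omega>. \<bar>bvm_dist (\<lambda>N \<omega>. posterior N (p N) (product_prior H (p N) (\<sigma> N)) (Y N \<omega>))
          (\<lambda>N \<omega>. Phi_product H N (p N) (\<sigma> N) (Y N \<omega>)) \<Psi> v N \<omega>\<bar> \<le>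
        K * (r N * (1 + (\<Sum>\<mu>=1..p N. (obs \<theta>0 \<epsilon> N \<omega> \<mu>)\<^sup>2)) + (\<Sum>\<mu>=1..p N. 0 * (obs \<theta>0 \<epsilon> N \<omega> \<mu>)\<^sup>2)
          + \<bar>4 * (\<Sum>\<mu>=1..p N. (obs \<theta>0 \<epsilon> N \<omega> \<mu>)\<^sup>2) - v\<bar>)"
        using p1 pN pos u1 u2 eventually_ge_at_top[of 3]
      proof eventually_elim
        case (elim N)
        have "\<sigma>0 N \<le> \<sigma> N i" if "i \<in> {1..p N}" for i
          unfolding \<sigma>0_def using that by (intro Min_le) auto
        note bound = product_posterior_rate[OF elim(6) elim(1,2) v dH dH' a b elim(3) this
            less_imp_le[OF elim(4)] less_imp_le[OF elim(5)] fun_cong[OF r']]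
        show ?case using bound unfolding bvm_dist_def Y_def \<Psi>_def K_def by simp
      qed
    qed
    with lim show ?thesis by blast
  qed
  have part2: "is_Op M (bvm_dist (\<lambda>N \<omega>. posterior N (p N) (gaussian_prior (p N) (\<sigma> N)) (Y N \<omega>))
          (\<lambda>N \<omega>. Phi_gaussian N (p N) (\<sigma> N) (Y N \<omega>)) \<Psi> v) r \<and> r \<longlonglongrightarrow> 0"
    if c: "c > 0" and \<sigma>c: "\<forall>N\<ge>1. \<forall>\<mu>\<in>{1..p N}. \<sigma> N \<mu> \<ge> c * max (real N powr (-1/2)) \<bar>\<theta>0 \<mu>\<bar>"
      and o: "(\<lambda>N. real (p N)) \<in> o(\<lambda>N. real N / ln (real N))"
      and r: "r = (\<lambda>N. real (p N) powr (-s) + sqrt (real (p N) * ln (real N) / real N))"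
    for c r
  proof -
    note pN = dimension_le_sample_size[OF o]
    have lim: "r \<longlonglongrightarrow> 0" using base_rate_tendsto[OF s pinf o] by (simp add: r)
    \<comment> \<open>One constant for two purposes: the first summand is that of the bound at fixed
      data, the second that of the mean of the weighted sum.\<close>
    define K where "K = 4 / v * (8 * (1 + 1 / c\<^sup>2)) + 2 / c\<^sup>2"
    have K0: "4 / v * (8 * (1 + 1 / c\<^sup>2)) \<ge> 0" "2 / c\<^sup>2 \<ge> 0" using v by simp_all
    then have K: "K \<ge> 0" by (simp add: K_def)
    have \<sigma>: "\<sigma> N i > 0" "(\<sigma> N i)\<^sup>2 \<ge> c\<^sup>2 / real N" "(\<sigma> N i)\<^sup>2 \<ge> c\<^sup>2 * (\<theta>0 i)\<^sup>2"
      if "N \<ge> 1" "i \<in> {1..p N}" for N i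
    proof -
      have w: "real N powr (-1/2) > 0" "(real N powr (-1/2))\<^sup>2 = 1 / real N"
        using that by (simp_all add: power2_eq_square powr_add[symmetric] powr_minus_divide)
      have "c * real N powr (-1/2) \<le> c * max (real N powr (-1/2)) \<bar>\<theta>0 i\<bar>"
        and "c * \<bar>\<theta>0 i\<bar> \<le> c * max (real N powr (-1/2)) \<bar>\<theta>0 i\<bar>"
        using c by (intro mult_left_mono; simp)+
      then have *: "c * real N powr (-1/2) \<le> \<sigma> N i" "c * \<bar>\<theta>0 i\<bar> \<le> \<sigma> N i"
        using \<sigma>c that by fastforce+
      have "c * real N powr (-1/2) > 0" using c w by simp
      with * show "\<sigma> N i > 0" by linarith
      show "(\<sigma> N i)\<^sup>2 \<ge> c\<^sup>2 / real N"
        using power_mono[OF *(1), of 2] c w by (simp add: power_mult_distrib)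
      show "(\<sigma> N i)\<^sup>2 \<ge> c\<^sup>2 * (\<theta>0 i)\<^sup>2"
        using power_mono[OF *(2), of 2] c by (simp add: power_mult_distrib)
    qed
    have "is_Op M (bvm_dist (\<lambda>N \<omega>. posterior N (p N) (gaussian_prior (p N) (\<sigma> N)) (Y N \<omega>))
          (\<lambda>N \<omega>. Phi_gaussian N (p N) (\<sigma> N) (Y N \<omega>)) \<Psi> v) r"
    proof (rule is_Op_of_energy_bound[OF s sob K, where \<tau>="\<lambda>N \<mu>. 1 / (N * (\<sigma> N \<mu>)\<^sup>2)" and p=p and v=v])
      show "v = 4 * (l2_norm \<theta>0)\<^sup>2" by (simp add: v_def)
      show "\<forall>\<^sub>F N in sequentially. 1 \<le> p N \<and> p N \<le> N" using p1 pN by eventually_elim simp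
      show "\<forall>\<^sub>F N in sequentially. real (p N) powr (- s) + sqrt (real (p N) * ln (real N) / real N) \<le> r N"
        by (simp add: r)
      show "\<forall>\<^sub>F N in sequentially. (\<Sum>\<mu>=1..p N. 1 / (N * (\<sigma> N \<mu>)\<^sup>2) * ((\<theta>0 \<mu>)\<^sup>2 + 1 / real N)) \<le> K * r N"
        using p1 pN eventually_ge_at_top[of 3]
      proof eventually_elim
        case (elim N)
        note \<rho> = log_rate_bounds[OF elim(3,1,2)]
        have rN: "real (p N) / real N \<le> r N" "r N \<ge> 0"
          using \<rho>(1,3) powr_ge_zero[of "real (p N)" "- s"] unfolding r by linarith+
        have "(\<Sum>\<mu>=1..p N. 1 / (N * (\<sigma> N \<mu>)\<^sup>2) * ((\<theta>0 \<mu>)\<^sup>2 + 1 / real N)) \<le> (\<Sum>\<mu>=1..p N. 2 / (c\<^sup>2 * real N))"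
        proof (rule sum_mono)
          fix \<mu> assume \<mu>: "\<mu> \<in> {1..p N}"
          have N1: "N \<ge> 1" using elim by simp
          \<comment> \<open>The two lower bounds on \<sigma>, by |\<theta>0| and by N^(-1/2), match
            the two parts of the second moment of an observation. Each coordinate then costs at most
            2 / (c^2 N), in total a multiple of p / N.\<close>
          have "c\<^sup>2 * ((\<theta>0 \<mu>)\<^sup>2 + 1 / real N) \<le> 2 * (\<sigma> N \<mu>)\<^sup>2"
            using \<sigma>(2,3)[OF N1 \<mu>] by (simp add: distrib_left)
          then show "1 / (N * (\<sigma> N \<mu>)\<^sup>2) * ((\<theta>0 \<mu>)\<^sup>2 + 1 / real N) \<le> 2 / (c\<^sup>2 * real N)"
            using \<sigma>(1)[OF N1 \<mu>] c N1 by (simp add: divide_simps mult_ac)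
        qed
        also have "\<dots> = 2 / c\<^sup>2 * (real (p N) / real N)" by simp
        also have "\<dots> \<le> 2 / c\<^sup>2 * r N" using rN by (intro mult_left_mono) auto
        also have "\<dots> \<le> K * r N" using rN K0 by (intro mult_right_mono) (auto simp: K_def)
        finally show ?case .
      qed
      show "\<forall>\<^sub>F N in sequentially. \<forall>\<omega>. \<bar>bvm_dist (\<lambda>N \<omega>. posterior N (p N) (gaussian_prior (p N) (\<sigma> N)) (Y N \<omega>))
          (\<lambda>N \<omega>. Phi_gaussian N (p N) (\<sigma> N) (Y N \<omega>)) \<Psi> v N \<omega>\<bar> \<le>
        K * (r N * (1 + (\<Sum>\<mu>=1..p N. (obs \<theta>0 \<epsilon> N \<omega> \<mu>)\<^sup>2)) + (\<Sum>\<mu>=1..p N. 1 / (N * (\<sigma> N \<mu>)\<^sup>2) * (obs \<theta>0 \<epsilon> N \<omega> \<mu>)\<^sup>2)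
          + \<bar>4 * (\<Sum>\<mu>=1..p N. (obs \<theta>0 \<epsilon> N \<omega> \<mu>)\<^sup>2) - v\<bar>)"
        using p1 pN eventually_ge_at_top[of 3]
      proof eventually_elim
        case (elim N)
        have N1: "N \<ge> 1" using elim by simp
        have rN: "r N \<ge> 0"
          using log_rate_bounds(1)[OF elim(3,1,2)] powr_ge_zero[of "real (p N)" "- s"] unfolding r by linarith
        show ?case
        proof
          fix \<omega>
          let ?D = "r N * (1 + (\<Sum>\<mu>=1..p N. (obs \<theta>0 \<epsilon> N \<omega> \<mu>)\<^sup>2)) + (\<Sum>\<mu>=1..p N. 1 / (N * (\<sigma> N \<mu>)\<^sup>2) * (obs \<theta>0 \<epsilon> N \<omega> \<mu>)\<^sup>2)
            + \<bar>4 * (\<Sum>\<mu>=1..p N. (obs \<theta>0 \<epsilon> N \<omega> \<mu>)\<^sup>2) - v\<bar>"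
          have "?D \<ge> 0" using rN by (intro add_nonneg_nonneg mult_nonneg_nonneg sum_nonneg) auto
          then have "4 / v * (8 * (1 + 1 / c\<^sup>2)) * ?D \<le> K * ?D"
            using K0 by (intro mult_right_mono) (auto simp: K_def)
          with gaussian_posterior_rate[OF elim(3) elim(1,2) v c \<sigma>(1,2)[OF N1] fun_cong[OF r]]
          show "\<bar>bvm_dist (\<lambda>N \<omega>. posterior N (p N) (gaussian_prior (p N) (\<sigma> N)) (Y N \<omega>))
              (\<lambda>N \<omega>. Phi_gaussian N (p N) (\<sigma> N) (Y N \<omega>)) \<Psi> v N \<omega>\<bar> \<le> K * ?D"
            unfolding bvm_dist_def Y_def \<Psi>_def by (rule order_trans)
        qed
      qed
    qed
    with lim show ?thesis by blast
  qed
  show ?thesis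
    unfolding Let_def bvm_phenomenon_def
  proof (intro conjI allI impI)
    fix H :: "real \<Rightarrow> real"
    assume "\<forall>x. H differentiable (at x)" "\<forall>x. deriv H differentiable (at x)"
      "bounded (range (deriv H))" "bounded (range (deriv (deriv H)))"
      "(\<lambda>N. real (p N)) \<in> o(\<lambda>N. real N / ln (real N))"
      "\<forall>N\<ge>1. \<forall>\<mu>\<in>{1..p N}. \<sigma> N \<mu> > 0"
      "(\<lambda>N. real N powr (-1/2)) \<in> o(\<lambda>N. Min (\<sigma> N ` {1..p N}))"
    note 1 = part1[OF this refl]
    show "is_Op M (bvm_dist (\<lambda>N \<omega>. posterior N (p N) (product_prior H (p N) (\<sigma> N)) (Y N \<omega>))
          (\<lambda>N \<omega>. Phi_product H N (p N) (\<sigma> N) (Y N \<omega>)) \<Psi> v)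
        (\<lambda>N. real (p N) powr (-s) + sqrt (real (p N) * ln (real N) / real N)
          + 1 / (real N * (Min (\<sigma> N ` {1..p N}))\<^sup>2) + sqrt (real (p N)) / (real N * Min (\<sigma> N ` {1..p N})))"
      using 1 by blast
    show "is_op M (bvm_dist (\<lambda>N \<omega>. posterior N (p N) (product_prior H (p N) (\<sigma> N)) (Y N \<omega>))
          (\<lambda>N \<omega>. Phi_product H N (p N) (\<sigma> N) (Y N \<omega>)) \<Psi> v) (\<lambda>_. 1)"
      using 1 is_op_of_is_Op by blast
    then show "is_op M (bvm_dist (\<lambda>N \<omega>. posterior N (p N) (product_prior H (p N) (\<sigma> N)) (Y N \<omega>))
          (\<lambda>N \<omega>. Phi_product H N (p N) (\<sigma> N) (Y N \<omega>)) \<Psi> v) (\<lambda>_. 1)" .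
  next
    fix c :: real
    assume "c > 0" "\<forall>N\<ge>1. \<forall>\<mu>\<in>{1..p N}. \<sigma> N \<mu> \<ge> c * max (real N powr (-1/2)) \<bar>\<theta>0 \<mu>\<bar>"
      "(\<lambda>N. real (p N)) \<in> o(\<lambda>N. real N / ln (real N))"
    note 2 = part2[OF this refl]
    show "is_Op M (bvm_dist (\<lambda>N \<omega>. posterior N (p N) (gaussian_prior (p N) (\<sigma> N)) (Y N \<omega>))
          (\<lambda>N \<omega>. Phi_gaussian N (p N) (\<sigma> N) (Y N \<omega>)) \<Psi> v)
        (\<lambda>N. real (p N) powr (-s) + sqrt (real (p N) * ln (real N) / real N))"
      using 2 by blast
    show "is_op M (bvm_dist (\<lambda>N \<omega>. posterior N (p N) (gaussian_prior (p N) (\<sigma> N)) (Y N \<omega>))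
          (\<lambda>N \<omega>. Phi_gaussian N (p N) (\<sigma> N) (Y N \<omega>)) \<Psi> v) (\<lambda>_. 1)"
      using 2 is_op_of_is_Op by blast
    then show "is_op M (bvm_dist (\<lambda>N \<omega>. posterior N (p N) (gaussian_prior (p N) (\<sigma> N)) (Y N \<omega>))
          (\<lambda>N \<omega>. Phi_gaussian N (p N) (\<sigma> N) (Y N \<omega>)) \<Psi> v) (\<lambda>_. 1)" .
  \<comment> \<open>What is left are the positivity conditions on the variance in the two BvM
    statements.\<close>
  qed (rule v)+
qed

end
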